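(* Consider the block-issuance model and the stationary marked point process $\Psi$ with Palm probability $\mathbb P^0$ (expectation $\mathbb E^0$) described in the context, with $k\ge2$, and let $W_0$ be the observer-tip lifetime mark of the block issued at time $T_0=0$ under $\mathbb P^0$. Let $\pi$ be the invariant probability measure of the embedded chain. Then \[ \pi(X^{(o)}):=\int X^{(o)}(y)\,\pi(dy)=\lambda\,\mathbb E^0[W_0]. \] Equivalently, if $(\bar X_t^{(o)})_{t\in\mathbb R}$ denotes the time-stationary observer tip-count process associated with $\Psi$, then \[ \mathbb E[\bar X_0^{(o)}]=\lambda\,\mathbb E^0[W_0]=\pi(X^{(o)}). \] In particular, $\mathbb E^0[W_0]<\infty$.
   Context: **Model.** Let $\mathcal N=\{1,\dots,N\}$ be a finite set of nodes, $k\ge2$ an integer, $\lambda>0$ and $0\le\Delta<\infty$. Blocks are issued at times $0<t_1<t_2<\cdots$ forming a homogeneous Poisson process on $\mathbb R_+$ with rate $\lambda$; put $t_0:=0$. Block $n\ge1$, issued at $t_n$, carries a mark $\kappa_n=(\mathrm{blockID}_n,\mathrm{Ref}_n,\mathrm{nodeID}_n,\mathrm{delay}_n)$, where: - $\mathrm{blockID}_n$ are i.i.d. $\mathrm{Unif}[0,1]$, independent of the Poisson process (hence a.s. distinct); blocks are identified with their identifiers; - the issuers $\mathrm{nodeID}_n$ are i.i.d. $\mathcal N$-valued, independent of everything else; - $\mathrm{delay}_n=(\mathrm{delay}_n(j))_{j\in\mathcal N}$, where $\mathrm{delay}_n(j)\ge0$ is the time after $t_n$ until node $j$ receives block $n$.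 Delays are i.i.d. across blocks: if the issuer is $i$, the vector is drawn from a law depending only on $i$, with $j$-th coordinate distributed as $\Delta_i(j)$, and $\mathrm{delay}_n(i)=0$ for the issuer $i$. Conditional on $(t_m,\mathrm{blockID}_m,\mathrm{nodeID}_m)_{m\le n}$, $\mathrm{delay}_n$ is independent of the past. Partial synchrony: $\mathbb P(\Delta_i(j)\le\Delta)=1$ for all $i,j\in\mathcal N$; - $\mathrm{Ref}_n$ is the list of earlier blocks referenced by block $n$, defined below. There is a genesis block $\star$, visible to all nodes from time $0$. Messages with arrival time at most $t_n$ are processed before block $n$ is issued. For $i\in\mathcal N$, the pre-issuance local tip pool is \[\mathrm{pool}_n^-(i)=\Bigl(\{\star\}\cup\{\mathrm{blockID}_m: m<n,\ t_m+\mathrm{delay}_m(i)\le t_n\}\Bigr)\setminus\bigcup_{m<n:\,t_m+\mathrm{delay}_m(i)\le t_n}\{\text{entries of }\mathrm{Ref}_m\}.\] $\mathrm{Ref}_n$ consists of $\min\{k,|\mathrm{pool}_n^-(\mathrm{nodeID}_n)|\}$ distinct elements sampled uniformly without replacement from $\mathrm{pool}_n^-(\mathrm{nodeID}_n)$. The post-issuance local tip pool $\mathrm{pool}_n(i)$ is defined by the same formula with $m<n$ replaced by $m\le n$. The observer tip pool is $\mathrm{pool}_n^{(o)}=\bigl(\{\star\}\cup\{\mathrm{blockID}_1,\dots,\mathrm{blockID}_n\}\bigr)\setminus\bigcup_{m=1}^n\{\text{entries of }\mathrm{Ref}_m\}$. At $n=0$ all pools equal $\{\star\}$. **Embedded chain.**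 The augmented embedded state is \[\mathsf Y_n=\Bigl(\mathrm{pool}_n^{(o)},(\mathrm{pool}_n(i))_{i\in\mathcal N},\bigl((t_n-t_m,\kappa_m)\bigr)_{m\le n:\,t_m\in(t_n-\Delta,t_n]}\Bigr).\] With $\widehat{\mathsf B}=\{\star\}\sqcup[0,1]$, each finite tip pool is encoded as an increasing tuple in $\widehat{\mathsf B}$ (with $\star$ smallest), marks lie in $\mathsf K=\widehat{\mathsf B}\times\bigl(\bigsqcup_{r=0}^k\widehat{\mathsf B}^r\bigr)\times\mathcal N\times[0,\Delta]^N$, and the recent marked configuration lies in $\bigsqcup_{m\ge0}([0,\Delta]\times\mathsf K)^m$; the state space is the measurable (standard Borel) set of admissible such tuples, i.e. those that can be generated by the protocol dynamics. $(\mathsf Y_n)$ is a time-homogeneous Markov chain, it is positive Harris recurrent, and $\pi$ denotes its unique invariant probability measure. $X^{(o)}(y)$ is the size of the observer pool in state $y$. **Stationary version.** Take the two-sided stationary issuance-by-issuance evolution $(\mathsf Y_n)_{n\in\mathbb Z}$ with one-dimensional marginal $\pi$, with issuance times $(T_n)_{n\in\mathbb Z}$, $T_0=0$, in which each transition is driven by a fresh $\mathrm{Exp}(\lambda)$ inter-arrival gap $T_{n+1}-T_n$ (independent of the current post-issuance state), issuer identity, block identifier, delay vector and reference selection as in the model. The observer-tip lifetime of block $n$ is $W_n=\inf\{T_m:\ m>n,\ \mathrm{blockID}_n\in\mathrm{Ref}_m\}-T_n\in[0,\infty]$ (with $\inf\emptyset=\infty$). The law of this evolution is the Palm version $\mathbb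 P^0$ of a time-stationary marked point process $\Psi=\sum_{n\in\mathbb Z}\delta_{(T_n,W_n)}$ on $\mathbb R\times[0,\infty]$ with intensity $\lambda$; under $\mathbb P^0$, $T_0=0$ a.s., the post-issuance embedded state at time $0$ has law $\pi$, and $T_1-T_0\sim\mathrm{Exp}(\lambda)$ is independent of it. The associated time-stationary observer tip-count process $\bar X_t^{(o)}$, $t\in\mathbb R$, is the number of observer tips present at time $t$: it is constant between issuances, equals the post-issuance observer tip count at issuances, and the block issued at $T_n$ is an observer tip exactly during $[T_n,T_n+W_n)$. *)

theory Defs
  imports "HOL-Probability.Probability"
begin

section \<open>Blocks, marks and pools\<close>

text \<open>
  Nodes are the elements of a finite type \<open>'n\<close>.  The identifier space (the genesis block together
  with \<open>[0,1]\<close>) is represented inside the reals, with \<open>-1\<close> as genesis: this keeps both the Borel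
  structure and the convention that genesis is the smallest identifier.
\<close>

type_synonym block = real
type_synonym 'n mark = "block \<times> block list \<times> 'n \<times> ('n \<Rightarrow> real)"

definition genesis :: block where
  "genesis = -1"

definition blockID :: "'n mark \<Rightarrow> block" where
  "blockID \<kappa> = fst \<kappa>"

definition refs :: "'n mark \<Rightarrow> block list" where
  "refs \<kappa> = fst (snd \<kappa>)"

definition nodeID :: "'n mark \<Rightarrow> 'n" where
  "nodeID \<kappa> = fst (snd (snd \<kappa>))"

definition delay :: "'n mark \<Rightarrow> 'n \<Rightarrow> real" where
  "delay \<kappa> = snd (snd (snd \<kappa>))"

text \<open>
  A history is the chronological list of the pairs (issuance time, mark).  With
  \<open>h = [(t\<^sub>1,\<kappa>\<^sub>1), \<dots>, (t\<^sub>n,\<kappa>\<^sub>n)]\<close>, the post-issuance pool of node \<open>i\<close> is \<open>local_pool h i t\<^sub>n\<close>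
  and the pre-issuance pool at the next issuance time \<open>t\<close> is \<open>local_pool h i t\<close>.
\<close>

type_synonym 'n history = "(real \<times> 'n mark) list"

definition received :: "'n history \<Rightarrow> 'n \<Rightarrow> real \<Rightarrow> 'n mark set" where
  "received h i t = {\<kappa>. \<exists>s. (s, \<kappa>) \<in> set h \<and> s + delay \<kappa> i \<le> t}"

definition local_pool :: "'n history \<Rightarrow> 'n \<Rightarrow> real \<Rightarrow> block set" where
  "local_pool h i t =
     ({genesis} \<union> blockID ` received h i t) - (\<Union>\<kappa>\<in>received h i t. set (refs \<kappa>))"

definition observer_pool :: "'n history \<Rightarrow> block set" where
  "observer_pool h =
     ({genesis} \<union> blockID ` snd ` set h) - (\<Union>\<kappa>\<in>snd ` set h. set (refs \<kappa>))"

definition ref_choices :: "nat \<Rightarrow> block set \<Rightarrow> block list set" where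
  "ref_choices k P = {r. distinct r \<and> set r \<subseteq> P \<and> length r = min k (card P)}"

definition last_time :: "'n history \<Rightarrow> real" where
  "last_time h = (if h = [] then 0 else fst (last h))"

inductive valid_history :: "nat \<Rightarrow> real \<Rightarrow> 'n history \<Rightarrow> bool" for k :: nat and \<Delta> :: real where
  valid_Nil: "valid_history k \<Delta> []"
| valid_snoc: "\<lbrakk>valid_history k \<Delta> h; last_time h < t;
     b \<in> {0..1}; b \<notin> blockID ` snd ` set h;
     \<forall>j. 0 \<le> d j \<and> d j \<le> \<Delta>; d i = 0;
     r \<in> ref_choices k (local_pool h i t)\<rbrakk>
   \<Longrightarrow> valid_history k \<Delta> (h @ [(t, (b, r, i, d))])"


section \<open>The embedded chain\<close>

text \<open>
  A state consists of the observer pool, the local pools (both as increasing lists), and the list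
  of (age, mark) of the blocks issued during the last \<open>\<Delta>\<close> time units.
\<close>

type_synonym 'n state = "block list \<times> ('n \<Rightarrow> block list) \<times> (real \<times> 'n mark) list"

definition embed_state :: "real \<Rightarrow> 'n history \<Rightarrow> 'n state" where
  "embed_state \<Delta> h =
     (sorted_list_of_set (observer_pool h),
      (\<lambda>i. sorted_list_of_set (local_pool h i (last_time h))),
      map (\<lambda>(s, \<kappa>). (last_time h - s, \<kappa>))
        (filter (\<lambda>(s, \<kappa>). s \<in> {last_time h - \<Delta> <.. last_time h}) h))"

definition admissible :: "nat \<Rightarrow> real \<Rightarrow> 'n state \<Rightarrow> bool" where
  "admissible k \<Delta> y \<longleftrightarrow> (\<exists>h. valid_history k \<Delta> h \<and> y = embed_state \<Delta> h)"

definition obs_tips :: "'n state \<Rightarrow> nat" where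
  "obs_tips y = length (fst y)"

text \<open>
  The one-step dynamics on states.  A block in transit to some node was issued less than \<open>\<Delta>\<close> ago,
  and so was every later block; hence the blocks listed in the state suffice to update the pools,
  also when a block arrives after a block that references it.  The lemmas \<open>pre_pool_embed\<close> and
  \<open>update_embed\<close> below state that these maps agree with the pools of the full history.
\<close>

definition deliver :: "block set \<Rightarrow> (real \<times> 'n mark) list \<Rightarrow> 'n \<Rightarrow> block set" where
  "deliver P R i =
     (let A = {\<kappa>. \<exists>a. (a, \<kappa>) \<in> set R \<and> delay \<kappa> i \<le> a}
      in (P \<union> blockID ` A) - (\<Union>\<kappa>\<in>A. set (refs \<kappa>)))"

definition aged :: "real \<Rightarrow> (real \<times> 'n mark) list \<Rightarrow> (real \<times> 'n mark) list" where
  "aged g R = map (\<lambda>(a, \<kappa>). (a + g, \<kappa>)) R"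

definition pre_pool :: "'n state \<Rightarrow> real \<Rightarrow> 'n \<Rightarrow> block set" where
  "pre_pool y g i = (case y of (Ob, L, R) \<Rightarrow> deliver (set (L i)) (aged g R) i)"

definition update :: "real \<Rightarrow> 'n state \<Rightarrow> real \<Rightarrow> 'n mark \<Rightarrow> 'n state" where
  "update \<Delta> y g \<kappa> = (case y of (Ob, L, R) \<Rightarrow>
     let R' = aged g R @ [(0, \<kappa>)]
     in (sorted_list_of_set ((set Ob \<union> {blockID \<kappa>}) - set (refs \<kappa>)),
         (\<lambda>i. sorted_list_of_set (deliver (set (L i)) R' i)),
         filter (\<lambda>(a, _). a < \<Delta>) R'))"

text \<open>Disjoint union of the finite powers of \<open>M\<close>, generated by the measurable boxes.\<close>

definition list_space :: "'a measure \<Rightarrow> 'a list measure" where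
  "list_space M = sigma (lists (space M)) {listset As | As. set As \<subseteq> sets M}"

definition mark_space :: "('n::finite) mark measure" where
  "mark_space = borel \<Otimes>\<^sub>M list_space borel \<Otimes>\<^sub>M count_space UNIV \<Otimes>\<^sub>M (\<Pi>\<^sub>M j\<in>UNIV. borel)"

definition state_space :: "('n::finite) state measure" where
  "state_space =
     list_space borel \<Otimes>\<^sub>M (\<Pi>\<^sub>M i\<in>UNIV. list_space borel) \<Otimes>\<^sub>M list_space (borel \<Otimes>\<^sub>M mark_space)"

text \<open>
  Joint law of the next inter-arrival gap and the next mark, given the current state;
  \<open>\<nu>\<close> is the law of the issuer and \<open>D i\<close> the law of the delay vector of a block issued by \<open>i\<close>.
\<close>

definition innovation ::
    "nat \<Rightarrow> real \<Rightarrow> 'n pmf \<Rightarrow> ('n \<Rightarrow> ('n \<Rightarrow> real) measure) \<Rightarrow> ('n::finite) state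
     \<Rightarrow> (real \<times> 'n mark) measure" where
  "innovation k rate \<nu> D y = do {
     g \<leftarrow> density lborel (exponential_density rate);
     b \<leftarrow> uniform_measure lborel {0..1};
     i \<leftarrow> measure_pmf \<nu>;
     d \<leftarrow> D i;
     r \<leftarrow> measure_pmf (pmf_of_set (ref_choices k (pre_pool y g i)));
     return (borel \<Otimes>\<^sub>M mark_space) (g, (b, r, i, d))
   }"

definition transition ::
    "nat \<Rightarrow> real \<Rightarrow> real \<Rightarrow> 'n pmf \<Rightarrow> ('n \<Rightarrow> ('n \<Rightarrow> real) measure) \<Rightarrow> ('n::finite) state
     \<Rightarrow> 'n state measure" where
  "transition k \<Delta> rate \<nu> D y =
     distr (innovation k rate \<nu> D y) state_space (\<lambda>(g, \<kappa>). update \<Delta> y g \<kappa>)"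

definition invariant_distribution ::
    "nat \<Rightarrow> real \<Rightarrow> real \<Rightarrow> 'n pmf \<Rightarrow> ('n \<Rightarrow> ('n \<Rightarrow> real) measure)
     \<Rightarrow> ('n::finite) state measure \<Rightarrow> bool" where
  "invariant_distribution k \<Delta> rate \<nu> D \<pi> \<longleftrightarrow>
     prob_space \<pi> \<and> sets \<pi> = sets state_space \<and> (AE y in \<pi>. admissible k \<Delta> y) \<and>
     (\<forall>A\<in>sets state_space. emeasure \<pi> A = (\<integral>\<^sup>+ y. emeasure (transition k \<Delta> rate \<nu> D y) A \<partial>\<pi>))"


section \<open>Two-sided evolutions\<close>

text \<open>A path records \<open>(T\<^sub>n, Y\<^sub>n, \<kappa>\<^sub>n)\<close> for all integers \<open>n\<close>.\<close>

type_synonym 'n path = "int \<Rightarrow> real \<times> 'n state \<times> 'n mark"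

definition path_space :: "('n::finite) path measure" where
  "path_space = (\<Pi>\<^sub>M n\<in>UNIV. borel \<Otimes>\<^sub>M state_space \<Otimes>\<^sub>M mark_space)"

definition time_at :: "'n path \<Rightarrow> int \<Rightarrow> real" where
  "time_at z n = fst (z n)"

definition state_at :: "'n path \<Rightarrow> int \<Rightarrow> 'n state" where
  "state_at z n = fst (snd (z n))"

definition mark_at :: "'n path \<Rightarrow> int \<Rightarrow> 'n mark" where
  "mark_at z n = snd (snd (z n))"

definition gap_at :: "'n path \<Rightarrow> int \<Rightarrow> real" where
  "gap_at z n = time_at z n - time_at z (n - 1)"

text \<open>
  The past up to issuance \<open>n\<close> contains the gaps, not the times: as \<open>T\<^sub>0 = 0\<close>, the times of the
  issuances before \<open>0\<close> depend on later gaps.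
\<close>

definition past_at :: "'n path \<Rightarrow> int \<Rightarrow> int \<Rightarrow> real \<times> 'n state \<times> 'n mark" where
  "past_at z n = (\<lambda>m\<in>{..n}. (gap_at z m, state_at z m, mark_at z m))"

definition past_space :: "int \<Rightarrow> (int \<Rightarrow> real \<times> ('n::finite) state \<times> 'n mark) measure" where
  "past_space n = (\<Pi>\<^sub>M m\<in>{..n}. borel \<Otimes>\<^sub>M state_space \<Otimes>\<^sub>M mark_space)"

text \<open>
  Stationarity is built into the requirement that all one-dimensional marginals equal \<open>\<pi>\<close>, because
  the conditional law of the next gap and mark given the past does not depend on \<open>n\<close>.
\<close>

definition stationary_evolution ::
    "nat \<Rightarrow> real \<Rightarrow> real \<Rightarrow> 'n pmf \<Rightarrow> ('n \<Rightarrow> ('n \<Rightarrow> real) measure) \<Rightarrow> ('n::finite) state measure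
     \<Rightarrow> 'a measure \<Rightarrow> ('a \<Rightarrow> 'n path) \<Rightarrow> bool" where
  "stationary_evolution k \<Delta> rate \<nu> D \<pi> P0 Z0 \<longleftrightarrow>
     prob_space P0 \<and> Z0 \<in> P0 \<rightarrow>\<^sub>M path_space \<and>
     (AE \<omega> in P0. time_at (Z0 \<omega>) 0 = 0) \<and>
     (\<forall>n. distr P0 state_space (\<lambda>\<omega>. state_at (Z0 \<omega>) n) = \<pi>) \<and>
     (\<forall>n. AE \<omega> in P0. state_at (Z0 \<omega>) (n + 1) =
        update \<Delta> (state_at (Z0 \<omega>) n) (gap_at (Z0 \<omega>) (n + 1)) (mark_at (Z0 \<omega>) (n + 1))) \<and>
     (\<forall>n. \<forall>A\<in>sets (past_space n). \<forall>B\<in>sets (borel \<Otimes>\<^sub>M mark_space).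
        emeasure P0 {\<omega>\<in>space P0. past_at (Z0 \<omega>) n \<in> A \<and>
                        (gap_at (Z0 \<omega>) (n + 1), mark_at (Z0 \<omega>) (n + 1)) \<in> B} =
        (\<integral>\<^sup>+ \<omega>. indicator A (past_at (Z0 \<omega>) n) *
              emeasure (innovation k rate \<nu> D (state_at (Z0 \<omega>) n)) B \<partial>P0))"

text \<open>The infimum is taken in \<open>[0,\<infinity>]\<close>, so it is \<open>\<infinity>\<close> if block \<open>n\<close> is never referenced.\<close>

definition lifetime :: "'n path \<Rightarrow> int \<Rightarrow> ennreal" where
  "lifetime z n =
     (INF m\<in>{m. n < m \<and> blockID (mark_at z n) \<in> set (refs (mark_at z m))}.
        ennreal (time_at z m - time_at z n))"

text \<open>The marked point process \<open>\<Sum>\<^sub>n \<delta>(T\<^sub>n, W\<^sub>n)\<close>, as a measure on \<open>\<real> \<times> [0,\<infinity>]\<close>.\<close>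

definition Psi :: "'n path \<Rightarrow> (real \<times> ennreal) measure" where
  "Psi z = distr (count_space UNIV) (borel \<Otimes>\<^sub>M borel) (\<lambda>n. (time_at z n, lifetime z n))"


section \<open>Time-stationary version\<close>

definition last_issue :: "'n path \<Rightarrow> real \<Rightarrow> int" where
  "last_issue z t = (THE n. time_at z n \<le> t \<and> t < time_at z (n + 1))"

definition reroot :: "real \<Rightarrow> int \<Rightarrow> 'n path \<Rightarrow> 'n path" where
  "reroot s n z = (\<lambda>m. (time_at z (n + m) - s, state_at z (n + m), mark_at z (n + m)))"

text \<open>
  Points are enumerated such that \<open>T\<^sub>0 \<le> 0 < T\<^sub>1\<close>; \<open>reroot t (last_issue z t) z\<close> is the path \<open>z\<close> seen
  from time \<open>t\<close>, enumerated by the same convention.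
\<close>

definition time_stationary ::
    "real \<Rightarrow> 'b measure \<Rightarrow> ('b \<Rightarrow> ('n::finite) path) \<Rightarrow> bool" where
  "time_stationary rate P Z \<longleftrightarrow>
     prob_space P \<and> Z \<in> P \<rightarrow>\<^sub>M path_space \<and>
     (\<forall>\<omega>\<in>space P. strict_mono (time_at (Z \<omega>)) \<and>
        filterlim (time_at (Z \<omega>)) at_top at_top \<and> filterlim (time_at (Z \<omega>)) at_bot at_bot \<and>
        time_at (Z \<omega>) 0 \<le> 0 \<and> 0 < time_at (Z \<omega>) 1) \<and>
     (\<forall>t. distr P path_space (\<lambda>\<omega>. reroot t (last_issue (Z \<omega>) t) (Z \<omega>)) = distr P path_space Z) \<and>
     (\<integral>\<^sup>+ \<omega>. emeasure (Psi (Z \<omega>)) ({0<..1} \<times> UNIV) \<partial>P) = ennreal rate"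

text \<open>
  The law of \<open>Z0\<close> under \<open>P0\<close> is the Palm distribution of the time-stationary \<open>Z\<close>, i.e.
  the law of \<open>Z\<close> seen from a typical point of the unit interval.
\<close>

definition palm_version ::
    "real \<Rightarrow> 'b measure \<Rightarrow> ('b \<Rightarrow> ('n::finite) path) \<Rightarrow> 'a measure \<Rightarrow> ('a \<Rightarrow> 'n path) \<Rightarrow> bool" where
  "palm_version rate P Z P0 Z0 \<longleftrightarrow>
     (\<forall>A\<in>sets path_space.
        ennreal rate * emeasure P0 {\<omega>\<in>space P0. Z0 \<omega> \<in> A} =
        (\<integral>\<^sup>+ \<omega>. (\<integral>\<^sup>+ n. indicator {0<..1} (time_at (Z \<omega>) n) *
                indicator A (reroot (time_at (Z \<omega>) n) n (Z \<omega>)) \<partial>count_space UNIV) \<partial>P))"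

definition tip_count :: "'n path \<Rightarrow> real \<Rightarrow> nat" where
  "tip_count z t = obs_tips (state_at z (last_issue z t))"


section \<open>The state dynamics agree with the pools of the full history\<close>

lemma finite_pools [simp]: "finite (local_pool h i t)" "finite (observer_pool h)"
proof -
  have "received h i t \<subseteq> snd ` set h"
    by (force simp: received_def)
  then have "finite (received h i t)"
    by (rule finite_subset) simp
  then show "finite (local_pool h i t)" "finite (observer_pool h)"
    by (auto simp: local_pool_def observer_pool_def)
qed

lemma valid_history_times:
  assumes "valid_history k \<Delta> h" "(s, \<kappa>) \<in> set h"
  shows "s \<le> last_time h"
  using assms
  by (induction arbitrary: s \<kappa> rule: valid_history.induct) (force simp: last_time_def split: if_splits)+

lemma valid_history_marks:
  assumes "valid_history k \<Delta> h" "(s, \<kappa>) \<in> set h"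
  shows "blockID \<kappa> \<in> {0..1}" "0 \<le> delay \<kappa> j" "delay \<kappa> j \<le> \<Delta>"
    and "set (refs \<kappa>) \<subseteq> {genesis} \<union> blockID ` snd ` set h"
proof -
  have *: "local_pool h i t \<subseteq> {genesis} \<union> blockID ` snd ` set h" for h :: "'a history" and i t
    by (force simp: local_pool_def received_def)
  have "blockID \<kappa> \<in> {0..1} \<and> 0 \<le> delay \<kappa> j \<and> delay \<kappa> j \<le> \<Delta> \<and>
      set (refs \<kappa>) \<subseteq> {genesis} \<union> blockID ` snd ` set h"
    using assms
  proof (induction arbitrary: s \<kappa> rule: valid_history.induct)
    case (valid_snoc h t b d i r)
    have r: "set r \<subseteq> {genesis} \<union> blockID ` snd ` set h"
      using valid_snoc.hyps * unfolding ref_choices_def by blast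
    show ?case
    proof (cases "(s, \<kappa>) \<in> set h")
      case True
      from valid_snoc.IH[OF this] show ?thesis by auto
    next
      case False
      then have "\<kappa> = (b, r, i, d)" using valid_snoc.prems by simp
      with valid_snoc.hyps r show ?thesis by (auto simp: blockID_def delay_def refs_def)
    qed
  qed simp
  then show "blockID \<kappa> \<in> {0..1}" "0 \<le> delay \<kappa> j" "delay \<kappa> j \<le> \<Delta>"
    and "set (refs \<kappa>) \<subseteq> {genesis} \<union> blockID ` snd ` set h" by auto
qed

lemma valid_history_refs_earlier:
  assumes "valid_history k \<Delta> h" "(s, \<kappa>) \<in> set h" "(s', \<kappa>') \<in> set h" "blockID \<kappa> \<in> set (refs \<kappa>')"
  shows "s < s'"
  using assms
proof (induction arbitrary: s \<kappa> s' \<kappa>' rule: valid_history.induct)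
  case (valid_snoc h t b d i r)
  let ?new = "(b, r, i, d)"
  have v: "valid_history k \<Delta> (h @ [(t, ?new)])"
    using valid_snoc.hyps by (rule valid_history.valid_snoc)
  have fresh: "b \<notin> {genesis} \<union> blockID ` snd ` set h"
    using valid_snoc.hyps by (auto simp: genesis_def)
  have "set r \<subseteq> {genesis} \<union> blockID ` snd ` set h"
  proof -
    have "local_pool h i t \<subseteq> {genesis} \<union> blockID ` snd ` set h"
      by (force simp: local_pool_def received_def)
    then show ?thesis using valid_snoc.hyps unfolding ref_choices_def by blast
  qed
  then have "b \<notin> set r" using fresh by blast
  moreover have "b \<notin> set (refs \<kappa>')" if "(s', \<kappa>') \<in> set h"
    using valid_history_marks(4)[OF valid_snoc.hyps(1) that] fresh by blast
  ultimately have old: "(s, \<kappa>) \<in> set h"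
    using valid_snoc.prems by (auto simp: blockID_def refs_def)
  show ?case
  proof (cases "(s', \<kappa>') \<in> set h")
    case True
    then show ?thesis using valid_snoc.IH[OF old] valid_snoc.prems by blast
  next
    case False
    then have "s' = t" using valid_snoc.prems by simp
    then show ?thesis
      using valid_history_times[OF valid_snoc.hyps(1) old] valid_snoc.hyps(2) by simp
  qed
qed simp

lemma deliver_sets:
  assumes "\<And>x y. x \<in> A \<Longrightarrow> y \<in> B \<Longrightarrow> y \<notin> A \<Longrightarrow> f x \<notin> F y"
  shows "((G \<union> f ` B) - (\<Union>y\<in>B. F y) \<union> f ` A) - (\<Union>y\<in>A. F y) =
    (G \<union> f ` (B \<union> A)) - (\<Union>y\<in>B \<union> A. F y)"
  using assms by blast

lemma local_pool_deliver:
  assumes v: "valid_history k \<Delta> (h @ h')" and le: "last_time h \<le> t"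
    and hv: "valid_history k \<Delta> h" and \<Delta>: "0 \<le> \<Delta>"
    and later: "\<And>s \<kappa>. (s, \<kappa>) \<in> set h' \<Longrightarrow> last_time h < s"
  shows "local_pool (h @ h') i t =
    deliver (local_pool h i (last_time h))
      (map (\<lambda>(s, \<kappa>). (t - s, \<kappa>))
        (filter (\<lambda>(s, \<kappa>). s \<in> {last_time h - \<Delta> <.. last_time h}) h @ h')) i"
    (is "?lhs = ?rhs")
proof -
  let ?l = "last_time h"
  let ?A = "{\<kappa>. \<exists>s. (s, \<kappa>) \<in> set (h @ h') \<and> ?l - \<Delta> < s \<and> s + delay \<kappa> i \<le> t}"
  have A: "{\<kappa>. \<exists>a. (a, \<kappa>) \<in> set (map (\<lambda>(s, \<kappa>). (t - s, \<kappa>))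
        (filter (\<lambda>(s, \<kappa>). s \<in> {?l - \<Delta> <.. ?l}) h @ h')) \<and> delay \<kappa> i \<le> a} = ?A"
    (is "?B = _")
  proof (intro set_eqI iffI)
    fix \<kappa> assume "\<kappa> \<in> ?B"
    then obtain s where "(s, \<kappa>) \<in> set h \<and> s \<in> {?l - \<Delta> <.. ?l} \<or> (s, \<kappa>) \<in> set h'" "delay \<kappa> i \<le> t - s"
      by auto
    then show "\<kappa> \<in> ?A" using later[of s \<kappa>] \<Delta> by (auto intro!: exI[of _ s])
  next
    fix \<kappa> assume "\<kappa> \<in> ?A"
    then obtain s where s: "(s, \<kappa>) \<in> set (h @ h')" "?l - \<Delta> < s" "s + delay \<kappa> i \<le> t" by blast
    then have "(t - s, \<kappa>) \<in> set (map (\<lambda>(s, \<kappa>). (t - s, \<kappa>))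
        (filter (\<lambda>(s, \<kappa>). s \<in> {?l - \<Delta> <.. ?l}) h @ h'))"
      using valid_history_times[OF hv, of s \<kappa>] by (auto intro!: image_eqI[of _ _ "(s, \<kappa>)"])
    then show "\<kappa> \<in> ?B" using s(3) by (auto intro!: exI[of _ "t - s"])
  qed
  have rec: "received (h @ h') i t = received h i ?l \<union> ?A"
  proof (intro set_eqI iffI)
    fix \<kappa> assume "\<kappa> \<in> received (h @ h') i t"
    then obtain s where s: "(s, \<kappa>) \<in> set (h @ h')" "s + delay \<kappa> i \<le> t"
      by (auto simp: received_def)
    show "\<kappa> \<in> received h i ?l \<union> ?A"
    proof (cases "?l - \<Delta> < s")
      case False
      then have "(s, \<kappa>) \<in> set h" using s(1) later[of s \<kappa>] \<Delta> by auto
      moreover have "s + delay \<kappa> i \<le> ?l"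
        using valid_history_marks(3)[OF v s(1), of i] False by linarith
      ultimately show ?thesis by (auto simp: received_def)
    qed (use s in blast)
  next
    fix \<kappa> assume "\<kappa> \<in> received h i ?l \<union> ?A"
    then show "\<kappa> \<in> received (h @ h') i t" using le by (force simp: received_def)
  qed
  have old: "blockID \<kappa> \<notin> set (refs \<kappa>')" if new: "\<kappa> \<in> ?A" "\<kappa>' \<in> received (h @ h') i t" "\<kappa>' \<notin> ?A" for \<kappa> \<kappa>'
  proof
    assume *: "blockID \<kappa> \<in> set (refs \<kappa>')"
    obtain s where s: "(s, \<kappa>) \<in> set (h @ h')" "?l - \<Delta> < s" using new(1) by blast
    obtain s' where s': "(s', \<kappa>') \<in> set (h @ h')" "s' + delay \<kappa>' i \<le> t"
      using new(2) by (auto simp: received_def)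
    have "s < s'" using valid_history_refs_earlier[OF v s(1) s'(1) *] .
    then show False using s' s(2) new(3) by force
  qed
  have "?rhs = (local_pool h i ?l \<union> blockID ` ?A) - (\<Union>\<kappa>\<in>?A. set (refs \<kappa>))"
    unfolding deliver_def Let_def A ..
  also have "\<dots> = ?lhs"
    unfolding local_pool_def rec by (rule deliver_sets) (use old rec in blast)
  finally show ?thesis ..
qed

lemma aged_recent:
  "aged (t - l) (map (\<lambda>(s, \<kappa>). (l - s, \<kappa>)) xs) = map (\<lambda>(s, \<kappa>). (t - s, \<kappa>)) xs"
  by (auto simp: aged_def)

lemma pre_pool_embed:
  assumes "valid_history k \<Delta> h" "0 \<le> \<Delta>" "last_time h < t"
  shows "pre_pool (embed_state \<Delta> h) (t - last_time h) i = local_pool h i t"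
  using local_pool_deliver[of k \<Delta> h "[]" t i] assms
  by (simp add: pre_pool_def embed_state_def aged_recent)

lemma update_embed:
  assumes v: "valid_history k \<Delta> (h @ [(t, \<kappa>)])" and \<Delta>: "0 \<le> \<Delta>"
  shows "embed_state \<Delta> (h @ [(t, \<kappa>)]) = update \<Delta> (embed_state \<Delta> h) (t - last_time h) \<kappa>"
proof -
  let ?l = "last_time h"
  let ?R = "filter (\<lambda>(s, \<kappa>). s \<in> {?l - \<Delta> <.. ?l}) h"
  have hv: "valid_history k \<Delta> h" and lt: "?l < t"
    and fresh: "blockID \<kappa> \<notin> {genesis} \<union> blockID ` snd ` set h"
    by (rule valid_history.cases[OF v]; force simp: blockID_def genesis_def)+
  have lt': "last_time (h @ [(t, \<kappa>)]) = t" by (simp add: last_time_def)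
  have obs: "observer_pool (h @ [(t, \<kappa>)]) = (observer_pool h \<union> {blockID \<kappa>}) - set (refs \<kappa>)"
  proof -
    have "blockID \<kappa> \<notin> (\<Union>\<kappa>'\<in>snd ` set h. set (refs \<kappa>'))"
    proof
      assume "blockID \<kappa> \<in> (\<Union>\<kappa>'\<in>snd ` set h. set (refs \<kappa>'))"
      then obtain s \<kappa>' where m: "(s, \<kappa>') \<in> set h" and r: "blockID \<kappa> \<in> set (refs \<kappa>')" by auto
      from valid_history_marks(4)[OF hv m] r fresh show False by blast
    qed
    then show ?thesis unfolding observer_pool_def by auto
  qed
  have loc: "local_pool (h @ [(t, \<kappa>)]) i t =
      deliver (local_pool h i ?l) (map (\<lambda>(s, \<kappa>). (t - s, \<kappa>)) ?R @ [(0, \<kappa>)]) i" for i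
    using local_pool_deliver[OF v, of t i] lt hv \<Delta> by simp
  have "filter (\<lambda>(s, \<kappa>). s \<in> {t - \<Delta> <.. t}) h =
      filter (\<lambda>(s, \<kappa>). t - s < \<Delta>) ?R"
    unfolding filter_filter
  proof (rule filter_cong[OF refl])
    fix x assume "x \<in> set h"
    then have "fst x \<le> ?l" using valid_history_times[OF hv, of "fst x" "snd x"] by simp
    then show "(case x of (s, \<kappa>) \<Rightarrow> s \<in> {t - \<Delta> <.. t}) =
        ((case x of (s, \<kappa>) \<Rightarrow> s \<in> {?l - \<Delta> <.. ?l}) \<and> (case x of (s, \<kappa>) \<Rightarrow> t - s < \<Delta>))"
      using lt by (auto simp: case_prod_unfold)
  qed
  then have "map (\<lambda>(s, \<kappa>). (t - s, \<kappa>)) (filter (\<lambda>(s, \<kappa>). s \<in> {t - \<Delta> <.. t}) (h @ [(t, \<kappa>)])) =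
      filter (\<lambda>(a, _). a < \<Delta>) (map (\<lambda>(s, \<kappa>). (t - s, \<kappa>)) ?R @ [(0, \<kappa>)])"
    by (auto simp: filter_map o_def case_prod_unfold)
  then show ?thesis
    unfolding update_def embed_state_def lt' obs loc
    by (simp add: aged_recent Let_def del: filter_append map_append)
qed

end

theory Submission
  imports Defs
begin

text \<open>
  Little's law, issuance by issuance. If the block issued at time \<open>0\<close> is eventually referenced, its
  lifetime is the sum of the gaps \<open>T (m + 1) - T m\<close> over those \<open>m \<ge> 0\<close> at which it is still a tip.
  Each gap is exponential and independent of the past, and the probability that block \<open>l\<close> is a tip
  at issuance \<open>l + m\<close> does not depend on \<open>l\<close>. Hence \<open>rate * E W\<close> is the sum over \<open>m\<close> of the
  probabilities that block \<open>-m\<close> is a tip at issuance \<open>0\<close>, which is the mean number of tips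
  at issuance \<open>0\<close> that were issued along the path.

  It remains to exclude infinite means and tips that were never issued. With \<open>X\<close> observer tips and
  \<open>r\<close> recent blocks, a local pool contains all but \<open>r\<close> of the observer tips and at most \<open>k * r\<close>
  other blocks. As \<open>k \<ge> 2\<close>, for large \<open>X\<close> about two tips or more are removed per issuance and one
  is added, so that \<open>X\<^sup>2\<close> plus a multiple of \<open>r\<close> has drift at most \<open>const - 2 * X\<close>, which bounds
  the mean of \<open>X\<close>. Eternal tips, those present at all earlier issuances, form a set that decreases
  along the path with constant finite mean size, so they are never referenced. After a gap of length
  at least \<open>\<Delta>\<close> an eternal tip is visible to every node and would be referenced with positive
  probability; hence there are none.

  For the time-stationary version, integrating the tip count over a unit interval and transporting
  mass between unit intervals yields the mean of \<open>X 0 * (T 1 - T 0)\<close> under the Palm measure.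
\<close>

section \<open>Measurability of list operations\<close>

text \<open>The evolution is tied to the protocol only through its one-step transitions and the
  almost sure admissibility of each single state. Nothing in \<open>stationary_evolution\<close>
  says that a tip was issued at some index of the path, so eternal tips must be excluded by
  probability, not by construction. The finite mean comes before that: equal means of two nested
  finite sets force the sets to agree only if the means can be cancelled. Sums and integrals live in
  \<open>ennreal\<close>, where they may be exchanged freely; finiteness is used for this
  cancellation and for the existence of a first reference to block 0. The mean of the Lyapunov
  function is not known to be finite either, so the drift is applied to truncations of it. A further
  obstacle is measurability. States hold sorted lists of finite sets and the reference law depends
  on such a set, so each set operation is reduced to lengths, entries and cardinalities of lists
  before the innovation can serve as a kernel. The law of past and innovation is given on rectangles
  only, and has to be extended to joint functionals before the Markov property can be used.\<close>

lemma space_list_space: "space (list_space M) = lists (space M)"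
  unfolding list_space_def
  by (rule space_measure_of_conv)

lemma mem_listset_iff:
  "xs \<in> listset As \<longleftrightarrow> length xs = length As \<and> (\<forall>i<length As. xs ! i \<in> As ! i)"
proof (induction As arbitrary: xs)
  case (Cons A As)
  show ?case
    by (cases xs) (auto simp: set_Cons_def Cons.IH less_Suc_eq_0_disj)
qed simp

lemma listset_subset: "set As \<subseteq> Pow X \<Longrightarrow> listset As \<subseteq> lists X"
  by (auto simp: mem_listset_iff all_set_conv_all_nth in_lists_conv_set subset_eq in_set_conv_nth)

lemma sets_list_space:
  "sets (list_space M) = sigma_sets (lists (space M)) {listset As | As. set As \<subseteq> sets M}"
  unfolding list_space_def
proof (rule sets_measure_of, safe)
  fix As xs x assume "set As \<subseteq> sets M" "xs \<in> listset As" "x \<in> set xs"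
  then show "x \<in> space M"
    using listset_subset[of As "space M"] sets.space_closed[of M] by (auto simp: in_lists_conv_set)
qed

lemma listset_in_sets: "set As \<subseteq> sets M \<Longrightarrow> listset As \<in> sets (list_space M)"
  unfolding sets_list_space by (intro sigma_sets.Basic) auto

text \<open>The lists of length n form the generating box with n sides
  \<open>space M\<close>.\<close>

lemma measurable_length [measurable]: "length \<in> list_space M \<rightarrow>\<^sub>M count_space UNIV"
proof (subst measurable_count_space_eq2_countable, simp, safe)
  fix n
  have "length -` {n} \<inter> space (list_space M) = listset (replicate n (space M))"
    by (auto simp: space_list_space mem_listset_iff in_lists_conv_set) (metis in_set_conv_nth)
  then show "length -` {n} \<inter> space (list_space M) \<in> sets (list_space M)"
    by (simp add: listset_in_sets set_replicate_conv_if)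
qed

text \<open>Beyond the end of a list \<open>nth\<close> returns junk that depends only on the excess of the index.\<close>

lemma nth_beyond: "length xs \<le> j \<Longrightarrow> xs ! j = [] ! (j - length xs)"
  by (induction xs arbitrary: j) (auto simp: nth_Cons split: nat.splits)

text \<open>The preimage splits by length: lists longer than j contribute boxes with A as side j,
  and on each shorter length the value is one fixed junk value, so that the whole length class is in
  or out. With \<open>space M = UNIV\<close> the junk values need no separate care.\<close>

lemma measurable_nth:
  assumes [simp]: "space M = UNIV"
  shows "(\<lambda>xs. xs ! j) \<in> list_space M \<rightarrow>\<^sub>M M"
proof (rule measurableI)
  fix A assume A: "A \<in> sets M"
  have "(\<lambda>xs. xs ! j) -` A \<inter> space (list_space M) =
     (\<Union>n\<in>{j<..}. listset ((replicate n UNIV)[j := A])) \<union>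
     (\<Union>n\<in>{n. n \<le> j \<and> [] ! (j - n) \<in> A}. length -` {n} \<inter> space (list_space M))" (is "?L = ?R")
  proof (intro set_eqI)
    fix xs :: "'a list"
    show "xs \<in> ?L \<longleftrightarrow> xs \<in> ?R"
    proof (cases "j < length xs")
      case True
      then show ?thesis by (auto simp: space_list_space mem_listset_iff nth_list_update)
    next
      case False
      then show ?thesis using nth_beyond[of xs j]
        by (auto simp: space_list_space mem_listset_iff)
    qed
  qed
  also have "\<dots> \<in> sets (list_space M)"
    using sets.top[of M] A set_update_subset_insert[of "replicate _ UNIV" j A]
    by (intro sets.Un sets.countable_UN'' measurable_sets[OF measurable_length] listset_in_sets)
       (auto, metis in_set_replicate insert_iff subset_iff)
  finally show "(\<lambda>xs. xs ! j) -` A \<inter> space (list_space M) \<in> sets (list_space M)" .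
qed simp

text \<open>A generating box constrains the length and finitely many entries, and nothing else. The
  default \<open>c\<close> makes the entry maps total without any appeal to junk values.\<close>

lemma measurable_list_spaceI:
  assumes [simp]: "space M = UNIV"
    and len [measurable]: "(\<lambda>x. length (f x)) \<in> N \<rightarrow>\<^sub>M count_space UNIV"
    and nth: "\<And>j. (\<lambda>x. if j < length (f x) then f x ! j else c) \<in> N \<rightarrow>\<^sub>M M"
  shows "f \<in> N \<rightarrow>\<^sub>M list_space M"
  unfolding list_space_def
proof (rule measurable_measure_of, safe)
  fix As assume As: "set As \<subseteq> sets M"
  let ?n = "length As"
  have "f -` listset As \<inter> space N = {x \<in> space N. length (f x) = ?n \<and>
      (\<forall>j\<in>{..<?n}. (if j < length (f x) then f x ! j else c) \<in> As ! j)}"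
    by (auto simp: mem_listset_iff)
  also have "\<dots> \<in> sets N"
  proof -
    have [measurable]: "As ! j \<in> sets M" if "j < length As" for j
      using As that by (auto simp: subset_eq)
    note nth[measurable]
    show ?thesis by measurable
  qed
  finally show "f -` listset As \<inter> space N \<in> sets N" .
qed (auto simp: in_lists_conv_set)

lemma measurable_nth_compose:
  assumes [simp]: "space M = UNIV"
    and [measurable]: "f \<in> N \<rightarrow>\<^sub>M list_space M" "j \<in> N \<rightarrow>\<^sub>M count_space (UNIV :: nat set)"
  shows "(\<lambda>x. f x ! j x) \<in> N \<rightarrow>\<^sub>M M"
proof (rule measurable_compose_countable[where f = "\<lambda>i x. f x ! i" and g = j])
  show "(\<lambda>x. f x ! i) \<in> N \<rightarrow>\<^sub>M M" for i
    by (rule measurable_compose[OF _ measurable_nth]) simp_all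
qed simp


lemma measurable_append:
  assumes [simp]: "space M = UNIV"
    and [measurable]: "f \<in> N \<rightarrow>\<^sub>M list_space M" "g \<in> N \<rightarrow>\<^sub>M list_space M"
  shows "(\<lambda>x. f x @ g x) \<in> N \<rightarrow>\<^sub>M list_space M"
proof (rule measurable_list_spaceI[where c = undefined])
  fix j
  have len: "(\<lambda>x. length (f x)) \<in> N \<rightarrow>\<^sub>M count_space UNIV" "(\<lambda>x. length (g x)) \<in> N \<rightarrow>\<^sub>M count_space UNIV"
    by (rule measurable_compose[OF assms(2) measurable_length] measurable_compose[OF assms(3) measurable_length])+
  have diff: "(\<lambda>x. j - length (f x)) \<in> N \<rightarrow>\<^sub>M count_space UNIV"
    by (rule measurable_compose[OF len(1)]) (simp only: measurable_count_space_eq1, simp)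
  have *: "(if j < length (f x @ g x) then (f x @ g x) ! j else undefined) =
      (if length (f x) \<le> j
       then if j - length (f x) < length (g x) then g x ! (j - length (f x)) else undefined
       else f x ! j)" for x
    by (auto simp: nth_append)
  have "Measurable.pred N (\<lambda>x. length (f x) \<le> j)"
    by (rule measurable_compose[OF len(1)]) simp
  moreover have "Measurable.pred N (\<lambda>x. j - length (f x) < length (g x))"
    by (rule measurable_compose_countable[OF _ len(1), where f = "\<lambda>n x. j - n < length (g x)"])
      (rule measurable_compose[OF len(2)], simp)
  ultimately show "(\<lambda>x. if j < length (f x @ g x) then (f x @ g x) ! j else undefined) \<in> N \<rightarrow>\<^sub>M M"
    unfolding *
    by (intro measurable_If measurable_nth_compose assms diff measurable_const) (simp_all add: pred_def)
next
  show "(\<lambda>x. length (f x @ g x)) \<in> N \<rightarrow>\<^sub>M count_space UNIV"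
    unfolding length_append
  proof (rule measurable_compose_countable[where f = "\<lambda>n x. n + length (g x)" and g = "\<lambda>x. length (f x)"])
    show "(\<lambda>x. n + length (g x)) \<in> N \<rightarrow>\<^sub>M count_space UNIV" for n
      by (rule measurable_compose[OF measurable_compose[OF assms(3) measurable_length]])
        (simp only: measurable_count_space_eq1, simp)
    show "(\<lambda>x. length (f x)) \<in> N \<rightarrow>\<^sub>M count_space UNIV"
      by measurable
  qed
qed (rule assms(1))

lemma measurable_singleton_list:
  assumes [simp]: "space M = UNIV" and [measurable]: "f \<in> N \<rightarrow>\<^sub>M M"
  shows "(\<lambda>x. [f x]) \<in> N \<rightarrow>\<^sub>M list_space M"
proof (rule measurable_list_spaceI[where c = undefined])
  show "(\<lambda>x. if j < length [f x] then [f x] ! j else undefined) \<in> N \<rightarrow>\<^sub>M M" for j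
    by (cases "j = 0") simp_all
qed simp_all

lemma measurable_map_list:
  assumes [simp]: "space M = UNIV" "space M' = UNIV"
    and [measurable]: "(\<lambda>(x, e). h x e) \<in> N \<Otimes>\<^sub>M M \<rightarrow>\<^sub>M M'" "f \<in> N \<rightarrow>\<^sub>M list_space M"
  shows "(\<lambda>x. map (h x) (f x)) \<in> N \<rightarrow>\<^sub>M list_space M'"
proof (rule measurable_list_spaceI[where c = undefined])
  have *: "(if j < length (map (h x) (f x)) then map (h x) (f x) ! j else undefined) =
      (if j < length (f x) then h x (f x ! j) else undefined)" for x j
    by simp
  have [measurable]: "(\<lambda>x. f x ! j) \<in> N \<rightarrow>\<^sub>M M" for j
    by (rule measurable_nth_compose) simp_all
  have [measurable]: "(\<lambda>x. undefined) \<in> N \<rightarrow>\<^sub>M M'"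
    by simp
  have [measurable]: "(\<lambda>x. h x (f x ! j)) \<in> N \<rightarrow>\<^sub>M M'" for j
    using measurable_compose[of "\<lambda>x. (x, f x ! j)" N "N \<Otimes>\<^sub>M M" "\<lambda>(x, e). h x e" M'] by simp
  show "(\<lambda>x. if j < length (map (h x) (f x)) then map (h x) (f x) ! j else undefined) \<in> N \<rightarrow>\<^sub>M M'" for j
    unfolding * by measurable
next
  show "(\<lambda>x. length (map (h x) (f x))) \<in> N \<rightarrow>\<^sub>M count_space UNIV"
    unfolding length_map by measurable
qed simp

lemma measurable_Nil [measurable]: "(\<lambda>x. []) \<in> N \<rightarrow>\<^sub>M list_space M"
  by (rule measurable_const) (simp add: space_list_space)

text \<open>Filtering is measurable on prefixes of a fixed length, by induction with one append per
  entry; the actual length takes countably many values, so it may be inserted afterwards.\<close>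

lemma measurable_filter_list:
  assumes [simp]: "space M = UNIV" and [measurable]: "Measurable.pred M P"
    and f [measurable]: "f \<in> N \<rightarrow>\<^sub>M list_space M"
  shows "(\<lambda>x. filter P (f x)) \<in> N \<rightarrow>\<^sub>M list_space M"
proof -
  have [measurable]: "(\<lambda>x. f x ! j) \<in> N \<rightarrow>\<^sub>M M" for j
    by (rule measurable_nth_compose) simp_all
  have [measurable]: "(\<lambda>x. [f x ! j]) \<in> N \<rightarrow>\<^sub>M list_space M" for j
    by (rule measurable_singleton_list) simp_all
  have [measurable]: "(\<lambda>x. filter P (take n (f x))) \<in> N \<rightarrow>\<^sub>M list_space M" for n
  proof (induction n)
    case (Suc n)
    note Suc [measurable]
    have *: "filter P (take (Suc n) (f x)) = filter P (take n (f x)) @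
        (if n < length (f x) \<and> P (f x ! n) then [f x ! n] else [])" for x
      by (cases "n < length (f x)") (auto simp: take_Suc_conv_app_nth)
    show ?case unfolding * by (rule measurable_append[OF assms(1)]) measurable
  qed simp
  have "(\<lambda>x. filter P (take (length (f x)) (f x))) \<in> N \<rightarrow>\<^sub>M list_space M"
    by (rule measurable_compose_countable[where f = "\<lambda>n x. filter P (take n (f x))" and g = "\<lambda>x. length (f x)"])
      measurable
  then show ?thesis by simp
qed

lemmas measurable_nth_borel [measurable] = measurable_nth[OF space_borel]

lemma pred_mem_list [measurable (raw)]:
  fixes e :: "'a \<Rightarrow> real"
  assumes [measurable]: "f \<in> N \<rightarrow>\<^sub>M list_space borel" "e \<in> borel_measurable N"
  shows "Measurable.pred N (\<lambda>x. e x \<in> set (f x))"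
proof -
  have "(\<lambda>x. e x \<in> set (f x)) = (\<lambda>x. \<exists>j. j < length (f x) \<and> f x ! j = e x)"
    by (auto simp: in_set_conv_nth)
  also have "Measurable.pred N \<dots>" by measurable
  finally show ?thesis .
qed

text \<open>The covering list \<open>f x\<close> turns the random finite set into countably many
  index conditions. Counting only first occurrences removes repetitions, so that the cardinality is
  a finite sum of measurable indicators.\<close>

lemma measurable_card_subset_list:
  fixes f :: "'a \<Rightarrow> real list"
  assumes [measurable]: "f \<in> N \<rightarrow>\<^sub>M list_space borel"
    and sub: "\<And>x. x \<in> space N \<Longrightarrow> A x \<subseteq> set (f x)"
    and [measurable]: "\<And>j. Measurable.pred N (\<lambda>x. f x ! j \<in> A x)"
  shows "(\<lambda>x. card (A x)) \<in> N \<rightarrow>\<^sub>M count_space UNIV"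
proof -
  let ?P = "\<lambda>x j. f x ! j \<in> A x \<and> (\<forall>i<j. f x ! i \<noteq> f x ! j)"
  have "card (A x) = (\<Sum>j<length (f x). of_bool (?P x j))" if x: "x \<in> space N" for x
  proof -
    have "bij_betw (\<lambda>j. f x ! j) {j. j < length (f x) \<and> ?P x j} (A x)"
      unfolding bij_betw_def
    proof (intro conjI inj_onI set_eqI iffI)
      fix i j assume "i \<in> {j. j < length (f x) \<and> ?P x j}" "j \<in> {j. j < length (f x) \<and> ?P x j}"
        "f x ! i = f x ! j"
      then show "i = j" by (metis (mono_tags, lifting) linorder_neqE_nat mem_Collect_eq)
    next
      fix e assume "e \<in> (!) (f x) ` {j. j < length (f x) \<and> ?P x j}"
      then show "e \<in> A x" by blast
    next
      fix e assume e: "e \<in> A x"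
      then obtain i where i: "i < length (f x)" "f x ! i = e"
        using sub[OF x] by (auto simp: in_set_conv_nth subset_eq)
      define j where "j = (LEAST i. f x ! i = e)"
      have "f x ! j = e" unfolding j_def using i by (intro LeastI)
      moreover have "j \<le> i" unfolding j_def using i by (intro Least_le)
      moreover have "\<forall>l<j. f x ! l \<noteq> e" unfolding j_def using not_less_Least by blast
      ultimately show "e \<in> (!) (f x) ` {j. j < length (f x) \<and> ?P x j}"
        using i e by (intro image_eqI[of _ _ j]) auto
    qed
    then have "card (A x) = card {j. j < length (f x) \<and> ?P x j}"
      by (rule bij_betw_same_card[symmetric])
    also have "\<dots> = (\<Sum>j<length (f x). of_bool (?P x j))"
      by (simp add: sum_of_bool_eq Int_def lessThan_def conj_ac)
    finally show ?thesis .
  qed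
  moreover have "(\<lambda>x. \<Sum>j<length (f x). of_bool (?P x j)) \<in> N \<rightarrow>\<^sub>M (count_space UNIV :: nat measure)"
  proof (rule measurable_compose_countable[where f = "\<lambda>n x. \<Sum>j<n. of_bool (?P x j)" and g = "\<lambda>x. length (f x)"])
    show "(\<lambda>x. \<Sum>j<n. of_bool (?P x j)) \<in> N \<rightarrow>\<^sub>M (count_space UNIV :: nat measure)" for n
      by measurable
  qed simp
  ultimately show ?thesis by (simp cong: measurable_cong)
qed

text \<open>An order statistic expressed by counting: the entry with index j, counted from 0, is at
  most c exactly if j + 1 elements are. This reduces measurability of sorted entries to that of
  cardinalities.\<close>

lemma nth_sorted_list_of_set_le_iff:
  fixes A :: "'a :: linorder set"
  assumes "finite A" "j < card A"
  shows "sorted_list_of_set A ! j \<le> c \<longleftrightarrow> j < card {x \<in> A. x \<le> c}"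
proof -
  let ?s = "sorted_list_of_set A"
  have len: "length ?s = card A" and set: "set ?s = A" and s: "sorted ?s" and d: "distinct ?s"
    using assms by simp_all
  have "{x \<in> A. x \<le> c} = (!) ?s ` {i. i < card A \<and> ?s ! i \<le> c}"
    using len set by (force simp: in_set_conv_nth)
  moreover have "inj_on ((!) ?s) {i. i < card A \<and> ?s ! i \<le> c}"
    using d len by (auto intro: inj_on_nth)
  ultimately have c: "card {x \<in> A. x \<le> c} = card {i. i < card A \<and> ?s ! i \<le> c}"
    by (simp add: card_image)
  show ?thesis
  proof
    assume "?s ! j \<le> c"
    then have "{..j} \<subseteq> {i. i < card A \<and> ?s ! i \<le> c}"
      using s len assms(2) by (auto simp: sorted_iff_nth_mono intro: order_trans)
    from card_mono[OF _ this] show "j < card {x \<in> A. x \<le> c}" unfolding c by simp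
  next
    assume j: "j < card {x \<in> A. x \<le> c}"
    show "?s ! j \<le> c"
    proof (rule ccontr)
      assume "\<not> ?s ! j \<le> c"
      then have "{i. i < card A \<and> ?s ! i \<le> c} \<subseteq> {..<j}"
        using s len by (force simp: sorted_iff_nth_mono not_le not_less intro: order_trans)
      from card_mono[OF _ this] show False using j unfolding c by simp
    qed
  qed
qed

text \<open>The sublevel sets of each entry are described by cardinalities of subsets of
  \<open>A x\<close>, which the covering list makes measurable.\<close>

lemma measurable_sorted_list_of_set:
  fixes f :: "'a \<Rightarrow> real list"
  assumes [measurable]: "f \<in> N \<rightarrow>\<^sub>M list_space borel"
    and sub: "\<And>x. A x \<subseteq> set (f x)"
    and [measurable]: "\<And>j. Measurable.pred N (\<lambda>x. f x ! j \<in> A x)"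
  shows "(\<lambda>x. sorted_list_of_set (A x)) \<in> N \<rightarrow>\<^sub>M list_space borel"
proof (rule measurable_list_spaceI[where c = 0])
  have fin: "finite (A x)" for x by (rule finite_subset[OF sub]) simp
  have [measurable]: "(\<lambda>x. card (A x)) \<in> N \<rightarrow>\<^sub>M count_space UNIV"
    by (rule measurable_card_subset_list[of f]) (use sub in auto)
  have [measurable]: "(\<lambda>x. card {e \<in> A x. e \<le> c}) \<in> N \<rightarrow>\<^sub>M count_space UNIV" for c
  proof (rule measurable_card_subset_list[of f])
    show "Measurable.pred N (\<lambda>x. f x ! j \<in> {e \<in> A x. e \<le> c})" for j by simp
  qed (use sub in auto)
  show "(\<lambda>x. length (sorted_list_of_set (A x))) \<in> N \<rightarrow>\<^sub>M count_space UNIV" by simp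
  fix j
  show "(\<lambda>x. if j < length (sorted_list_of_set (A x)) then sorted_list_of_set (A x) ! j else 0)
      \<in> borel_measurable N"
  proof (rule borel_measurableI_le)
    fix c :: real
    have "{x \<in> space N. (if j < length (sorted_list_of_set (A x)) then sorted_list_of_set (A x) ! j else 0) \<le> c}
      = {x \<in> space N. if j < card (A x) then j < card {e \<in> A x. e \<le> c} else 0 \<le> c}"
      using fin by (auto simp: nth_sorted_list_of_set_le_iff split: if_splits)
    also have "\<dots> \<in> sets N" by measurable
    finally show "{x \<in> space N. (if j < length (sorted_list_of_set (A x)) then sorted_list_of_set (A x) ! j else 0) \<le> c}
       \<in> sets N" .
  qed
qed simp


section \<open>Measurability of the one-step dynamics\<close>

lemma space_mark_space [simp]: "space (mark_space :: 'n::finite mark measure) = UNIV"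
  by (simp add: mark_space_def space_pair_measure space_list_space space_PiM PiE_UNIV_domain)

lemma space_state_space [simp]: "space (state_space :: 'n::finite state measure) = UNIV"
  by (simp add: state_space_def space_pair_measure space_list_space space_PiM PiE_UNIV_domain)

lemma space_aged_mark [simp]: "space (borel \<Otimes>\<^sub>M mark_space :: (real \<times> 'n::finite mark) measure) = UNIV"
  by (simp add: space_pair_measure)

lemma measurable_blockID [measurable]: "blockID \<in> borel_measurable (mark_space :: 'n::finite mark measure)"
  unfolding blockID_def[abs_def] mark_space_def by measurable

lemma measurable_refs [measurable]: "refs \<in> (mark_space :: 'n::finite mark measure) \<rightarrow>\<^sub>M list_space borel"
  unfolding refs_def[abs_def] mark_space_def by measurable

lemma measurable_delay [measurable]:
  "(\<lambda>\<kappa>. delay \<kappa> j) \<in> borel_measurable (mark_space :: 'n::finite mark measure)"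
  unfolding delay_def mark_space_def by measurable

lemma measurable_obs_list [measurable]: "fst \<in> (state_space :: 'n::finite state measure) \<rightarrow>\<^sub>M list_space borel"
  unfolding state_space_def by measurable

lemma measurable_local_list [measurable]:
  "(\<lambda>y. fst (snd y) i) \<in> (state_space :: 'n::finite state measure) \<rightarrow>\<^sub>M list_space borel"
  unfolding state_space_def by measurable

lemma measurable_recent_list [measurable]:
  "(\<lambda>y. snd (snd y)) \<in> (state_space :: 'n::finite state measure) \<rightarrow>\<^sub>M list_space (borel \<Otimes>\<^sub>M mark_space)"
  unfolding state_space_def by measurable

lemma measurable_obs_tips [measurable]:
  "obs_tips \<in> (state_space :: 'n::finite state measure) \<rightarrow>\<^sub>M count_space UNIV"
  unfolding obs_tips_def[abs_def] by measurable

lemma deliver_subset: "deliver P R i \<subseteq> P \<union> set (map (\<lambda>(a, \<kappa>). blockID \<kappa>) R)"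
  by (force simp: deliver_def Let_def)

lemma finite_deliver [simp]: "finite P \<Longrightarrow> finite (deliver P R i)"
  by (rule finite_subset[OF deliver_subset]) simp

text \<open>Quantifiers over blocks become quantifiers over indices of the recent list; those are
  countable, as measurability requires.\<close>

lemma mem_deliver_iff:
  "e \<in> deliver P R i \<longleftrightarrow>
    (e \<in> P \<or> (\<exists>j<length R. delay (snd (R ! j)) i \<le> fst (R ! j) \<and> e = blockID (snd (R ! j)))) \<and>
    \<not> (\<exists>j<length R. delay (snd (R ! j)) i \<le> fst (R ! j) \<and> e \<in> set (refs (snd (R ! j))))"
  (is "_ \<longleftrightarrow> (e \<in> P \<or> ?B) \<and> \<not> ?C")
proof -
  have A: "{\<kappa>. \<exists>a. (a, \<kappa>) \<in> set R \<and> delay \<kappa> i \<le> a} =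
      (\<lambda>j. snd (R ! j)) ` {j. j < length R \<and> delay (snd (R ! j)) i \<le> fst (R ! j)}"
    by (force simp: in_set_conv_nth image_iff)
  show ?thesis
    unfolding deliver_def Let_def A by auto
qed

lemma measurable_recent_nth:
  fixes R :: "'a \<Rightarrow> (real \<times> 'n::finite mark) list"
  assumes "R \<in> N \<rightarrow>\<^sub>M list_space (borel \<Otimes>\<^sub>M mark_space)"
  shows "(\<lambda>x. R x ! j) \<in> N \<rightarrow>\<^sub>M borel \<Otimes>\<^sub>M mark_space"
  by (rule measurable_nth_compose[OF space_aged_mark assms]) simp

lemma measurable_nth_borel_compose:
  assumes "f \<in> N \<rightarrow>\<^sub>M list_space borel"
  shows "(\<lambda>x. f x ! j) \<in> borel_measurable N"
  by (rule measurable_nth_compose[OF space_borel assms]) simp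

lemma measurable_sorted_deliver:
  fixes R :: "'a \<Rightarrow> (real \<times> 'n::finite mark) list"
  assumes l [measurable]: "l \<in> N \<rightarrow>\<^sub>M list_space borel"
    and R [measurable]: "R \<in> N \<rightarrow>\<^sub>M list_space (borel \<Otimes>\<^sub>M mark_space)"
  shows "(\<lambda>x. sorted_list_of_set (deliver (set (l x)) (R x) i)) \<in> N \<rightarrow>\<^sub>M list_space borel"
proof (rule measurable_sorted_list_of_set)
  note measurable_recent_nth[OF R, measurable]
  have [measurable]: "(\<lambda>x. map ((\<lambda>_ (a, \<kappa>). blockID \<kappa>) x) (R x)) \<in> N \<rightarrow>\<^sub>M list_space borel"
    by (rule measurable_map_list[OF space_aged_mark _ _ R]) (simp_all add: case_prod_unfold)
  show b: "(\<lambda>x. l x @ map (\<lambda>(a, \<kappa>). blockID \<kappa>) (R x)) \<in> N \<rightarrow>\<^sub>M list_space borel" (is "?f \<in> _")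
    by (rule measurable_append) simp_all
  note measurable_nth_borel_compose[OF b, measurable]
  show "Measurable.pred N (\<lambda>x. ?f x ! j \<in> deliver (set (l x)) (R x) i)" for j
    unfolding mem_deliver_iff by measurable
  show "deliver (set (l x)) (R x) i \<subseteq> set (?f x)" for x
    using deliver_subset[of "set (l x)" "R x" i] by simp
qed

lemma measurable_aged:
  fixes R :: "'a \<Rightarrow> (real \<times> 'n::finite mark) list"
  assumes [measurable]: "g \<in> borel_measurable N" and R: "R \<in> N \<rightarrow>\<^sub>M list_space (borel \<Otimes>\<^sub>M mark_space)"
  shows "(\<lambda>x. aged (g x) (R x)) \<in> N \<rightarrow>\<^sub>M list_space (borel \<Otimes>\<^sub>M mark_space)"
  unfolding aged_def
  by (rule measurable_map_list[OF space_aged_mark space_aged_mark _ R]) (simp add: case_prod_unfold)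

lemma measurable_update [measurable (raw)]:
  fixes y :: "'a \<Rightarrow> 'n::finite state"
  assumes y [measurable]: "y \<in> N \<rightarrow>\<^sub>M state_space" and g [measurable]: "g \<in> borel_measurable N"
    and \<kappa> [measurable]: "\<kappa> \<in> N \<rightarrow>\<^sub>M mark_space"
  shows "(\<lambda>x. update \<Delta> (y x) (g x) (\<kappa> x)) \<in> N \<rightarrow>\<^sub>M state_space"
proof -
  have Ob: "(\<lambda>x. fst (y x)) \<in> N \<rightarrow>\<^sub>M list_space borel"
    by (rule measurable_compose[OF y measurable_obs_list])
  have L: "(\<lambda>x. fst (snd (y x)) i) \<in> N \<rightarrow>\<^sub>M list_space borel" for i
    by (rule measurable_compose[OF y measurable_local_list])
  have R: "(\<lambda>x. aged (g x) (snd (snd (y x))) @ [(0, \<kappa> x)]) \<in> N \<rightarrow>\<^sub>M list_space (borel \<Otimes>\<^sub>M mark_space)"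
    (is "?R \<in> _")
    by (intro measurable_append measurable_aged measurable_singleton_list g
        measurable_compose[OF y measurable_recent_list]) simp_all
  have "(\<lambda>x. sorted_list_of_set ((set (fst (y x)) \<union> {blockID (\<kappa> x)}) - set (refs (\<kappa> x)))) \<in> N \<rightarrow>\<^sub>M list_space borel"
  proof (rule measurable_sorted_list_of_set)
    show b: "(\<lambda>x. fst (y x) @ [blockID (\<kappa> x)]) \<in> N \<rightarrow>\<^sub>M list_space borel" (is "?f \<in> _")
      by (intro measurable_append measurable_singleton_list Ob) simp_all
    note measurable_nth_borel_compose[OF b, measurable] Ob[measurable]
    show "Measurable.pred N (\<lambda>x. ?f x ! j \<in> (set (fst (y x)) \<union> {blockID (\<kappa> x)}) - set (refs (\<kappa> x)))" for j
      unfolding Diff_iff Un_iff singleton_iff by measurable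
  qed auto
  moreover have "(\<lambda>x i. sorted_list_of_set (deliver (set (fst (snd (y x)) i)) (?R x) i))
      \<in> N \<rightarrow>\<^sub>M (\<Pi>\<^sub>M i\<in>UNIV. list_space borel)"
    by (intro measurable_PiM_single' measurable_sorted_deliver L R)
      (auto simp: space_list_space)
  moreover have "(\<lambda>x. filter (\<lambda>(a, _). a < \<Delta>) (?R x)) \<in> N \<rightarrow>\<^sub>M list_space (borel \<Otimes>\<^sub>M mark_space)"
    by (rule measurable_filter_list[OF _ _ R]) (simp_all add: case_prod_unfold)
  ultimately show ?thesis
    unfolding state_space_def
    by (intro measurable_pair) (simp_all add: o_def update_def Let_def case_prod_unfold)
qed

lemma measurable_sorted_pre_pool:
  fixes y :: "'a \<Rightarrow> 'n::finite state"
  assumes y: "y \<in> N \<rightarrow>\<^sub>M state_space" and g: "g \<in> borel_measurable N"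
    and i: "i \<in> N \<rightarrow>\<^sub>M count_space UNIV"
  shows "(\<lambda>x. sorted_list_of_set (pre_pool (y x) (g x) (i x))) \<in> N \<rightarrow>\<^sub>M list_space borel"
proof (rule measurable_compose_countable[OF _ i])
  show "(\<lambda>x. sorted_list_of_set (pre_pool (y x) (g x) j)) \<in> N \<rightarrow>\<^sub>M list_space borel" for j
    unfolding pre_pool_def case_prod_unfold
    by (intro measurable_sorted_deliver measurable_aged g measurable_compose[OF y measurable_local_list]
        measurable_compose[OF y measurable_recent_list])
qed

lemma finite_pre_pool [simp]: "finite (pre_pool y g i)"
  by (simp add: pre_pool_def case_prod_unfold)


section \<open>The innovation as a Markov kernel\<close>

text \<open>
  The references are the entries of the sorted pool at a uniform list of distinct indices.  The index
  lists form a countable type, so that the choice depends measurably on the state.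
\<close>

definition index_choices :: "nat \<Rightarrow> nat \<Rightarrow> nat list set" where
  "index_choices k c = {js. distinct js \<and> set js \<subseteq> {..<c} \<and> length js = min k c}"

lemma index_choices_finite: "finite (index_choices k c)"
  by (rule finite_subset[OF _ finite_lists_length_eq[of "{..<c}" "min k c"]]) (auto simp: index_choices_def)

lemma index_choices_nonempty: "index_choices k c \<noteq> {}"
  by (auto simp: index_choices_def intro!: exI[of _ "[0..<min k c]"])

text \<open>Reading the sorted pool by index is a bijection from \<open>{..<card P}\<close> onto P,
  and mapping a bijection over lists preserves distinctness and length.\<close>

lemma ref_choices_eq_index_choices:
  assumes "finite P"
  shows "ref_choices k P = map (nth (sorted_list_of_set P)) ` index_choices k (card P)" (is "?L = ?f ` ?R")
    and "inj_on (map (nth (sorted_list_of_set P))) (index_choices k (card P))"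
proof -
  let ?p = "sorted_list_of_set P"
  have p: "distinct ?p" "set ?p = P" "length ?p = card P" using assms by simp_all
  have inj: "inj_on (nth ?p) {..<card P}"
    using p by (auto intro: inj_on_nth)
  have img: "nth ?p ` {..<card P} = P"
    using p by (auto simp: set_conv_nth image_def)
  show "inj_on ?f ?R"
  proof (rule inj_onI)
    fix js js' assume "js \<in> ?R" "js' \<in> ?R" and eq: "?f js = ?f js'"
    then have "inj_on (nth ?p) (set js \<union> set js')"
      by (intro inj_on_subset[OF inj]) (auto simp: index_choices_def)
    with eq show "js = js'" by (rule map_inj_on)
  qed
  show "?L = ?f ` ?R"
  proof (intro equalityI subsetI)
    fix r assume r: "r \<in> ?L"
    let ?js = "map (the_inv_into {..<card P} (nth ?p)) r"
    have sub: "set r \<subseteq> nth ?p ` {..<card P}" using r img by (simp add: ref_choices_def)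
    then have "?f ?js = r"
      using f_the_inv_into_f[OF inj] by (auto simp: map_idI subset_eq)
    moreover have "?js \<in> ?R"
      using r sub the_inv_into_into[OF inj] inj_on_the_inv_into[OF inj]
      by (auto simp: index_choices_def ref_choices_def distinct_map subset_eq intro: inj_on_subset)
    ultimately show "r \<in> ?f ` ?R" by (metis imageI)
  next
    fix r assume "r \<in> ?f ` ?R"
    then obtain js where js: "js \<in> ?R" "r = ?f js" by blast
    then have "set js \<subseteq> {..<card P}" by (simp add: index_choices_def)
    with inj img have "inj_on (nth ?p) (set js)" "nth ?p ` set js \<subseteq> P"
      by (auto intro: inj_on_subset)
    with js show "r \<in> ?L" by (simp add: index_choices_def ref_choices_def distinct_map)
  qed
qed

lemma ref_choices_finite: "finite P \<Longrightarrow> finite (ref_choices k P)"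
  by (simp add: ref_choices_eq_index_choices index_choices_finite)

lemma ref_choices_nonempty: "finite P \<Longrightarrow> ref_choices k P \<noteq> {}"
  by (simp add: ref_choices_eq_index_choices index_choices_nonempty)

lemma pmf_of_ref_choices:
  assumes "finite P"
  shows "pmf_of_set (ref_choices k P) =
    map_pmf (map (nth (sorted_list_of_set P))) (pmf_of_set (index_choices k (card P)))"
  using map_pmf_of_set_inj[OF ref_choices_eq_index_choices(2)[OF assms] index_choices_nonempty index_choices_finite]
  by (simp add: ref_choices_eq_index_choices(1)[OF assms])

lemma measurable_map_nth:
  fixes p :: "'a \<Rightarrow> real list"
  assumes p: "p \<in> N \<rightarrow>\<^sub>M list_space borel" and js: "js \<in> N \<rightarrow>\<^sub>M count_space (UNIV :: nat list set)"
  shows "(\<lambda>x. map (nth (p x)) (js x)) \<in> N \<rightarrow>\<^sub>M list_space borel"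
proof (rule measurable_compose_countable[OF _ js])
  show "(\<lambda>x. map (nth (p x)) js) \<in> N \<rightarrow>\<^sub>M list_space borel" for js
  proof (rule measurable_list_spaceI[where c = 0])
    show "(\<lambda>x. if j < length (map (nth (p x)) js) then map (nth (p x)) js ! j else 0) \<in> borel_measurable N" for j
      using measurable_nth_borel_compose[OF p] by (cases "j < length js") simp_all
  qed simp_all
qed

locale block_model =
  fixes k :: nat and rate \<Delta> :: real and \<nu> :: "'n::finite pmf" and D :: "'n \<Rightarrow> ('n \<Rightarrow> real) measure"
  assumes k: "k \<ge> 2" and rate: "rate > 0" and \<Delta>: "\<Delta> \<ge> 0"
    and delay_prob: "\<And>i. prob_space (D i)"
    and delay_sets [simp, measurable_cong]: "\<And>i. sets (D i) = sets (\<Pi>\<^sub>M j\<in>UNIV. borel)"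
begin

abbreviation K :: "'n state \<Rightarrow> (real \<times> 'n mark) measure" where
  "K \<equiv> innovation k rate \<nu> D"

abbreviation innov :: "(real \<times> 'n mark) measure" where
  "innov \<equiv> borel \<Otimes>\<^sub>M mark_space"

definition expo :: "real measure" where
  "expo = density lborel (exponential_density rate)"

lemma sets_expo [simp, measurable_cong]: "sets expo = sets borel"
  by (simp add: expo_def)

lemma prob_space_expo: "prob_space expo"
  unfolding expo_def using rate by (rule prob_space_exponential_density)

lemma prob_space_uniform: "prob_space (uniform_measure lborel {0..1::real})"
  by (rule prob_space_uniform_measure) simp_all

lemma uniform_in_subprob_algebra: "uniform_measure lborel {0..1::real} \<in> space (subprob_algebra borel)"
  using prob_space_uniform
  by (simp only: space_subprob_algebra prob_space_imp_subprob_space sets_uniform_measure sets_lborel mem_Collect_eq)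

lemma in_subprob_algebra:
  assumes "prob_space M" "sets M = sets N"
  shows "M \<in> space (subprob_algebra N)"
  using assms by (simp add: space_subprob_algebra prob_space_imp_subprob_space)

lemma measurable_delay_kernel [measurable]: "D \<in> count_space UNIV \<rightarrow>\<^sub>M subprob_algebra (\<Pi>\<^sub>M j\<in>UNIV. borel)"
  by (simp add: in_subprob_algebra delay_prob)

text \<open>The innermost stage of \<open>innovation\<close>, with everything drawn before it as a
  parameter. The full kernel is assembled outward from here.\<close>

definition ref_kernel :: "'n state \<Rightarrow> real \<Rightarrow> real \<Rightarrow> 'n \<Rightarrow> ('n \<Rightarrow> real) \<Rightarrow> (real \<times> 'n mark) measure" where
  "ref_kernel y g b i d = measure_pmf (pmf_of_set (ref_choices k (pre_pool y g i))) \<bind>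
     (\<lambda>r. return innov (g, (b, r, i, d)))"

lemma ref_kernel_index:
  "ref_kernel y g b i d = measure_pmf (pmf_of_set (index_choices k (length (sorted_list_of_set (pre_pool y g i))))) \<bind>
     (\<lambda>js. return innov (g, (b, map (nth (sorted_list_of_set (pre_pool y g i))) js, i, d)))"
  unfolding ref_kernel_def pmf_of_ref_choices[OF finite_pre_pool] map_pmf_rep_eq
  by (subst bind_distr[where K = innov]) (auto intro!: in_subprob_algebra prob_space_return simp: space_pair_measure)

lemma measurable_ref_kernel:
  "(\<lambda>(y, g, b, i, d). ref_kernel y g b i d) \<in>
     state_space \<Otimes>\<^sub>M borel \<Otimes>\<^sub>M borel \<Otimes>\<^sub>M count_space UNIV \<Otimes>\<^sub>M (\<Pi>\<^sub>M j\<in>UNIV. borel) \<rightarrow>\<^sub>M subprob_algebra innov"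
  (is "_ \<in> ?N \<rightarrow>\<^sub>M _")
  unfolding ref_kernel_index case_prod_unfold
proof (rule measurable_bind)
  let ?p = "\<lambda>x :: 'n state \<times> real \<times> real \<times> 'n \<times> ('n \<Rightarrow> real).
    sorted_list_of_set (pre_pool (fst x) (fst (snd x)) (fst (snd (snd (snd x)))))"
  have p: "?p \<in> ?N \<rightarrow>\<^sub>M list_space borel"
    by (rule measurable_sorted_pre_pool) measurable
  have "(\<lambda>c. measure_pmf (pmf_of_set (index_choices k c))) \<in> count_space UNIV \<rightarrow>\<^sub>M subprob_algebra (count_space UNIV)"
    by (simp add: measure_pmf_in_subprob_algebra)
  from measurable_compose[OF measurable_compose[OF p measurable_length] this]
  show "(\<lambda>x. measure_pmf (pmf_of_set (index_choices k (length (?p x))))) \<in> ?N \<rightarrow>\<^sub>M subprob_algebra (count_space UNIV)" .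
  have "(\<lambda>z. map (nth (?p (fst z))) (snd z)) \<in> ?N \<Otimes>\<^sub>M count_space UNIV \<rightarrow>\<^sub>M list_space borel"
    by (rule measurable_map_nth[OF measurable_compose[OF measurable_fst p]]) simp
  then have "(\<lambda>z. (fst (snd (fst z)), fst (snd (snd (fst z))), map (nth (?p (fst z))) (snd z),
        fst (snd (snd (snd (fst z)))), snd (snd (snd (snd (fst z)))))) \<in> ?N \<Otimes>\<^sub>M count_space UNIV \<rightarrow>\<^sub>M innov"
    unfolding mark_space_def by measurable
  from measurable_compose[OF this return_measurable]
  show "(\<lambda>z. return innov (fst (snd (fst z)), fst (snd (snd (fst z))), map (nth (?p (fst z))) (snd z),
        fst (snd (snd (snd (fst z)))), snd (snd (snd (snd (fst z)))))) \<in> ?N \<Otimes>\<^sub>M count_space UNIV \<rightarrow>\<^sub>M subprob_algebra innov" .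
qed

lemma innovation_eq:
  "K y = expo \<bind> (\<lambda>g. uniform_measure lborel {0..1} \<bind> (\<lambda>b. measure_pmf \<nu> \<bind> (\<lambda>i. D i \<bind> (\<lambda>d. ref_kernel y g b i d))))"
  by (simp add: innovation_def expo_def ref_kernel_def)

text \<open>One stage of randomness is integrated out at a time, from the inside: delays, issuer,
  identifier, gap. Each partial integral stays measurable in the parameters that are still
  free.\<close>

lemma measurable_innovation_steps:
  shows "(\<lambda>(y, g, b, i). D i \<bind> (\<lambda>d. ref_kernel y g b i d)) \<in>
      state_space \<Otimes>\<^sub>M borel \<Otimes>\<^sub>M borel \<Otimes>\<^sub>M count_space UNIV \<rightarrow>\<^sub>M subprob_algebra innov" (is ?A)
    and "(\<lambda>(y, g, b). measure_pmf \<nu> \<bind> (\<lambda>i. D i \<bind> (\<lambda>d. ref_kernel y g b i d))) \<in>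
      state_space \<Otimes>\<^sub>M borel \<Otimes>\<^sub>M borel \<rightarrow>\<^sub>M subprob_algebra innov" (is ?B)
    and "(\<lambda>(y, g). uniform_measure lborel {0..1} \<bind>
        (\<lambda>b. measure_pmf \<nu> \<bind> (\<lambda>i. D i \<bind> (\<lambda>d. ref_kernel y g b i d)))) \<in>
      state_space \<Otimes>\<^sub>M borel \<rightarrow>\<^sub>M subprob_algebra innov" (is ?C)
    and measurable_innovation: "K \<in> state_space \<rightarrow>\<^sub>M subprob_algebra innov"
proof -
  note measurable_ref_kernel[measurable]
  show A: ?A
    unfolding case_prod_unfold
  proof (rule measurable_bind)
    show "(\<lambda>x. D (snd (snd (snd x)))) \<in> state_space \<Otimes>\<^sub>M borel \<Otimes>\<^sub>M borel \<Otimes>\<^sub>M count_space UNIV \<rightarrow>\<^sub>M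
        subprob_algebra (\<Pi>\<^sub>M j\<in>UNIV. borel)"
      by measurable
    show "(\<lambda>z. ref_kernel (fst (fst z)) (fst (snd (fst z))) (fst (snd (snd (fst z)))) (snd (snd (snd (fst z)))) (snd z))
      \<in> (state_space \<Otimes>\<^sub>M borel \<Otimes>\<^sub>M borel \<Otimes>\<^sub>M count_space UNIV) \<Otimes>\<^sub>M (\<Pi>\<^sub>M j\<in>UNIV. borel) \<rightarrow>\<^sub>M subprob_algebra innov"
      using measurable_compose[OF _ measurable_ref_kernel, of "\<lambda>z. (fst (fst z), fst (snd (fst z)), fst (snd (snd (fst z))), snd (snd (snd (fst z))), snd z)"]
      by simp
  qed
  show B: ?B
    unfolding case_prod_unfold
  proof (rule measurable_bind)
    show "(\<lambda>x. measure_pmf \<nu>) \<in> state_space \<Otimes>\<^sub>M borel \<Otimes>\<^sub>M borel \<rightarrow>\<^sub>M subprob_algebra (count_space UNIV)"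
      by (simp add: measure_pmf_in_subprob_algebra)
    show "(\<lambda>z. D (snd z) \<bind> ref_kernel (fst (fst z)) (fst (snd (fst z))) (snd (snd (fst z))) (snd z))
      \<in> (state_space \<Otimes>\<^sub>M borel \<Otimes>\<^sub>M borel) \<Otimes>\<^sub>M count_space UNIV \<rightarrow>\<^sub>M subprob_algebra innov"
      using measurable_compose[OF _ A, of "\<lambda>z. (fst (fst z), fst (snd (fst z)), snd (snd (fst z)), snd z)"]
      by simp
  qed
  show C: ?C
    unfolding case_prod_unfold
  proof (rule measurable_bind)
    show "(\<lambda>x. uniform_measure lborel {0..1::real}) \<in> state_space \<Otimes>\<^sub>M borel \<rightarrow>\<^sub>M subprob_algebra borel"
      by (rule measurable_const[OF uniform_in_subprob_algebra])
    show "(\<lambda>z. measure_pmf \<nu> \<bind> (\<lambda>i. D i \<bind> ref_kernel (fst (fst z)) (snd (fst z)) (snd z) i))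
      \<in> (state_space \<Otimes>\<^sub>M borel) \<Otimes>\<^sub>M borel \<rightarrow>\<^sub>M subprob_algebra innov"
    proof -
      have "(\<lambda>z. (fst (fst z), snd (fst z), snd z)) \<in>
          (state_space \<Otimes>\<^sub>M borel) \<Otimes>\<^sub>M borel \<rightarrow>\<^sub>M state_space \<Otimes>\<^sub>M borel \<Otimes>\<^sub>M borel"
        by measurable
      from measurable_compose[OF this B] show ?thesis by (simp only: prod.case)
    qed
  qed
  show "K \<in> state_space \<rightarrow>\<^sub>M subprob_algebra innov"
    unfolding innovation_eq[abs_def]
  proof (rule measurable_bind)
    show "(\<lambda>x. expo) \<in> state_space \<rightarrow>\<^sub>M subprob_algebra borel"
      by (simp add: in_subprob_algebra prob_space_expo)
    show "(\<lambda>z. uniform_measure lborel {0..1} \<bind>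
        (\<lambda>b. measure_pmf \<nu> \<bind> (\<lambda>i. D i \<bind> ref_kernel (fst z) (snd z) b i))) \<in>
      state_space \<Otimes>\<^sub>M borel \<rightarrow>\<^sub>M subprob_algebra innov"
      using C by (simp only: case_prod_unfold)
  qed
qed

end


section \<open>Integration against the innovation kernel\<close>

context block_model
begin

lemma AE_expo_pos: "AE g in expo. 0 < g"
proof -
  have "AE g in lborel. g \<noteq> (0::real)" by (rule AE_lborel_singleton)
  then have "AE g in lborel. 0 < exponential_density rate g \<longrightarrow> 0 < g"
    by eventually_elim (auto simp: exponential_density_def)
  then show ?thesis unfolding expo_def using rate by (subst AE_density) (auto simp: exponential_density_nonneg)
qed

lemma nn_integral_expo_id: "(\<integral>\<^sup>+ g. ennreal g \<partial>expo) = ennreal (1 / rate)"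
proof -
  have "(\<integral>\<^sup>+ g. ennreal g \<partial>expo) = (\<integral>\<^sup>+ g. ennreal (exponential_density rate g * g ^ 1) \<partial>lborel)"
    unfolding expo_def using rate
    by (subst nn_integral_density) (auto intro!: nn_integral_cong simp: ennreal_mult'' exponential_density_nonneg ennreal_mult')
  also have "\<dots> = ennreal (1 / rate)"
    using nn_integral_erlang_ith_moment[OF rate, of 0 1] by simp
  finally show ?thesis .
qed

text \<open>The exponential law charges every right tail. This is what lets the list of recent
  blocks shrink in the mean, and the drift weight divides by the remaining mass.\<close>

lemma expo_gap_less: "emeasure expo {..<\<Delta>} < 1"
proof -
  have "emeasure expo {..<\<Delta>} \<le> emeasure expo {..\<Delta>}" by (intro emeasure_mono) auto
  also have "\<dots> = ennreal (erlang_CDF 0 rate \<Delta>)"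
    unfolding expo_def by (rule emeasure_erlang_density[OF rate])
  also have "\<dots> < 1" using \<Delta> by (simp add: erlang_CDF_def)
  finally show ?thesis .
qed

lemma sets_innovation [simp, measurable_cong]: "sets (K y) = sets innov"
  by (rule sets_kernel[OF measurable_innovation]) simp

lemma space_innovation [simp]: "space (K y) = UNIV"
  using sets_eq_imp_space_eq[OF sets_innovation] by simp

lemma nn_integral_innovation:
  assumes [measurable]: "F \<in> borel_measurable innov"
  shows "(\<integral>\<^sup>+ z. F z \<partial>K y) = (\<integral>\<^sup>+ g. \<integral>\<^sup>+ b. \<integral>\<^sup>+ i. \<integral>\<^sup>+ d. \<integral>\<^sup>+ r. F (g, (b, r, i, d))
     \<partial>measure_pmf (pmf_of_set (ref_choices k (pre_pool y g i))) \<partial>D i \<partial>measure_pmf \<nu>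
     \<partial>uniform_measure lborel {0..1} \<partial>expo)"
proof -
  have ref: "(\<integral>\<^sup>+ z. F z \<partial>ref_kernel y g b i d) =
     (\<integral>\<^sup>+ r. F (g, (b, r, i, d)) \<partial>measure_pmf (pmf_of_set (ref_choices k (pre_pool y g i))))" for g b i d
    unfolding ref_kernel_def
    by (subst nn_integral_bind[where B = innov])
      (auto intro!: in_subprob_algebra prob_space_return nn_integral_cong nn_integral_return simp: space_pair_measure)
  have "(\<lambda>d. (y, g, b, i, d)) \<in> (\<Pi>\<^sub>M j\<in>UNIV. borel) \<rightarrow>\<^sub>M
      state_space \<Otimes>\<^sub>M borel \<Otimes>\<^sub>M borel \<Otimes>\<^sub>M count_space UNIV \<Otimes>\<^sub>M (\<Pi>\<^sub>M j\<in>UNIV. borel)" for g b :: real and i :: 'n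
    by measurable
  from measurable_compose[OF this measurable_ref_kernel]
  have 1: "(\<lambda>d. ref_kernel y g b i d) \<in> D i \<rightarrow>\<^sub>M subprob_algebra innov" for g b i
    by (simp only: prod.case measurable_cong_sets[OF delay_sets refl])
  have 2: "(\<lambda>i. D i \<bind> ref_kernel y g b i) \<in> measure_pmf \<nu> \<rightarrow>\<^sub>M subprob_algebra innov" for g b
  proof -
    have "(\<lambda>i. (y, g, b, i)) \<in> count_space UNIV \<rightarrow>\<^sub>M state_space \<Otimes>\<^sub>M borel \<Otimes>\<^sub>M borel \<Otimes>\<^sub>M count_space UNIV"
      by measurable
    from measurable_compose[OF this measurable_innovation_steps(1)] show ?thesis
      by (simp only: prod.case measurable_cong_sets[OF sets_measure_pmf_count_space refl])
  qed
  have 3: "(\<lambda>b. measure_pmf \<nu> \<bind> (\<lambda>i. D i \<bind> ref_kernel y g b i)) \<in> uniform_measure lborel {0..1} \<rightarrow>\<^sub>M subprob_algebra innov" for g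
  proof -
    have "(\<lambda>b. (y, g, b)) \<in> borel \<rightarrow>\<^sub>M state_space \<Otimes>\<^sub>M borel \<Otimes>\<^sub>M borel"
      by measurable
    from measurable_compose[OF this measurable_innovation_steps(2)] show ?thesis
      by (simp only: prod.case measurable_cong_sets[OF trans[OF sets_uniform_measure sets_lborel] refl])
  qed
  have 4: "(\<lambda>g. uniform_measure lborel {0..1} \<bind> (\<lambda>b. measure_pmf \<nu> \<bind> (\<lambda>i. D i \<bind> ref_kernel y g b i)))
      \<in> expo \<rightarrow>\<^sub>M subprob_algebra innov"
  proof -
    have "(\<lambda>g. (y, g)) \<in> borel \<rightarrow>\<^sub>M state_space \<Otimes>\<^sub>M borel"
      by measurable
    from measurable_compose[OF this measurable_innovation_steps(3)] show ?thesis
      by (simp only: prod.case measurable_cong_sets[OF sets_expo refl])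
  qed
  show ?thesis
    unfolding innovation_eq
    by (simp only: nn_integral_bind[OF assms 4] nn_integral_bind[OF assms 3] nn_integral_bind[OF assms 2]
        nn_integral_bind[OF assms 1] ref)
qed

text \<open>The gap is drawn before anything that depends on the state, and the later stages have
  total mass one. This is the independence of the gap from the current state, in the form used
  later.\<close>

lemma nn_integral_innovation_gap:
  assumes [measurable]: "h \<in> borel_measurable borel"
  shows "(\<integral>\<^sup>+ z. h (fst z) \<partial>K y) = (\<integral>\<^sup>+ g. h g \<partial>expo)"
  using prob_space.emeasure_space_1[OF delay_prob] prob_space.emeasure_space_1[OF prob_space_uniform]
  by (simp add: nn_integral_innovation)

lemma prob_space_innovation: "prob_space (K y)"
proof
  have "emeasure (K y) (space (K y)) = (\<integral>\<^sup>+ z. 1 \<partial>K y)" by simp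
  also have "\<dots> = (\<integral>\<^sup>+ g. 1 \<partial>expo)" by (rule nn_integral_innovation_gap) simp
  finally show "emeasure (K y) (space (K y)) = 1"
    using prob_space.emeasure_space_1[OF prob_space_expo] by simp
qed

text \<open>Null sets are allowed for the gap and the identifier only: issuer and delays are
  quantified universally, and the uniform choice charges nothing outside
  \<open>ref_choices\<close>.\<close>

lemma AE_innovationI:
  assumes [measurable]: "Measurable.pred innov P"
    and *: "AE g in expo. AE b in uniform_measure lborel {0..1}. \<forall>i d. \<forall>r\<in>ref_choices k (pre_pool y g i). P (g, (b, r, i, d))"
  shows "AE z in K y. P z"
proof -
  have sets: "{z \<in> space innov. \<not> P z} \<in> sets innov" by measurable
  have "emeasure (K y) {z \<in> space (K y). \<not> P z} = (\<integral>\<^sup>+ z. of_bool (\<not> P z) \<partial>K y)"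
  proof -
    have "(\<integral>\<^sup>+ z. of_bool (\<not> P z) \<partial>K y) = (\<integral>\<^sup>+ z. indicator {z \<in> space (K y). \<not> P z} z \<partial>K y)"
      by (auto intro!: nn_integral_cong simp: indicator_def)
    then show ?thesis using sets by (simp add: nn_integral_indicator)
  qed
  also have "\<dots> = (\<integral>\<^sup>+ g. \<integral>\<^sup>+ b. \<integral>\<^sup>+ i. \<integral>\<^sup>+ d. \<integral>\<^sup>+ r. of_bool (\<not> P (g, (b, r, i, d)))
     \<partial>measure_pmf (pmf_of_set (ref_choices k (pre_pool y g i))) \<partial>D i \<partial>measure_pmf \<nu>
     \<partial>uniform_measure lborel {0..1} \<partial>expo)"
    by (rule nn_integral_innovation) measurable
  also have "\<dots> = (\<integral>\<^sup>+ g. \<integral>\<^sup>+ b. 0 \<partial>uniform_measure lborel {0..1::real} \<partial>expo)"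
  proof (rule nn_integral_cong_AE)
    have z: "(\<integral>\<^sup>+ b. \<integral>\<^sup>+ i. \<integral>\<^sup>+ d. \<integral>\<^sup>+ r. of_bool (\<not> P (g, (b, r, i, d)))
        \<partial>measure_pmf (pmf_of_set (ref_choices k (pre_pool y g i))) \<partial>D i \<partial>measure_pmf \<nu>
        \<partial>uniform_measure lborel {0..1}) = (\<integral>\<^sup>+ b. 0 \<partial>uniform_measure lborel {0..1::real})"
      if "AE b in uniform_measure lborel {0..1}. \<forall>i d. \<forall>r\<in>ref_choices k (pre_pool y g i). P (g, (b, r, i, d))" for g
    proof (rule nn_integral_cong_AE)
      have "(\<integral>\<^sup>+ i. \<integral>\<^sup>+ d. \<integral>\<^sup>+ r. of_bool (\<not> P (g, (b, r, i, d)))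
          \<partial>measure_pmf (pmf_of_set (ref_choices k (pre_pool y g i))) \<partial>D i \<partial>measure_pmf \<nu>) = 0"
        if b: "\<forall>i d. \<forall>r\<in>ref_choices k (pre_pool y g i). P (g, (b, r, i, d))" for b
      proof -
        have "(\<integral>\<^sup>+ r. of_bool (\<not> P (g, (b, r, i, d)))
          \<partial>measure_pmf (pmf_of_set (ref_choices k (pre_pool y g i)))) = (0::ennreal)" for i d
          using b by (subst nn_integral_0_iff_AE)
            (auto simp: AE_measure_pmf_iff set_pmf_of_set ref_choices_finite ref_choices_nonempty)
        then show ?thesis by simp
      qed
      with that show "AE b in uniform_measure lborel {0..1}. (\<integral>\<^sup>+ i. \<integral>\<^sup>+ d. \<integral>\<^sup>+ r. of_bool (\<not> P (g, (b, r, i, d)))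
          \<partial>measure_pmf (pmf_of_set (ref_choices k (pre_pool y g i))) \<partial>D i \<partial>measure_pmf \<nu>) = 0"
        by (elim AE_mp) (auto intro!: AE_I2)
    qed
    from * show "AE g in expo. (\<integral>\<^sup>+ b. \<integral>\<^sup>+ i. \<integral>\<^sup>+ d. \<integral>\<^sup>+ r. of_bool (\<not> P (g, (b, r, i, d)))
        \<partial>measure_pmf (pmf_of_set (ref_choices k (pre_pool y g i))) \<partial>D i \<partial>measure_pmf \<nu>
        \<partial>uniform_measure lborel {0..1}) = (\<integral>\<^sup>+ b. 0 \<partial>uniform_measure lborel {0..1::real})"
      by eventually_elim (rule z)
  qed
  also have "\<dots> = 0" by simp
  finally show ?thesis using sets by (intro AE_I[OF order_refl]) auto
qed

text \<open>The facts about one step that replace \<open>valid_history\<close> in arguments along a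
  two-sided path, which has no initial history. Freshness of the identifier is demanded only
  relative to the current tips and references.\<close>

definition good :: "'n state \<Rightarrow> real \<times> 'n mark \<Rightarrow> bool" where
  "good y z \<longleftrightarrow> 0 < fst z \<and> length (refs (snd z)) \<le> k \<and> blockID (snd z) \<notin> set (refs (snd z)) \<and>
     blockID (snd z) \<notin> set (fst y)"

lemma pred_good [measurable (raw)]:
  assumes [measurable]: "y \<in> N \<rightarrow>\<^sub>M state_space" "z \<in> N \<rightarrow>\<^sub>M innov"
  shows "Measurable.pred N (\<lambda>x. good (y x) (z x))"
proof -
  have [measurable]: "(\<lambda>x. fst (y x)) \<in> N \<rightarrow>\<^sub>M list_space borel"
    by (rule measurable_compose[OF assms(1) measurable_obs_list])
  show ?thesis unfolding good_def by measurable
qed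

text \<open>For a fixed gap the tips and the local pools form a finite set that does not depend on
  the new identifier, hence a null set for the uniform law. Avoiding the pools excludes
  self-references.\<close>

lemma AE_good: "AE z in K y. good y z"
proof (rule AE_innovationI)
  have good: "good y (g, (b, r, i, d))" if "0 < g" "b \<notin> set (fst y) \<union> (\<Union>i. pre_pool y g i)"
    "r \<in> ref_choices k (pre_pool y g i)" for g b r i d
    using that by (auto simp: good_def blockID_def refs_def ref_choices_def)
  have fresh: "AE b in uniform_measure lborel {0..1}. b \<notin> set (fst y) \<union> (\<Union>i. pre_pool y g i)" for g
  proof (rule AE_uniform_measureI)
    have "set (fst y) \<union> (\<Union>i. pre_pool y g i) \<in> null_sets lborel"
      by (intro finite_imp_null_set_lborel) auto
    then show "AE b in lborel. b \<in> {0..1} \<longrightarrow> b \<notin> set (fst y) \<union> (\<Union>i. pre_pool y g i)"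
      by (auto dest!: AE_not_in)
  qed simp
  have "AE b in uniform_measure lborel {0..1}.
      \<forall>i d. \<forall>r\<in>ref_choices k (pre_pool y g i). good y (g, (b, r, i, d))" if "0 < g" for g
    using fresh[of g] by (rule eventually_mono) (use good that in blast)
  with AE_expo_pos show "AE g in expo. AE b in uniform_measure lborel {0..1}.
      \<forall>i d. \<forall>r\<in>ref_choices k (pre_pool y g i). good y (g, (b, r, i, d))"
    by (auto elim!: eventually_mono)
qed measurable

end

section \<open>Uniform references\<close>

text \<open>Double counting of pairs (element, list containing it). Transposing two elements
  permutes the choices, so every element lies in equally many of them.\<close>

lemma card_ref_choices_containing:
  assumes P: "finite P" and x: "x \<in> P"
  shows "card {r \<in> ref_choices k P. x \<in> set r} * card P = min k (card P) * card (ref_choices k P)"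
proof -
  note fin = ref_choices_finite[OF P, of k]
  have eq: "card {r \<in> ref_choices k P. x' \<in> set r} = card {r \<in> ref_choices k P. x \<in> set r}" if x': "x' \<in> P" for x'
  proof (rule bij_betw_same_card[of "map (Transposition.transpose x x')"], rule bij_betw_byWitness[where f' = "map (Transposition.transpose x x')"])
    have t: "map (Transposition.transpose x x') r \<in> ref_choices k P" if "r \<in> ref_choices k P" for r
      using that x x' by (auto simp: ref_choices_def distinct_map inj_on_def Transposition.transpose_def subset_eq)
    show "map (Transposition.transpose x x') ` {r \<in> ref_choices k P. x' \<in> set r} \<subseteq> {r \<in> ref_choices k P. x \<in> set r}"
      using t by (auto simp: image_iff intro!: bexI[of _ x'])
    show "map (Transposition.transpose x x') ` {r \<in> ref_choices k P. x \<in> set r} \<subseteq> {r \<in> ref_choices k P. x' \<in> set r}"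
      using t by (auto simp: image_iff intro!: bexI[of _ x])
  qed (auto simp: o_def)
  have "card {r \<in> ref_choices k P. x \<in> set r} * card P = (\<Sum>x'\<in>P. card {r \<in> ref_choices k P. x' \<in> set r})"
    using eq by simp
  also have "\<dots> = (\<Sum>x'\<in>P. \<Sum>r\<in>ref_choices k P. of_bool (x' \<in> set r))"
    using fin by (simp add: sum_of_bool_eq Int_def)
  also have "\<dots> = (\<Sum>r\<in>ref_choices k P. \<Sum>x'\<in>P. of_bool (x' \<in> set r))"
    by (rule sum.swap)
  also have "\<dots> = (\<Sum>r\<in>ref_choices k P. min k (card P))"
  proof (rule sum.cong[OF refl])
    fix r assume "r \<in> ref_choices k P"
    then have "P \<inter> {x'. x' \<in> set r} = set r" "card (set r) = min k (card P)"
      by (auto simp: ref_choices_def distinct_card)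
    then show "(\<Sum>x'\<in>P. of_bool (x' \<in> set r)) = min k (card P)"
      using P by (simp add: sum_of_bool_eq)
  qed
  finally show ?thesis by simp
qed

lemma prob_ref_contains:
  assumes P: "finite P" and x: "x \<in> P"
  shows "measure_pmf.prob (pmf_of_set (ref_choices k P)) {r. x \<in> set r} = min k (card P) / card P"
proof -
  have "card P > 0" using assms by (auto simp: card_gt_0_iff)
  moreover have "card (ref_choices k P) > 0"
    using ref_choices_finite[OF P] ref_choices_nonempty[OF P] by (auto simp: card_gt_0_iff)
  moreover have "ref_choices k P \<inter> {r. x \<in> set r} = {r \<in> ref_choices k P. x \<in> set r}" by auto
  moreover have "real (card {r \<in> ref_choices k P. x \<in> set r}) * card P = min k (card P) * card (ref_choices k P)"
    using card_ref_choices_containing[OF P x, of k] by (metis of_nat_mult)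
  ultimately show ?thesis
    by (simp add: measure_pmf_of_set ref_choices_finite[OF P] ref_choices_nonempty[OF P] field_simps)
qed


section \<open>Admissible states\<close>

lemma admissible_obs_distinct: "admissible k \<Delta> y \<Longrightarrow> distinct (fst y)"
  by (auto simp: admissible_def embed_state_def)

lemma admissible_ages:
  assumes "admissible k \<Delta> y" "(a, \<kappa>) \<in> set (snd (snd y))"
  shows "0 \<le> a"
  using assms by (auto simp: admissible_def embed_state_def)

lemma valid_history_length_refs:
  assumes "valid_history k \<Delta> h" "(s, \<kappa>) \<in> set h"
  shows "length (refs \<kappa>) \<le> k"
  using assms
  by (induction arbitrary: s \<kappa> rule: valid_history.induct) (auto simp: ref_choices_def refs_def)

abbreviation recent_ids :: "'n state \<Rightarrow> block set" where
  "recent_ids y \<equiv> (\<lambda>(a, \<kappa>). blockID \<kappa>) ` set (snd (snd y))"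

text \<open>A block of age at least \<open>\<Delta>\<close> has reached every node, so the local and
  the observer pool differ through recent blocks only. A tip that is not recent is visible
  everywhere. A pool element that is no observer tip was referenced by a block still in transit, and
  each recent block accounts for at most k of these.\<close>

lemma admissible_pre_pool:
  fixes y :: "'n::finite state"
  assumes adm: "admissible k \<Delta> y" and \<Delta>: "0 \<le> \<Delta>" and g: "0 < g"
  shows admissible_old_tips_visible: "set (fst y) - recent_ids y \<subseteq> pre_pool y g i"
    and admissible_card_pre_pool: "card (pre_pool y g i) \<le> obs_tips y + k * length (snd (snd y))"
proof -
  obtain h where h: "valid_history k \<Delta> h" and y: "y = embed_state \<Delta> h"
    using adm by (auto simp: admissible_def)
  define l where "l = last_time h"
  have pool: "pre_pool y g i = local_pool h i (l + g)"
    using pre_pool_embed[OF h \<Delta>, of "l + g" i] g by (simp add: l_def y)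
  have Ob: "set (fst y) = observer_pool h" "obs_tips y = card (observer_pool h)"
    by (simp_all add: y embed_state_def obs_tips_def)
  have recent: "(l - s, \<kappa>) \<in> set (snd (snd y))" if "(s, \<kappa>) \<in> set h" "\<kappa> \<notin> received h i (l + g)" for s \<kappa>
  proof -
    have "l - \<Delta> < s"
      using that valid_history_marks(3)[OF h that(1), of i] g by (force simp: received_def)
    moreover have "s \<le> l" using valid_history_times[OF h that(1)] by (simp add: l_def)
    ultimately show ?thesis using that(1) by (force simp: y embed_state_def l_def)
  qed
  show "set (fst y) - recent_ids y \<subseteq> pre_pool y g i"
  proof
    fix x assume x: "x \<in> set (fst y) - recent_ids y"
    then have notref: "x \<notin> (\<Union>\<kappa>\<in>snd ` set h. set (refs \<kappa>))" and "x \<in> {genesis} \<union> blockID ` snd ` set h"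
      by (auto simp: Ob observer_pool_def)
    moreover have "\<kappa> \<in> received h i (l + g)" if "(s, \<kappa>) \<in> set h" "x = blockID \<kappa>" for s \<kappa>
      using recent[OF that(1)] x that(2) by force
    ultimately show "x \<in> pre_pool y g i"
      unfolding pool local_pool_def by (auto simp: received_def)
  qed
  let ?U = "\<Union>z\<in>set (snd (snd y)). set (refs (snd z))"
  have "pre_pool y g i \<subseteq> observer_pool h \<union> ?U"
  proof
    fix x assume x: "x \<in> pre_pool y g i"
    show "x \<in> observer_pool h \<union> ?U"
    proof (cases "x \<in> (\<Union>\<kappa>\<in>snd ` set h. set (refs \<kappa>))")
      case True
      then obtain s \<kappa> where m: "(s, \<kappa>) \<in> set h" "x \<in> set (refs \<kappa>)" by auto
      then have "\<kappa> \<notin> received h i (l + g)" using x by (auto simp: pool local_pool_def)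
      from recent[OF m(1) this] m(2) have "x \<in> ?U"
        by (intro UN_I[of "(l - s, \<kappa>)"]) simp_all
      then show ?thesis by blast
    next
      case False
      have "x \<in> {genesis} \<union> blockID ` received h i (l + g)"
        using x unfolding pool local_pool_def by blast
      moreover have "received h i (l + g) \<subseteq> snd ` set h"
        by (force simp: received_def)
      ultimately show ?thesis using False unfolding observer_pool_def by blast
    qed
  qed
  then have "card (pre_pool y g i) \<le> card (observer_pool h \<union> ?U)"
    by (rule card_mono[rotated]) simp
  also have "\<dots> \<le> card (observer_pool h) + card ?U" by (rule card_Un_le)
  also have "card ?U \<le> (\<Sum>z\<in>set (snd (snd y)). card (set (refs (snd z))))"
    by (rule card_UN_le) simp
  also have "\<dots> \<le> (\<Sum>z\<in>set (snd (snd y)). k)"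
  proof (rule sum_mono)
    fix z assume "z \<in> set (snd (snd y))"
    then obtain s \<kappa> where "(s, \<kappa>) \<in> set h" "snd z = \<kappa>" by (auto simp: y embed_state_def)
    then show "card (set (refs (snd z))) \<le> k"
      using valid_history_length_refs[OF h] card_length[of "refs \<kappa>"] by (metis order_trans)
  qed
  also have "\<dots> \<le> k * length (snd (snd y))" by (simp add: card_length)
  finally show "card (pre_pool y g i) \<le> obs_tips y + k * length (snd (snd y))" by (simp add: Ob)
qed

lemma update_obs: "fst (update \<Delta> y g \<kappa>) = sorted_list_of_set ((set (fst y) \<union> {blockID \<kappa>}) - set (refs \<kappa>))"
  by (simp add: update_def Let_def case_prod_unfold)

lemma update_recent: "snd (snd (update \<Delta> y g \<kappa>)) = filter (\<lambda>(a, _). a < \<Delta>) (aged g (snd (snd y)) @ [(0, \<kappa>)])"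
  by (simp add: update_def Let_def case_prod_unfold)

text \<open>A gap of length at least \<open>\<Delta>\<close> makes every earlier block too old for
  the list, so that at most the new block is left.\<close>

lemma length_update_recent:
  assumes "admissible k \<Delta> y"
  shows "length (snd (snd (update \<Delta> y g \<kappa>))) \<le> 1 + (if g < \<Delta> then length (snd (snd y)) else 0)"
proof -
  have "filter (\<lambda>(a, _). a < \<Delta>) (aged g (snd (snd y))) = []" if "\<not> g < \<Delta>"
    using that admissible_ages[OF assms] by (force simp: aged_def filter_empty_conv)
  moreover have "length (filter (\<lambda>(a, _). a < \<Delta>) (aged g (snd (snd y)))) \<le> length (snd (snd y))"
    by (rule order_trans[OF length_filter_le]) (simp add: aged_def)
  ultimately show ?thesis by (auto simp: update_recent)
qed

text \<open>Written as a sum because subtraction on natural numbers truncates.\<close>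

lemma obs_tips_update:
  assumes "distinct (fst y)" "blockID \<kappa> \<notin> set (fst y)" "blockID \<kappa> \<notin> set (refs \<kappa>)"
  shows "obs_tips (update \<Delta> y g \<kappa>) + card (set (refs \<kappa>) \<inter> set (fst y)) = obs_tips y + 1"
proof -
  have "(set (fst y) \<union> {blockID \<kappa>}) - set (refs \<kappa>) = insert (blockID \<kappa>) (set (fst y) - set (refs \<kappa>) \<inter> set (fst y))"
    using assms(3) by auto
  then have "obs_tips (update \<Delta> y g \<kappa>) = Suc (card (set (fst y) - set (refs \<kappa>) \<inter> set (fst y)))"
    using assms(2) by (simp add: obs_tips_def update_obs)
  also have "card (set (fst y) - set (refs \<kappa>) \<inter> set (fst y)) = card (set (fst y)) - card (set (refs \<kappa>) \<inter> set (fst y))"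
    by (rule card_Diff_subset) auto
  finally show ?thesis
    using assms(1) card_mono[of "set (fst y)" "set (refs \<kappa>) \<inter> set (fst y)"] by (simp add: obs_tips_def distinct_card)
qed

context block_model
begin

text \<open>The tip is in the pre-issuance pool of every issuer. A uniform choice from c elements
  contains it with probability \<open>min k c / c\<close>, at least \<open>min 1 (2 / c)\<close>
  since \<open>k \<ge> 2\<close>, and c is bounded by the size estimate for pools.\<close>

lemma emeasure_innovation_ref:
  assumes adm: "admissible k \<Delta> y" and x: "x \<in> set (fst y) - recent_ids y"
  shows "ennreal (min 1 (2 / (obs_tips y + k * length (snd (snd y))))) \<le> emeasure (K y) {z. x \<in> set (refs (snd z))}"
    (is "ennreal ?q \<le> _")
proof -
  have [measurable]: "Measurable.pred innov (\<lambda>z. x \<in> set (refs (snd z)))" by measurable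
  have sets: "{z. x \<in> set (refs (snd z))} \<in> sets (K y)"
    using measurable_sets[of "\<lambda>z. x \<in> set (refs (snd z))" innov "count_space UNIV" "{True}"]
    by (simp add: vimage_def)
  have "ennreal ?q = (\<integral>\<^sup>+ g. \<integral>\<^sup>+ b. \<integral>\<^sup>+ i. \<integral>\<^sup>+ d. ennreal ?q \<partial>D i \<partial>measure_pmf \<nu>
     \<partial>uniform_measure lborel {0..1::real} \<partial>expo)"
    using prob_space.emeasure_space_1[OF delay_prob] prob_space.emeasure_space_1[OF prob_space_uniform]
      prob_space.emeasure_space_1[OF prob_space_expo]
    by simp
  also have "\<dots> \<le> (\<integral>\<^sup>+ g. \<integral>\<^sup>+ b. \<integral>\<^sup>+ i. \<integral>\<^sup>+ d. \<integral>\<^sup>+ r. indicator {z. x \<in> set (refs (snd z))} (g, (b, r, i, d))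
     \<partial>measure_pmf (pmf_of_set (ref_choices k (pre_pool y g i))) \<partial>D i \<partial>measure_pmf \<nu>
     \<partial>uniform_measure lborel {0..1::real} \<partial>expo)"
  proof (rule nn_integral_mono_AE, rule AE_mp[OF AE_expo_pos AE_I2], rule impI, intro nn_integral_mono)
    fix g b :: real and i d assume g: "0 < g"
    let ?P = "pre_pool y g i"
    have xP: "x \<in> ?P" and c: "card ?P \<le> obs_tips y + k * length (snd (snd y))"
      using admissible_old_tips_visible[OF adm \<Delta> g, of i] x admissible_card_pre_pool[OF adm \<Delta> g, of i] by auto
    have pos: "0 < card ?P" using xP by (auto simp: card_gt_0_iff)
    have "real (card ?P) \<le> obs_tips y + k * length (snd (snd y))"
      using c by (metis of_nat_mono)
    then have "?q \<le> min 1 (2 / card ?P)"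
      using pos by (intro min.mono divide_left_mono order_refl) (auto intro!: mult_pos_pos)
    also have "\<dots> \<le> min k (card ?P) / card ?P"
      using k pos by (auto simp: min_def field_simps)
    also have "\<dots> = measure_pmf.prob (pmf_of_set (ref_choices k ?P)) {r. x \<in> set r}"
      by (rule prob_ref_contains[symmetric]) (use xP in auto)
    finally have "ennreal ?q \<le> emeasure (measure_pmf (pmf_of_set (ref_choices k ?P))) {r. x \<in> set r}"
      by (simp add: measure_pmf.emeasure_eq_measure)
    also have "\<dots> = (\<integral>\<^sup>+ r. indicator {r. x \<in> set r} r \<partial>measure_pmf (pmf_of_set (ref_choices k ?P)))"
      by simp
    also have "\<dots> = (\<integral>\<^sup>+ r. indicator {z. x \<in> set (refs (snd z))} (g, (b, r, i, d)) \<partial>measure_pmf (pmf_of_set (ref_choices k ?P)))"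
      by (intro nn_integral_cong) (simp add: refs_def indicator_def)
    finally show "ennreal ?q \<le> (\<integral>\<^sup>+ r. indicator {z. x \<in> set (refs (snd z))} (g, (b, r, i, d)) \<partial>measure_pmf (pmf_of_set (ref_choices k ?P)))" .
  qed
  also have "\<dots> = (\<integral>\<^sup>+ z. indicator {z. x \<in> set (refs (snd z))} z \<partial>K y)"
    using sets by (intro nn_integral_innovation[symmetric]) simp
  also have "\<dots> = emeasure (K y) {z. x \<in> set (refs (snd z))}"
    using sets by simp
  finally show ?thesis .
qed

end


section \<open>A drift inequality\<close>

context block_model
begin

text \<open>Chosen such that the weight times the probability of a gap of length at least
  \<open>\<Delta>\<close> equals \<open>4 * (k + 1)\<close>, the coefficient of the recent blocks in
  \<open>reference_rate_bound\<close>.\<close>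

definition drift_weight :: real where
  "drift_weight = 4 * (real k + 1) / (1 - measure expo {..<\<Delta>})"

text \<open>The square makes the drift proportional to the number of tips, so that it bounds their
  mean; a linear function would have bounded drift. The second term pays for the references lost to
  recent blocks.\<close>

definition lyapunov :: "'n state \<Rightarrow> real" where
  "lyapunov y = (real (obs_tips y))\<^sup>2 + drift_weight * real (length (snd (snd y)))"

text \<open>The square of k bounds the squared number of removed tips, the weight accounts for the
  new recent block, and 5 is 1 from expanding \<open>(X + 1)\<^sup>2\<close> plus the 4 of
  \<open>reference_rate_bound\<close>.\<close>

definition drift_const :: real where
  "drift_const = (real k)\<^sup>2 + drift_weight + 5"

lemma measure_gap_less: "measure expo {..<\<Delta>} < 1"
  using expo_gap_less finite_measure.emeasure_eq_measure[OF prob_space.finite_measure[OF prob_space_expo]]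
  by simp

lemma drift_weight_pos: "0 < drift_weight"
  using measure_gap_less k by (simp add: drift_weight_def)

lemma lyapunov_nonneg: "0 \<le> lyapunov y"
  using drift_weight_pos by (simp add: lyapunov_def)

lemma measurable_lyapunov [measurable]: "lyapunov \<in> borel_measurable state_space"
  unfolding lyapunov_def[abs_def] by measurable

text \<open>With N removed tips the new count is X + 1 - N, and N is at most k. The mixed term 2 X N
  stays on the left, so that both sides are nonnegative and can be integrated in
  \<open>ennreal\<close>.\<close>

lemma lyapunov_update_le:
  assumes adm: "admissible k \<Delta> y" and good: "good y z"
  shows "lyapunov (update \<Delta> y (fst z) (snd z)) + 2 * real (obs_tips y) * real (card (set (refs (snd z)) \<inter> set (fst y))) \<le>
    (real (obs_tips y) + 1)\<^sup>2 + (real k)\<^sup>2 + drift_weight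
      + drift_weight * real (length (snd (snd y))) * indicator {..<\<Delta>} (fst z)"
proof -
  let ?X = "real (obs_tips y)" and ?N = "real (card (set (refs (snd z)) \<inter> set (fst y)))"
  let ?X' = "real (obs_tips (update \<Delta> y (fst z) (snd z)))"
  have "card (set (refs (snd z)) \<inter> set (fst y)) \<le> card (set (refs (snd z)))"
    by (intro card_mono) auto
  also have "\<dots> \<le> k" using good card_length[of "refs (snd z)"] by (simp add: good_def)
  finally have N: "?N\<^sup>2 \<le> (real k)\<^sup>2" by (simp add: power_mono)
  have X': "?X' = ?X + 1 - ?N"
    using obs_tips_update[OF admissible_obs_distinct[OF adm], of "snd z" \<Delta> "fst z"] good
    by (simp add: good_def)
  have "?X'\<^sup>2 + 2 * ?X * ?N = (?X + 1)\<^sup>2 - 2 * ?N + ?N\<^sup>2"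
    unfolding X' by (simp add: power2_eq_square algebra_simps)
  also have "\<dots> \<le> (?X + 1)\<^sup>2 + (real k)\<^sup>2"
    using N by linarith
  finally have 1: "?X'\<^sup>2 + 2 * ?X * ?N \<le> (?X + 1)\<^sup>2 + (real k)\<^sup>2" .
  have "real (length (snd (snd (update \<Delta> y (fst z) (snd z))))) \<le> 1 + real (length (snd (snd y))) * indicator {..<\<Delta>} (fst z)"
    using length_update_recent[OF adm, of "fst z" "snd z"] by (auto split: if_splits simp: indicator_def)
  then have "drift_weight * length (snd (snd (update \<Delta> y (fst z) (snd z))))
      \<le> drift_weight * (1 + real (length (snd (snd y))) * indicator {..<\<Delta>} (fst z))"
    using drift_weight_pos by (intro mult_left_mono) auto
  with 1 show ?thesis by (simp add: lyapunov_def algebra_simps)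
qed

text \<open>Linearity of expectation over the tips that are not recent. There are at least as many
  of them as tips minus recent blocks, and each is referenced with the probability bounded
  above.\<close>

lemma expected_tip_refs:
  fixes y :: "'n state"
  assumes adm: "admissible k \<Delta> y"
  defines "s \<equiv> real (obs_tips y + k * length (snd (snd y)))"
  shows "ennreal (max 0 (real (obs_tips y) - length (snd (snd y))) * min 1 (2 / s)) \<le>
     (\<integral>\<^sup>+ z. ennreal (card (set (refs (snd z)) \<inter> set (fst y))) \<partial>K y)"
proof -
  let ?q = "min 1 (2 / s)" and ?A = "set (fst y) - recent_ids y"
  have q: "0 \<le> ?q" by (simp add: s_def)
  have sets [measurable]: "{z. x \<in> set (refs (snd z))} \<in> sets (K y)" for x
  proof -
    have "Measurable.pred innov (\<lambda>z. x \<in> set (refs (snd z)))" by measurable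
    then show ?thesis by (simp add: pred_def)
  qed
  have "obs_tips y = card (set (fst y))"
    using admissible_obs_distinct[OF adm] by (simp add: obs_tips_def distinct_card)
  moreover have "card (recent_ids y) \<le> length (snd (snd y))"
    by (rule order_trans[OF card_image_le card_length]) simp
  moreover have "card (set (fst y)) - card (recent_ids y) \<le> card ?A"
    by (rule diff_card_le_card_Diff) simp
  ultimately have A: "max 0 (real (obs_tips y) - length (snd (snd y))) \<le> card ?A"
    by linarith
  have "ennreal (max 0 (real (obs_tips y) - length (snd (snd y))) * ?q) \<le> ennreal (card ?A * ?q)"
    using A q by (intro ennreal_leI mult_right_mono)
  also have "\<dots> = (\<Sum>x\<in>?A. ennreal ?q)"
    using q by (simp add: ennreal_mult ennreal_of_nat_eq_real_of_nat)
  also have "\<dots> \<le> (\<Sum>x\<in>?A. emeasure (K y) {z. x \<in> set (refs (snd z))})"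
    unfolding s_def by (intro sum_mono emeasure_innovation_ref adm)
  also have "\<dots> \<le> (\<Sum>x\<in>set (fst y). emeasure (K y) {z. x \<in> set (refs (snd z))})"
    by (intro sum_mono2) auto
  also have "\<dots> = (\<integral>\<^sup>+ z. (\<Sum>x\<in>set (fst y). indicator {z. x \<in> set (refs (snd z))} z) \<partial>K y)"
    by (subst nn_integral_sum) (auto intro!: sum.cong nn_integral_indicator[symmetric] sets borel_measurable_indicator)
  also have "\<dots> = (\<integral>\<^sup>+ z. ennreal (card (set (refs (snd z)) \<inter> set (fst y))) \<partial>K y)"
  proof (intro nn_integral_cong)
    fix z
    have "(\<Sum>x\<in>set (fst y). indicator {z. x \<in> set (refs (snd z))} z) = (\<Sum>x\<in>set (fst y). of_bool (x \<in> set (refs (snd z))) :: ennreal)"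
      by (intro sum.cong) (simp_all add: indicator_def)
    also have "\<dots> = of_nat (card (set (fst y) \<inter> {x. x \<in> set (refs (snd z))}))"
      by (simp add: sum_of_bool_eq)
    also have "set (fst y) \<inter> {x. x \<in> set (refs (snd z))} = set (refs (snd z)) \<inter> set (fst y)" by auto
    finally show "(\<Sum>x\<in>set (fst y). indicator {z. x \<in> set (refs (snd z))} z) = ennreal (card (set (refs (snd z)) \<inter> set (fst y)))"
      by (simp add: ennreal_of_nat_eq_real_of_nat)
  qed
  finally show ?thesis .
qed

text \<open>The main case is \<open>s \<ge> 2\<close> with more tips than recent blocks, where the
  product is 4 X (X - r) / s. If \<open>X \<le> r\<close> the term with r suffices, and if s is
  below 2 then \<open>X \<le> 1\<close> and the constant 4 suffices.\<close>

lemma reference_rate_bound: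
  fixes X r :: nat
  assumes "s = real (X + k * r)"
  shows "4 * real X \<le> 2 * real X * (max 0 (real X - real r) * min 1 (2 / s)) + 4 * (real k + 1) * real r + 4"
proof (cases "X \<le> r")
  case True
  then have "real X \<le> r" by simp
  moreover have "4 * (real k + 1) * real r = 4 * (real k * real r) + 4 * real r" by (simp add: algebra_simps)
  moreover have "0 \<le> real k * r" by simp
  moreover have "max 0 (real X - r) = 0" using True by simp
  ultimately show ?thesis by (simp only: mult_zero_left mult_zero_right)
next
  case False
  then have Xr: "real r + 1 \<le> X" by linarith
  then have s: "real X \<le> s" using assms by simp
  show ?thesis
  proof (cases "s < 2")
    case True
    then have "real X < real 2" using s by simp
    then have "real X \<le> 1" by (simp only: of_nat_less_iff)
    moreover have "0 \<le> 2 * real X * (max 0 (real X - real r) * min 1 (2 / s)) + 4 * (real k + 1) * real r"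
      using s by (intro add_nonneg_nonneg mult_nonneg_nonneg) auto
    ultimately show ?thesis by linarith
  next
    case False
    then have "2 * real X * (max 0 (real X - real r) * min 1 (2 / s)) = 4 * (real X * (real X - real r) / s)"
      using Xr by (simp add: min_def field_simps)
    moreover have "real X - (real k + 1) * real r \<le> real X * (real X - real r) / s"
    proof -
      \<comment> \<open>Since s = X + k r, the mixed terms combine to -X r and the remainder -k (k +
        1) r^2 is nonpositive; so dividing by s costs at most (k + 1) r.\<close>
      have "(real X - (real k + 1) * r) * s = real X * (real X - r) - real k * (real k + 1) * (real r)\<^sup>2"
        unfolding assms by (simp add: power2_eq_square algebra_simps)
      also have "\<dots> \<le> real X * (real X - r)" by simp
      finally show ?thesis using False by (simp add: pos_le_divide_eq)
    qed
    moreover have "4 * (real k + 1) * real r = 4 * ((real k + 1) * real r)" by simp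
    ultimately show ?thesis by linarith
  qed
qed

lemma lyapunov_drift:
  assumes adm: "admissible k \<Delta> y"
  shows "(\<integral>\<^sup>+ z. ennreal (lyapunov (update \<Delta> y (fst z) (snd z))) \<partial>K y) + ennreal (2 * obs_tips y)
    \<le> ennreal (lyapunov y) + ennreal drift_const"
proof -
  let ?X = "real (obs_tips y)" and ?r = "real (length (snd (snd y)))" and ?a = drift_weight
  let ?N = "\<lambda>z :: real \<times> 'n mark. card (set (refs (snd z)) \<inter> set (fst y))"
  let ?e = "measure expo {..<\<Delta>}"
  let ?w = "max 0 (?X - ?r) * min 1 (2 / real (obs_tips y + k * length (snd (snd y))))"
  define I where "I = (\<integral>\<^sup>+ z. ennreal (lyapunov (update \<Delta> y (fst z) (snd z))) \<partial>K y)"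
  have [measurable]: "?N \<in> innov \<rightarrow>\<^sub>M count_space UNIV"
  proof (rule measurable_card_subset_list)
    show b: "(\<lambda>z. refs (snd z)) \<in> innov \<rightarrow>\<^sub>M list_space borel" by measurable
    note measurable_nth_borel_compose[OF b, measurable]
    have "(\<lambda>z. fst y) \<in> innov \<rightarrow>\<^sub>M list_space borel"
      by (simp add: space_list_space)
    note this[measurable]
    show "Measurable.pred innov (\<lambda>z. refs (snd z) ! j \<in> set (refs (snd z)) \<inter> set (fst y))" for j
      unfolding Int_iff by measurable
  qed auto
  have a: "0 < ?a" by (rule drift_weight_pos)
  have w: "0 \<le> ?w" by simp
  have "I + ennreal (2 * ?X) * ennreal ?w
      \<le> I + ennreal (2 * ?X) * (\<integral>\<^sup>+ z. ennreal (?N z) \<partial>K y)"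
    by (intro add_left_mono mult_left_mono expected_tip_refs adm) simp
  also have "\<dots> = (\<integral>\<^sup>+ z. ennreal (lyapunov (update \<Delta> y (fst z) (snd z))) + ennreal (2 * ?X) * ennreal (?N z) \<partial>K y)"
    unfolding I_def by (subst nn_integral_add) (simp_all add: nn_integral_cmult)
  also have "\<dots> \<le> (\<integral>\<^sup>+ z. ennreal ((?X + 1)\<^sup>2 + (real k)\<^sup>2 + ?a) + ennreal (?a * ?r) * indicator {..<\<Delta>} (fst z) \<partial>K y)"
  proof (rule nn_integral_mono_AE, rule AE_mp[OF AE_good AE_I2], rule impI)
    fix z assume z: "good y z"
    have "ennreal (lyapunov (update \<Delta> y (fst z) (snd z))) + ennreal (2 * ?X) * ennreal (?N z)
       = ennreal (lyapunov (update \<Delta> y (fst z) (snd z)) + 2 * ?X * ?N z)"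
      by (simp add: ennreal_mult lyapunov_nonneg)
    also have "\<dots> \<le> ennreal ((?X + 1)\<^sup>2 + (real k)\<^sup>2 + ?a + ?a * ?r * indicator {..<\<Delta>} (fst z))"
      by (intro ennreal_leI lyapunov_update_le adm z)
    also have "\<dots> = ennreal ((?X + 1)\<^sup>2 + (real k)\<^sup>2 + ?a) + ennreal (?a * ?r) * indicator {..<\<Delta>} (fst z)"
      using a by (auto simp: indicator_def)
    finally show "ennreal (lyapunov (update \<Delta> y (fst z) (snd z))) + ennreal (2 * ?X) * ennreal (?N z)
      \<le> ennreal ((?X + 1)\<^sup>2 + (real k)\<^sup>2 + ?a) + ennreal (?a * ?r) * indicator {..<\<Delta>} (fst z)" .
  qed
  also have "\<dots> = (\<integral>\<^sup>+ g. ennreal ((?X + 1)\<^sup>2 + (real k)\<^sup>2 + ?a) + ennreal (?a * ?r) * indicator {..<\<Delta>} g \<partial>expo)"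
    by (rule nn_integral_innovation_gap) measurable
  also have "\<dots> = ennreal ((?X + 1)\<^sup>2 + (real k)\<^sup>2 + ?a) + ennreal (?a * ?r) * emeasure expo {..<\<Delta>}"
    using prob_space.emeasure_space_1[OF prob_space_expo]
    by (subst nn_integral_add) (auto simp: nn_integral_cmult)
  also have "\<dots> = ennreal ((?X + 1)\<^sup>2 + (real k)\<^sup>2 + ?a + ?a * ?r * ?e)"
    using a finite_measure.emeasure_eq_measure[OF prob_space.finite_measure[OF prob_space_expo]]
    by (simp add: ennreal_mult)
  finally have main: "I + ennreal (2 * ?X * ?w) \<le> ennreal ((?X + 1)\<^sup>2 + (real k)\<^sup>2 + ?a + ?a * ?r * ?e)"
    using w by (simp add: ennreal_mult)
  \<comment> \<open>The bound makes the integral finite, and the rest is arithmetic over the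
    reals.\<close>
  have "I \<le> I + ennreal (2 * ?X * ?w)" by simp
  also note main
  finally have "I < \<infinity>" by (rule le_less_trans) simp
  then obtain i where i: "0 \<le> i" "I = ennreal i" by (cases I) auto
  have "0 \<le> 2 * ?X * ?w" by simp
  then have "ennreal (i + 2 * ?X * ?w) \<le> ennreal ((?X + 1)\<^sup>2 + (real k)\<^sup>2 + ?a + ?a * ?r * ?e)"
    using main i by simp
  then have "i + 2 * ?X * ?w \<le> (?X + 1)\<^sup>2 + (real k)\<^sup>2 + ?a + ?a * ?r * ?e"
    using a by (subst (asm) ennreal_le_iff) auto
  moreover have "4 * ?X \<le> 2 * ?X * ?w + 4 * (real k + 1) * ?r + 4"
    by (rule reference_rate_bound) simp
  \<comment> \<open>Here the value of \<open>drift_weight\<close> is used: the surplus of recent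
    blocks is absorbed exactly.\<close>
  moreover have "?a * ?r * ?e + 4 * (real k + 1) * ?r = ?a * ?r"
    using measure_gap_less by (simp add: drift_weight_def field_simps)
  ultimately have "i + 2 * ?X \<le> lyapunov y + drift_const"
    by (simp add: lyapunov_def drift_const_def power2_eq_square algebra_simps)
  then show ?thesis
    using i a lyapunov_nonneg[of y] unfolding I_def[symmetric]
    by (simp add: drift_const_def flip: ennreal_plus)
qed

end

section \<open>The joint law of past and innovation\<close>

text \<open>Rectangles form a generator stable under intersection, so the law of the pair is the
  composition of P with the kernel. The kernel may depend on the sample point and not just on X,
  which allows it to be given by the current state.\<close>

lemma nn_integral_semidirect:
  fixes X :: "'a \<Rightarrow> 'b" and Z :: "'a \<Rightarrow> 'c"
  assumes P: "prob_space P" and X [measurable]: "X \<in> P \<rightarrow>\<^sub>M M" and Z [measurable]: "Z \<in> P \<rightarrow>\<^sub>M N"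
    and \<kappa> [measurable]: "\<kappa> \<in> P \<rightarrow>\<^sub>M subprob_algebra N"
    and eq: "\<And>A B. A \<in> sets M \<Longrightarrow> B \<in> sets N \<Longrightarrow>
      emeasure P {\<omega> \<in> space P. X \<omega> \<in> A \<and> Z \<omega> \<in> B} = (\<integral>\<^sup>+ \<omega>. indicator A (X \<omega>) * emeasure (\<kappa> \<omega>) B \<partial>P)"
    and F [measurable]: "F \<in> borel_measurable (M \<Otimes>\<^sub>M N)"
  shows "(\<integral>\<^sup>+ \<omega>. F (X \<omega>, Z \<omega>) \<partial>P) = (\<integral>\<^sup>+ \<omega>. \<integral>\<^sup>+ z. F (X \<omega>, z) \<partial>\<kappa> \<omega> \<partial>P)"
proof -
  interpret prob_space P by fact
  have sets_\<kappa>: "sets (\<kappa> \<omega>) = sets N" if "\<omega> \<in> space P" for \<omega>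
    using sets_kernel[OF \<kappa> that] .
  define \<mu> where "\<mu> = distr P (M \<Otimes>\<^sub>M N) (\<lambda>\<omega>. (X \<omega>, Z \<omega>))"
  define k where "k = (\<lambda>\<omega>. distr (\<kappa> \<omega>) (M \<Otimes>\<^sub>M N) (\<lambda>z. (X \<omega>, z)))"
  have k [measurable]: "k \<in> P \<rightarrow>\<^sub>M subprob_algebra (M \<Otimes>\<^sub>M N)"
    unfolding k_def by (rule measurable_distr2[OF _ \<kappa>]) measurable
  have pair [measurable]: "(\<lambda>z. (X \<omega>, z)) \<in> \<kappa> \<omega> \<rightarrow>\<^sub>M M \<Otimes>\<^sub>M N" if "\<omega> \<in> space P" for \<omega>
    using measurable_space[OF X that]
    by (simp add: measurable_cong_sets[OF sets_\<kappa>[OF that] refl])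
  have "\<mu> = P \<bind> k"
  proof (rule measure_eqI_generator_eq[where E = "{A \<times> B | A B. A \<in> sets M \<and> B \<in> sets N}" and
        \<Omega> = "space M \<times> space N" and A = "\<lambda>_. space M \<times> space N"])
    show "Int_stable {A \<times> B | A B. A \<in> sets M \<and> B \<in> sets N}" by (rule Int_stable_pair_measure_generator)
    show "{A \<times> B | A B. A \<in> sets M \<and> B \<in> sets N} \<subseteq> Pow (space M \<times> space N)"
      by (auto dest: sets.sets_into_space)
    show "sets \<mu> = sigma_sets (space M \<times> space N) {A \<times> B | A B. A \<in> sets M \<and> B \<in> sets N}"
      by (simp add: \<mu>_def sets_pair_measure)
    show "sets (P \<bind> k) = sigma_sets (space M \<times> space N) {A \<times> B | A B. A \<in> sets M \<and> B \<in> sets N}"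
      using sets_bind[OF sets_kernel[OF k], of P] not_empty by (simp add: sets_pair_measure)
    show "emeasure \<mu> X' = emeasure (P \<bind> k) X'" if X': "X' \<in> {A \<times> B | A B. A \<in> sets M \<and> B \<in> sets N}" for X'
    proof -
      obtain A B where AB [measurable]: "A \<in> sets M" "B \<in> sets N" and X'_eq: "X' = A \<times> B" using X' by auto
      have "emeasure \<mu> (A \<times> B) = emeasure P {\<omega> \<in> space P. X \<omega> \<in> A \<and> Z \<omega> \<in> B}"
        unfolding \<mu>_def by (subst emeasure_distr) (auto intro!: arg_cong[of _ _ "emeasure P"])
      also have "\<dots> = (\<integral>\<^sup>+ \<omega>. indicator A (X \<omega>) * emeasure (\<kappa> \<omega>) B \<partial>P)" by (rule eq) fact+
      also have "\<dots> = (\<integral>\<^sup>+ \<omega>. emeasure (k \<omega>) (A \<times> B) \<partial>P)"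
      proof (rule nn_integral_cong)
        fix \<omega> assume \<omega>: "\<omega> \<in> space P"
        have "emeasure (k \<omega>) (A \<times> B) = emeasure (\<kappa> \<omega>) ((\<lambda>z. (X \<omega>, z)) -` (A \<times> B) \<inter> space (\<kappa> \<omega>))"
          unfolding k_def using pair[OF \<omega>] by (rule emeasure_distr) simp
        also have "(\<lambda>z. (X \<omega>, z)) -` (A \<times> B) \<inter> space (\<kappa> \<omega>) = (if X \<omega> \<in> A then B else {})"
          using sets.sets_into_space[OF AB(2)] sets_eq_imp_space_eq[OF sets_\<kappa>[OF \<omega>]] by auto
        finally show "indicator A (X \<omega>) * emeasure (\<kappa> \<omega>) B = emeasure (k \<omega>) (A \<times> B)" by simp
      qed
      also have "\<dots> = emeasure (P \<bind> k) (A \<times> B)"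
        by (rule emeasure_bind[symmetric, OF not_empty k]) simp
      finally show ?thesis by (simp add: X'_eq)
    qed
    interpret \<mu>: prob_space \<mu> unfolding \<mu>_def by (rule prob_space_distr) simp
    show "emeasure \<mu> (space M \<times> space N) \<noteq> \<infinity>" by simp
  qed auto
  then have "(\<integral>\<^sup>+ x. F x \<partial>\<mu>) = (\<integral>\<^sup>+ \<omega>. \<integral>\<^sup>+ x. F x \<partial>k \<omega> \<partial>P)"
    by (simp add: nn_integral_bind[OF F k])
  moreover have "(\<integral>\<^sup>+ x. F x \<partial>\<mu>) = (\<integral>\<^sup>+ \<omega>. F (X \<omega>, Z \<omega>) \<partial>P)"
    unfolding \<mu>_def by (subst nn_integral_distr) simp_all
  moreover have "(\<integral>\<^sup>+ \<omega>. \<integral>\<^sup>+ x. F x \<partial>k \<omega> \<partial>P) = (\<integral>\<^sup>+ \<omega>. \<integral>\<^sup>+ z. F (X \<omega>, z) \<partial>\<kappa> \<omega> \<partial>P)"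
    unfolding k_def by (intro nn_integral_cong nn_integral_distr pair) simp_all
  ultimately show ?thesis by simp
qed


section \<open>The two-sided evolution\<close>

lemma measurable_time_at [measurable]: "(\<lambda>z. time_at z n) \<in> borel_measurable (path_space :: 'n::finite path measure)"
  unfolding time_at_def path_space_def by measurable

lemma measurable_state_at [measurable]: "(\<lambda>z. state_at z n) \<in> (path_space :: 'n::finite path measure) \<rightarrow>\<^sub>M state_space"
  unfolding state_at_def path_space_def by measurable

lemma measurable_mark_at [measurable]: "(\<lambda>z. mark_at z n) \<in> (path_space :: 'n::finite path measure) \<rightarrow>\<^sub>M mark_space"
  unfolding mark_at_def path_space_def by measurable

lemma measurable_gap_at [measurable]: "(\<lambda>z. gap_at z n) \<in> borel_measurable (path_space :: 'n::finite path measure)"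
  unfolding gap_at_def by measurable

lemma measurable_past_at [measurable]: "(\<lambda>z. past_at z n) \<in> (path_space :: 'n::finite path measure) \<rightarrow>\<^sub>M past_space n"
  unfolding past_at_def past_space_def by (intro measurable_restrict) measurable

locale block_evolution = block_model k rate \<Delta> \<nu> D
  for k :: nat and rate \<Delta> :: real and \<nu> :: "'n::finite pmf" and D :: "'n \<Rightarrow> ('n \<Rightarrow> real) measure" +
  fixes \<pi> :: "'n state measure" and P0 :: "'a measure" and Z0 :: "'a \<Rightarrow> 'n path"
  assumes invariant: "invariant_distribution k \<Delta> rate \<nu> D \<pi>"
    and evolution: "stationary_evolution k \<Delta> rate \<nu> D \<pi> P0 Z0"
begin

abbreviation Y :: "int \<Rightarrow> 'a \<Rightarrow> 'n state" where "Y n \<omega> \<equiv> state_at (Z0 \<omega>) n"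
abbreviation G :: "int \<Rightarrow> 'a \<Rightarrow> real" where "G n \<omega> \<equiv> gap_at (Z0 \<omega>) n"
abbreviation M :: "int \<Rightarrow> 'a \<Rightarrow> 'n mark" where "M n \<omega> \<equiv> mark_at (Z0 \<omega>) n"

lemma prob_space_P0: "prob_space P0"
  and measurable_Z0 [measurable]: "Z0 \<in> P0 \<rightarrow>\<^sub>M path_space"
  and distr_state: "distr P0 state_space (\<lambda>\<omega>. Y n \<omega>) = \<pi>"
  and AE_update: "AE \<omega> in P0. Y (n + 1) \<omega> = update \<Delta> (Y n \<omega>) (G (n + 1) \<omega>) (M (n + 1) \<omega>)"
  and innovation_law: "A \<in> sets (past_space n) \<Longrightarrow> B \<in> sets innov \<Longrightarrow>
    emeasure P0 {\<omega> \<in> space P0. past_at (Z0 \<omega>) n \<in> A \<and> (G (n + 1) \<omega>, M (n + 1) \<omega>) \<in> B} =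
    (\<integral>\<^sup>+ \<omega>. indicator A (past_at (Z0 \<omega>) n) * emeasure (K (Y n \<omega>)) B \<partial>P0)"
proof -
  note * = evolution[unfolded stationary_evolution_def]
  show "prob_space P0" by (rule *[THEN conjunct1])
  show "Z0 \<in> P0 \<rightarrow>\<^sub>M path_space" by (rule *[THEN conjunct2, THEN conjunct1])
  show "distr P0 state_space (\<lambda>\<omega>. Y n \<omega>) = \<pi>"
    by (rule *[THEN conjunct2, THEN conjunct2, THEN conjunct2, THEN conjunct1, THEN spec])
  show "AE \<omega> in P0. Y (n + 1) \<omega> = update \<Delta> (Y n \<omega>) (G (n + 1) \<omega>) (M (n + 1) \<omega>)"
    by (rule *[THEN conjunct2, THEN conjunct2, THEN conjunct2, THEN conjunct2, THEN conjunct1, THEN spec])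
  show "emeasure P0 {\<omega> \<in> space P0. past_at (Z0 \<omega>) n \<in> A \<and> (G (n + 1) \<omega>, M (n + 1) \<omega>) \<in> B} =
      (\<integral>\<^sup>+ \<omega>. indicator A (past_at (Z0 \<omega>) n) * emeasure (K (Y n \<omega>)) B \<partial>P0)"
    if "A \<in> sets (past_space n)" "B \<in> sets innov"
    by (rule *[THEN conjunct2, THEN conjunct2, THEN conjunct2, THEN conjunct2, THEN conjunct2, THEN spec,
          THEN bspec, THEN bspec, OF that])
qed

sublocale prob_space P0 by (rule prob_space_P0)

lemma nn_integral_state:
  assumes [measurable]: "h \<in> borel_measurable state_space"
  shows "(\<integral>\<^sup>+ \<omega>. h (Y n \<omega>) \<partial>P0) = (\<integral>\<^sup>+ y. h y \<partial>\<pi>)"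
  unfolding distr_state[of n, symmetric] by (subst nn_integral_distr) simp_all

lemma AE_admissible: "AE \<omega> in P0. admissible k \<Delta> (Y n \<omega>)"
proof (rule AE_distrD[where f = "\<lambda>\<omega>. Y n \<omega>" and M' = state_space])
  show "(\<lambda>\<omega>. Y n \<omega>) \<in> P0 \<rightarrow>\<^sub>M state_space" by measurable
  show "AE y in distr P0 state_space (\<lambda>\<omega>. Y n \<omega>). admissible k \<Delta> y"
    using invariant unfolding distr_state invariant_distribution_def by blast
qed

text \<open>Only the sigma-algebra generated by the past matters; integrals are taken under
  \<open>P0\<close>. Keeping the sample space avoids rewriting functionals of the path as functions
  of \<open>past_at\<close>.\<close>

definition filt :: "int \<Rightarrow> 'a measure" where
  "filt n = vimage_algebra (space P0) (\<lambda>\<omega>. past_at (Z0 \<omega>) n) (past_space n)"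

lemma space_filt [simp]: "space (filt n) = space P0"
  by (simp add: filt_def)

lemma measurable_past: "(\<lambda>\<omega>. past_at (Z0 \<omega>) n) \<in> filt n \<rightarrow>\<^sub>M past_space n"
  unfolding filt_def
  by (rule measurable_vimage_algebra1) (auto intro!: measurable_space[of "\<lambda>\<omega>. past_at (Z0 \<omega>) n" P0])

lemma filt_ident: "(\<lambda>\<omega>. \<omega>) \<in> P0 \<rightarrow>\<^sub>M filt n"
  unfolding filt_def by (rule measurable_vimage_algebra2) auto

lemma measurable_filt_imp: "f \<in> filt n \<rightarrow>\<^sub>M N \<Longrightarrow> f \<in> P0 \<rightarrow>\<^sub>M N"
  using measurable_compose[OF filt_ident] by blast

lemma measurable_past_entry:
  assumes "m \<le> n"
  shows "(\<lambda>\<omega>. (G m \<omega>, Y m \<omega>, M m \<omega>)) \<in> filt n \<rightarrow>\<^sub>M borel \<Otimes>\<^sub>M state_space \<Otimes>\<^sub>M mark_space"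
proof -
  have "(\<lambda>p. p m) \<in> past_space n \<rightarrow>\<^sub>M borel \<Otimes>\<^sub>M (state_space :: 'n state measure) \<Otimes>\<^sub>M mark_space"
    unfolding past_space_def using assms by (intro measurable_component_singleton) simp
  from measurable_compose[OF measurable_past this] show ?thesis
    using assms by (simp add: past_at_def)
qed

lemma measurable_filt:
  assumes "m \<le> n"
  shows "(\<lambda>\<omega>. Y m \<omega>) \<in> filt n \<rightarrow>\<^sub>M state_space" "(\<lambda>\<omega>. G m \<omega>) \<in> borel_measurable (filt n)"
    "(\<lambda>\<omega>. M m \<omega>) \<in> filt n \<rightarrow>\<^sub>M mark_space"
proof -
  have 1: "(\<lambda>x. fst (snd x)) \<in> borel \<Otimes>\<^sub>M (state_space :: 'n state measure) \<Otimes>\<^sub>M (mark_space :: 'n mark measure) \<rightarrow>\<^sub>M state_space"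
    and 2: "(\<lambda>x. fst x) \<in> borel \<Otimes>\<^sub>M (state_space :: 'n state measure) \<Otimes>\<^sub>M (mark_space :: 'n mark measure) \<rightarrow>\<^sub>M borel"
    and 3: "(\<lambda>x. snd (snd x)) \<in> borel \<Otimes>\<^sub>M (state_space :: 'n state measure) \<Otimes>\<^sub>M (mark_space :: 'n mark measure) \<rightarrow>\<^sub>M mark_space"
    by measurable
  show "(\<lambda>\<omega>. Y m \<omega>) \<in> filt n \<rightarrow>\<^sub>M state_space"
    using measurable_compose[OF measurable_past_entry[OF assms] 1] by (simp only: fst_conv snd_conv)
  show "(\<lambda>\<omega>. G m \<omega>) \<in> borel_measurable (filt n)"
    using measurable_compose[OF measurable_past_entry[OF assms] 2] by (simp only: fst_conv snd_conv)
  show "(\<lambda>\<omega>. M m \<omega>) \<in> filt n \<rightarrow>\<^sub>M mark_space"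
    using measurable_compose[OF measurable_past_entry[OF assms] 3] by (simp only: fst_conv snd_conv)
qed

lemma measurable_state_kernel [measurable]: "(\<lambda>\<omega>. K (Y n \<omega>)) \<in> P0 \<rightarrow>\<^sub>M subprob_algebra innov"
proof -
  have "(\<lambda>\<omega>. Y n \<omega>) \<in> P0 \<rightarrow>\<^sub>M state_space" by measurable
  from measurable_compose[OF this measurable_innovation] show ?thesis .
qed

text \<open>The Markov property for joint functionals of the past and the next innovation.
  Measurability with respect to \<open>filt n\<close> is what forbids F to look ahead.\<close>

lemma nn_integral_next:
  assumes F: "(\<lambda>(\<omega>, z). F \<omega> z) \<in> borel_measurable (filt n \<Otimes>\<^sub>M innov)"
  shows "(\<integral>\<^sup>+ \<omega>. F \<omega> (G (n + 1) \<omega>, M (n + 1) \<omega>) \<partial>P0) = (\<integral>\<^sup>+ \<omega>. \<integral>\<^sup>+ z. F \<omega> z \<partial>K (Y n \<omega>) \<partial>P0)"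
proof -
  have "emeasure P0 {\<omega> \<in> space P0. \<omega> \<in> A \<and> (G (n + 1) \<omega>, M (n + 1) \<omega>) \<in> B} =
      (\<integral>\<^sup>+ \<omega>. indicator A \<omega> * emeasure (K (Y n \<omega>)) B \<partial>P0)"
    if A: "A \<in> sets (filt n)" and B: "B \<in> sets innov" for A B
  proof -
    have "(\<lambda>\<omega>. past_at (Z0 \<omega>) n) \<in> space P0 \<rightarrow> space (past_space n)"
      by (auto intro!: measurable_space[of "\<lambda>\<omega>. past_at (Z0 \<omega>) n" P0])
    with A obtain A' where A': "A' \<in> sets (past_space n)" "A = (\<lambda>\<omega>. past_at (Z0 \<omega>) n) -` A' \<inter> space P0"
      by (auto simp: filt_def sets_vimage_algebra2)
    have "{\<omega> \<in> space P0. \<omega> \<in> A \<and> (G (n + 1) \<omega>, M (n + 1) \<omega>) \<in> B} =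
        {\<omega> \<in> space P0. past_at (Z0 \<omega>) n \<in> A' \<and> (G (n + 1) \<omega>, M (n + 1) \<omega>) \<in> B}"
      by (auto simp: A')
    moreover have "(\<integral>\<^sup>+ \<omega>. indicator A \<omega> * emeasure (K (Y n \<omega>)) B \<partial>P0) =
        (\<integral>\<^sup>+ \<omega>. indicator A' (past_at (Z0 \<omega>) n) * emeasure (K (Y n \<omega>)) B \<partial>P0)"
      by (intro nn_integral_cong) (simp add: A' indicator_def)
    ultimately show ?thesis using innovation_law[OF A'(1) B] by simp
  qed
  note eq = this
  have I: "(\<lambda>\<omega>. (G (n + 1) \<omega>, M (n + 1) \<omega>)) \<in> P0 \<rightarrow>\<^sub>M innov" by measurable
  from nn_integral_semidirect[OF prob_space_P0 filt_ident I measurable_state_kernel eq F]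
  show ?thesis by (simp only: prod.case)
qed

text \<open>The indicator of failure has integral zero under the conditional laws, hence also along
  the path.\<close>

lemma AE_next:
  assumes P: "Measurable.pred (filt n \<Otimes>\<^sub>M innov) (\<lambda>(\<omega>, z). P \<omega> z)"
    and AE: "AE \<omega> in P0. AE z in K (Y n \<omega>). P \<omega> z"
  shows "AE \<omega> in P0. P \<omega> (G (n + 1) \<omega>, M (n + 1) \<omega>)"
proof -
  have I [measurable]: "(\<lambda>\<omega>. (\<omega>, (G (n + 1) \<omega>, M (n + 1) \<omega>))) \<in> P0 \<rightarrow>\<^sub>M filt n \<Otimes>\<^sub>M innov"
    using filt_ident by measurable
  have [measurable]: "Measurable.pred P0 (\<lambda>\<omega>. P \<omega> (G (n + 1) \<omega>, M (n + 1) \<omega>))"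
    using measurable_compose[OF I P] by (simp add: pred_def)
  have sec: "Measurable.pred innov (\<lambda>z. P \<omega> z)" if "\<omega> \<in> space P0" for \<omega>
    using measurable_compose[OF measurable_Pair1'[of \<omega> "filt n" innov] P] that by simp
  have "(\<integral>\<^sup>+ \<omega>. of_bool (\<not> P \<omega> (G (n + 1) \<omega>, M (n + 1) \<omega>)) \<partial>P0) = (\<integral>\<^sup>+ \<omega>. \<integral>\<^sup>+ z. of_bool (\<not> P \<omega> z) \<partial>K (Y n \<omega>) \<partial>P0)"
    by (rule nn_integral_next) (use P in \<open>simp add: case_prod_unfold\<close>)
  also have "\<dots> = (\<integral>\<^sup>+ \<omega>. 0 \<partial>P0)"
  proof (rule nn_integral_cong_AE)
    show "AE \<omega> in P0. (\<integral>\<^sup>+ z. of_bool (\<not> P \<omega> z) \<partial>K (Y n \<omega>)) = 0"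
      using AE
    proof (rule AE_mp, intro AE_I2 impI)
      fix \<omega> assume "\<omega> \<in> space P0" and z: "AE z in K (Y n \<omega>). P \<omega> z"
      have "(\<integral>\<^sup>+ z. of_bool (\<not> P \<omega> z) \<partial>K (Y n \<omega>)) = (\<integral>\<^sup>+ z. 0 \<partial>K (Y n \<omega>))"
        using z by (intro nn_integral_cong_AE) (auto elim!: eventually_mono)
      then show "(\<integral>\<^sup>+ z. of_bool (\<not> P \<omega> z) \<partial>K (Y n \<omega>)) = (0 :: ennreal)" by simp
    qed
  qed
  finally have "(\<integral>\<^sup>+ \<omega>. of_bool (\<not> P \<omega> (G (n + 1) \<omega>, M (n + 1) \<omega>)) \<partial>P0) = (0 :: ennreal)" by simp
  then have "AE \<omega> in P0. of_bool (\<not> P \<omega> (G (n + 1) \<omega>, M (n + 1) \<omega>)) = (0 :: ennreal)"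
    by (subst (asm) nn_integral_0_iff_AE) measurable
  then show ?thesis by (auto elim!: eventually_mono)
qed

lemma AE_good_step: "AE \<omega> in P0. good (Y n \<omega>) (G (n + 1) \<omega>, M (n + 1) \<omega>)"
proof (rule AE_next)
  note measurable_filt[of n n, measurable]
  show "Measurable.pred (filt n \<Otimes>\<^sub>M innov) (\<lambda>(\<omega>, z). good (Y n \<omega>) z)"
    by (simp add: case_prod_unfold) measurable
qed (simp add: AE_good)

text \<open>Stationarity cancels the mean of the Lyapunov function before and after a step, but only
  if that mean is finite. It is therefore truncated at m, where the drift bounds the tips on the
  sublevel set \<open>S m\<close> uniformly in m, and monotone convergence removes the
  restriction.\<close>

lemma tip_expectation_finite: "(\<integral>\<^sup>+ y. of_nat (obs_tips y) \<partial>\<pi>) < \<infinity>"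
proof -
  let ?L = "\<lambda>n \<omega>. ennreal (lyapunov (Y n \<omega>))"
  let ?X = "\<lambda>\<omega>. ennreal (obs_tips (Y 0 \<omega>))"
  define S where "S m = {y :: 'n state. lyapunov y \<le> real m}" for m :: nat
  have S [measurable]: "S m \<in> sets state_space" for m
    using measurable_lyapunov by (simp add: S_def borel_measurable_iff_le)
  have step: "2 * (\<integral>\<^sup>+ \<omega>. ?X \<omega> * indicator (S m) (Y 0 \<omega>) \<partial>P0) \<le> ennreal drift_const" for m :: nat
  proof -
    let ?A = "\<integral>\<^sup>+ \<omega>. min (?L 0 \<omega>) (of_nat m) \<partial>P0"
    have fin: "?A \<noteq> \<infinity>"
    proof -
      have "?A \<le> (\<integral>\<^sup>+ \<omega>. of_nat m \<partial>P0)" by (intro nn_integral_mono) simp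
      also have "\<dots> < \<infinity>" by (simp add: emeasure_space_1 ennreal_of_nat_eq_real_of_nat)
      finally show ?thesis by simp
    qed
    have "?A = (\<integral>\<^sup>+ y. min (ennreal (lyapunov y)) (of_nat m) \<partial>\<pi>)"
      by (rule nn_integral_state[where h = "\<lambda>y. min (ennreal (lyapunov y)) (of_nat m)"]) measurable
    also have "\<dots> = (\<integral>\<^sup>+ \<omega>. min (?L (0 + 1) \<omega>) (of_nat m) \<partial>P0)"
      by (rule nn_integral_state[where h = "\<lambda>y. min (ennreal (lyapunov y)) (of_nat m)", symmetric]) measurable
    also have "\<dots> = (\<integral>\<^sup>+ \<omega>. min (ennreal (lyapunov (update \<Delta> (Y 0 \<omega>) (G (0 + 1) \<omega>) (M (0 + 1) \<omega>)))) (of_nat m) \<partial>P0)"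
      using AE_update[of 0] by (intro nn_integral_cong_AE) (auto elim!: eventually_mono)
    also have "\<dots> = (\<integral>\<^sup>+ \<omega>. \<integral>\<^sup>+ z. min (ennreal (lyapunov (update \<Delta> (Y 0 \<omega>) (fst z) (snd z)))) (of_nat m) \<partial>K (Y 0 \<omega>) \<partial>P0)"
    proof -
      note measurable_filt[of 0 0, measurable]
      have "(\<lambda>(\<omega>, z). min (ennreal (lyapunov (update \<Delta> (Y 0 \<omega>) (fst z) (snd z)))) (of_nat m))
          \<in> borel_measurable (filt 0 \<Otimes>\<^sub>M innov)"
        by (simp add: case_prod_unfold)
      from nn_integral_next[OF this] show ?thesis by simp
    qed
    finally have A: "?A = \<dots>" .
    have [measurable]: "(\<lambda>\<omega>. \<integral>\<^sup>+ z. min (ennreal (lyapunov (update \<Delta> (Y 0 \<omega>) (fst z) (snd z)))) (of_nat m) \<partial>K (Y 0 \<omega>))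
        \<in> borel_measurable P0"
      by (rule nn_integral_measurable_subprob_algebra2[where N = innov]) (simp_all add: case_prod_unfold)
    have "?A + 2 * (\<integral>\<^sup>+ \<omega>. ?X \<omega> * indicator (S m) (Y 0 \<omega>) \<partial>P0) =
        (\<integral>\<^sup>+ \<omega>. (\<integral>\<^sup>+ z. min (ennreal (lyapunov (update \<Delta> (Y 0 \<omega>) (fst z) (snd z)))) (of_nat m) \<partial>K (Y 0 \<omega>)) +
          2 * (?X \<omega> * indicator (S m) (Y 0 \<omega>)) \<partial>P0)"
      unfolding A by (subst nn_integral_add) (simp_all add: nn_integral_cmult)
    also have "\<dots> \<le> (\<integral>\<^sup>+ \<omega>. min (?L 0 \<omega>) (of_nat m) + ennreal drift_const \<partial>P0)"
    proof (rule nn_integral_mono_AE, rule AE_mp[OF AE_admissible[of 0] AE_I2], rule impI)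
      fix \<omega> assume adm: "admissible k \<Delta> (Y 0 \<omega>)"
      interpret Ky: prob_space "K (Y 0 \<omega>)" by (rule prob_space_innovation)
      let ?I = "\<integral>\<^sup>+ z. min (ennreal (lyapunov (update \<Delta> (Y 0 \<omega>) (fst z) (snd z)))) (of_nat m) \<partial>K (Y 0 \<omega>)"
      show "?I + 2 * (?X \<omega> * indicator (S m) (Y 0 \<omega>)) \<le> min (?L 0 \<omega>) (of_nat m) + ennreal drift_const"
      \<comment> \<open>On \<open>S m\<close> the truncation at the current state is inactive and
        the drift inequality applies. Off \<open>S m\<close> the current truncated value is already
        the maximum m, so it cannot grow, and the tips are not counted.\<close>
      proof (cases "Y 0 \<omega> \<in> S m")
        case True
        then have "ennreal (lyapunov (Y 0 \<omega>)) \<le> of_nat m"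
          by (simp add: S_def ennreal_of_nat_eq_real_of_nat)
        moreover have "?I \<le> (\<integral>\<^sup>+ z. ennreal (lyapunov (update \<Delta> (Y 0 \<omega>) (fst z) (snd z))) \<partial>K (Y 0 \<omega>))"
          by (intro nn_integral_mono) simp
        moreover have "2 * ?X \<omega> = ennreal (2 * obs_tips (Y 0 \<omega>))"
          by (simp add: ennreal_mult)
        ultimately show ?thesis
          using order_trans[OF add_right_mono lyapunov_drift[OF adm]] True
          by (simp add: min_absorb1)
      next
        case False
        then have "of_nat m \<le> ennreal (lyapunov (Y 0 \<omega>))"
          by (simp add: S_def ennreal_of_nat_eq_real_of_nat ennreal_leI)
        moreover have "?I \<le> (\<integral>\<^sup>+ z. of_nat m \<partial>K (Y 0 \<omega>))"
          by (intro nn_integral_mono) simp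
        moreover have "(\<integral>\<^sup>+ z. of_nat m \<partial>K (Y 0 \<omega>)) = of_nat m"
          using Ky.emeasure_space_1 by simp
        ultimately have "?I \<le> min (?L 0 \<omega>) (of_nat m)" by (simp only: min_absorb2)
        then show ?thesis
          using False by (simp add: add_increasing2 del: min.bounded_iff)
      qed
    qed
    also have "\<dots> = ?A + ennreal drift_const"
      by (subst nn_integral_add) (simp_all add: emeasure_space_1)
    finally show ?thesis using fin by (simp add: ennreal_add_left_cancel_le)
  qed
  have "(\<integral>\<^sup>+ y. of_nat (obs_tips y) \<partial>\<pi>) = (\<integral>\<^sup>+ \<omega>. ?X \<omega> \<partial>P0)"
    by (subst nn_integral_state[of "\<lambda>y. of_nat (obs_tips y)", symmetric, of 0]) (simp_all add: ennreal_of_nat_eq_real_of_nat)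
  also have "\<dots> = (\<integral>\<^sup>+ \<omega>. (SUP m. ?X \<omega> * indicator (S m) (Y 0 \<omega>)) \<partial>P0)"
  proof (intro nn_integral_cong antisym)
    fix \<omega>
    obtain m :: nat where "lyapunov (Y 0 \<omega>) \<le> m" using real_arch_simple by blast
    then show "?X \<omega> \<le> (SUP m. ?X \<omega> * indicator (S m) (Y 0 \<omega>))"
      by (intro SUP_upper2[of m]) (simp_all add: S_def)
    show "(SUP m. ?X \<omega> * indicator (S m) (Y 0 \<omega>)) \<le> ?X \<omega>"
      by (intro SUP_least) (simp add: indicator_def)
  qed
  also have "\<dots> = (SUP m. \<integral>\<^sup>+ \<omega>. ?X \<omega> * indicator (S m) (Y 0 \<omega>) \<partial>P0)"
  proof (rule nn_integral_monotone_convergence_SUP)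
    show "incseq (\<lambda>m \<omega>. ?X \<omega> * indicator (S m) (Y 0 \<omega>))"
      by (auto simp: incseq_def le_fun_def S_def indicator_def)
  qed measurable
  also have "\<dots> \<le> ennreal drift_const"
  proof (rule SUP_least)
    fix m
    let ?B = "\<integral>\<^sup>+ \<omega>. ?X \<omega> * indicator (S m) (Y 0 \<omega>) \<partial>P0"
    have "?B \<le> 2 * ?B" by (simp add: mult_2)
    with step[of m] show "?B \<le> ennreal drift_const" by (rule order_trans[rotated])
  qed
  finally show ?thesis by (simp add: le_less_trans)
qed

end


section \<open>Survival of blocks along a path\<close>

text \<open>For n below l the condition is vacuous, which is why counts of surviving blocks carry
  \<open>l \<le> n\<close>.\<close>

definition alive :: "'n path \<Rightarrow> int \<Rightarrow> int \<Rightarrow> bool" where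
  "alive z l n \<longleftrightarrow> (\<forall>j\<in>{l<..n}. blockID (mark_at z l) \<notin> set (refs (mark_at z j)))"

definition eternal :: "'n path \<Rightarrow> int \<Rightarrow> block set" where
  "eternal z n = {x. \<forall>m\<le>n. x \<in> set (fst (state_at z m))}"

lemma alive_self [simp]: "alive z n n"
  by (simp add: alive_def)

lemma alive_step: "l \<le> n \<Longrightarrow> alive z l (n + 1) \<longleftrightarrow> alive z l n \<and> blockID (mark_at z l) \<notin> set (refs (mark_at z (n + 1)))"
proof -
  assume "l \<le> n"
  then have "{l<..n + 1} = insert (n + 1) {l<..n}" by auto
  then show ?thesis by (auto simp: alive_def)
qed

lemma alive_antimono: "alive z l n \<Longrightarrow> m \<le> n \<Longrightarrow> alive z l m"
  by (auto simp: alive_def)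

lemma measurable_alive [measurable]: "Measurable.pred (path_space :: 'n::finite path measure) (\<lambda>z. alive z l n)"
  unfolding alive_def by measurable

lemma eternal_antimono: "m \<le> n \<Longrightarrow> eternal z n \<subseteq> eternal z m"
  by (auto simp: eternal_def)

lemma eternal_subset: "eternal z n \<subseteq> set (fst (state_at z n))"
  by (auto simp: eternal_def)

lemma finite_eternal [simp]: "finite (eternal z n)"
  by (rule finite_subset[OF eternal_subset]) simp

context block_model
begin

text \<open>A deterministic condition that holds almost surely, so that the bookkeeping of tips can
  be done for one path at a time.\<close>

definition regular_path :: "'n path \<Rightarrow> bool" where
  "regular_path z \<longleftrightarrow> (\<forall>n. state_at z (n + 1) = update \<Delta> (state_at z n) (gap_at z (n + 1)) (mark_at z (n + 1)) \<and>
     good (state_at z n) (gap_at z (n + 1), mark_at z (n + 1)))"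

context
  fixes z :: "'n path"
  assumes z: "regular_path z"
begin

lemma regular_obs_step:
  "set (fst (state_at z (n + 1))) = (set (fst (state_at z n)) \<union> {blockID (mark_at z (n + 1))}) - set (refs (mark_at z (n + 1)))"
  using z by (simp add: regular_path_def update_obs)

lemma regular_id_new: "blockID (mark_at z n) \<notin> set (fst (state_at z (n - 1)))"
  and regular_id_not_self: "blockID (mark_at z n) \<notin> set (refs (mark_at z n))"
  and regular_gap_pos: "0 < gap_at z n"
proof -
  have "good (state_at z (n - 1)) (gap_at z (n - 1 + 1), mark_at z (n - 1 + 1))"
    using z unfolding regular_path_def by blast
  then show "blockID (mark_at z n) \<notin> set (fst (state_at z (n - 1)))"
    "blockID (mark_at z n) \<notin> set (refs (mark_at z n))" "0 < gap_at z n"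
    by (simp_all add: good_def)
qed

lemma regular_alive_tip:
  assumes "l \<le> n" "alive z l n"
  shows "blockID (mark_at z l) \<in> set (fst (state_at z n))"
  using assms
proof (induction n rule: int_ge_induct)
  case base
  show ?case using regular_obs_step[of "l - 1"] regular_id_not_self[of l] by simp
next
  case (step n)
  then show ?case using alive_step[of l n z] regular_obs_step[of n] by auto
qed

text \<open>Identifiers are known to be fresh only relative to current tips. That is enough: an
  earlier surviving block is still a tip just before the later one is issued.\<close>

lemma regular_inj_alive: "inj_on (\<lambda>l. blockID (mark_at z l)) {l. l \<le> n \<and> alive z l n}"
proof -
  have "blockID (mark_at z l) \<noteq> blockID (mark_at z l')" if "l < l'" "l' \<le> n" "alive z l n" for l l'
    using regular_alive_tip[of l "l' - 1"] alive_antimono[OF that(3), of "l' - 1"] regular_id_new[of l'] that by force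
  then show ?thesis by (auto simp: inj_on_def) (metis linorder_neqE)
qed

text \<open>Induction on how far back the absence lies. An identifier can enter the tip set only as
  that of the block just issued, and from then on staying a tip means not being referenced.\<close>

lemma regular_tip_origin:
  assumes "x \<in> set (fst (state_at z n))" "x \<notin> set (fst (state_at z (n - int i)))"
  shows "\<exists>l\<le>n. alive z l n \<and> blockID (mark_at z l) = x"
  using assms
proof (induction i arbitrary: n)
  case (Suc i)
  note step = regular_obs_step[of "n - 1", simplified]
  show ?case
  proof (cases "x \<in> set (fst (state_at z (n - 1)))")
    case True
    have "x \<notin> set (fst (state_at z (n - 1 - int i)))" using Suc.prems(2) by (simp add: algebra_simps)
    from Suc.IH[OF True this] obtain l where l: "l \<le> n - 1" "alive z l (n - 1)" "blockID (mark_at z l) = x" by blast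
    then have "alive z l n" using alive_step[of l "n - 1" z] step Suc.prems(1) by simp
    with l show ?thesis by (intro exI[of _ l]) simp
  next
    case False
    then have "x = blockID (mark_at z n)" using step Suc.prems(1) by simp
    then show ?thesis by (intro exI[of _ n]) simp
  qed
qed simp

lemma regular_tips_eq:
  "set (fst (state_at z n)) = (\<lambda>l. blockID (mark_at z l)) ` {l. l \<le> n \<and> alive z l n} \<union> eternal z n"
proof (intro equalityI subsetI)
  fix x assume x: "x \<in> set (fst (state_at z n))"
  show "x \<in> (\<lambda>l. blockID (mark_at z l)) ` {l. l \<le> n \<and> alive z l n} \<union> eternal z n"
  proof (cases "x \<in> eternal z n")
    case False
    then obtain m where m: "m \<le> n" "x \<notin> set (fst (state_at z m))" by (auto simp: eternal_def)
    then have "x \<notin> set (fst (state_at z (n - int (nat (n - m)))))" by simp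
    from regular_tip_origin[OF x this] show ?thesis by blast
  qed simp
qed (use regular_alive_tip in \<open>auto simp: eternal_def\<close>)

text \<open>The identifier was not a tip just before its issuance. Hence issued and eternal tips are
  disjoint and their numbers add up.\<close>

lemma regular_alive_not_eternal: "l \<le> n \<Longrightarrow> blockID (mark_at z l) \<notin> eternal z n"
  using regular_id_new[of l] by (auto simp: eternal_def intro!: exI[of _ "l - 1"])

lemma finite_alive: "finite {l. l \<le> n \<and> alive z l n}"
proof (rule finite_imageD[OF _ regular_inj_alive])
  show "finite ((\<lambda>l. blockID (mark_at z l)) ` {l. l \<le> n \<and> alive z l n})"
    by (rule finite_subset[of _ "set (fst (state_at z n))"]) (unfold regular_tips_eq, blast, simp flip: regular_tips_eq)
qed

lemma suminf_alive: "(\<Sum>i. of_bool (alive z (n - int i) n) :: ennreal) = of_nat (card {l. l \<le> n \<and> alive z l n})"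
proof -
  have bij: "bij_betw (\<lambda>i. n - int i) {i. alive z (n - int i) n} {l. l \<le> n \<and> alive z l n}"
    by (rule bij_betwI[where g = "\<lambda>l. nat (n - l)"]) auto
  then have fin: "finite {i. alive z (n - int i) n}"
    using finite_alive bij_betw_finite by blast
  have "(\<Sum>i. of_bool (alive z (n - int i) n) :: ennreal) = (\<Sum>i\<in>{i. alive z (n - int i) n}. of_bool (alive z (n - int i) n))"
    by (rule suminf_finite[OF fin]) simp
  also have "\<dots> = of_nat (card {i. alive z (n - int i) n})" by simp
  also have "card {i. alive z (n - int i) n} = card {l. l \<le> n \<and> alive z l n}"
    by (rule bij_betw_same_card[OF bij])
  finally show ?thesis .
qed

lemma regular_obs_tips:
  "(of_nat (obs_tips (state_at z n)) :: ennreal) =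
     (\<Sum>i. of_bool (alive z (n - int i) n)) + of_nat (card (eternal z n))"
proof -
  have "state_at z n = update \<Delta> (state_at z (n - 1)) (gap_at z n) (mark_at z n)"
    using z[unfolded regular_path_def, THEN spec, of "n - 1"] by simp
  then have "distinct (fst (state_at z n))" by (simp add: update_obs)
  then have "obs_tips (state_at z n) = card (set (fst (state_at z n)))"
    by (simp add: obs_tips_def distinct_card)
  also have "\<dots> = card ((\<lambda>l. blockID (mark_at z l)) ` {l. l \<le> n \<and> alive z l n}) + card (eternal z n)"
    unfolding regular_tips_eq
    by (rule card_Un_disjoint) (use finite_alive regular_alive_not_eternal in auto)
  also have "card ((\<lambda>l. blockID (mark_at z l)) ` {l. l \<le> n \<and> alive z l n}) = card {l. l \<le> n \<and> alive z l n}"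
    by (rule card_image[OF regular_inj_alive])
  finally show ?thesis by (simp add: suminf_alive)
qed

lemma regular_time_strict_mono: "strict_mono (time_at z)"
proof (rule strict_monoI)
  fix m n :: int assume "m < n"
  then show "time_at z m < time_at z n"
  proof (induction n rule: int_gr_induct)
    case base
    then show ?case using regular_gap_pos[of "m + 1"] by (simp add: gap_at_def)
  next
    case (step n)
    then show ?case using regular_gap_pos[of "n + 1"] by (simp add: gap_at_def)
  qed
qed

lemma sum_gaps: "(\<Sum>i<m. gap_at z (n + int i + 1)) = time_at z (n + int m) - time_at z n"
  by (induction m) (simp_all add: gap_at_def algebra_simps)

text \<open>The terms vanish from the first referencing index on, and the gaps before it telescope.
  The hypothesis keeps the lifetime finite: an unreferenced block would need divergent times, which
  \<open>regular_path\<close> does not provide.\<close>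

lemma regular_lifetime:
  assumes dead: "\<not> alive z n (n + int M)"
  shows "lifetime z n = (\<Sum>m. of_bool (alive z n (n + int m)) * ennreal (gap_at z (n + int m + 1)))"
proof -
  define m0 where "m0 = (LEAST m. \<not> alive z n (n + int m))"
  have m0: "\<not> alive z n (n + int m0)" unfolding m0_def using dead by (rule LeastI)
  have iff: "alive z n (n + int m) \<longleftrightarrow> m < m0" for m
    using m0 not_less_Least[of m "\<lambda>m. \<not> alive z n (n + int m)"] alive_antimono[of z n "n + int m" "n + int m0"]
    by (fastforce simp: m0_def)
  have "0 < m0" using iff[of 0] by simp
  then obtain p where p: "m0 = Suc p" by (cases m0) auto
  have ref: "blockID (mark_at z n) \<in> set (refs (mark_at z (n + int m0)))"
    using alive_step[of n "n + int p" z] iff[of p] m0 by (simp add: p algebra_simps)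
  have T: "time_at z a \<le> time_at z b \<longleftrightarrow> a \<le> b" for a b
    using regular_time_strict_mono by (simp add: strict_mono_less_eq)
  have "(\<Sum>m. of_bool (alive z n (n + int m)) * ennreal (gap_at z (n + int m + 1))) =
      (\<Sum>m<m0. of_bool (alive z n (n + int m)) * ennreal (gap_at z (n + int m + 1)))"
    by (rule suminf_finite) (auto simp: iff)
  also have "\<dots> = ennreal (\<Sum>m<m0. gap_at z (n + int m + 1))"
    using regular_gap_pos by (subst sum_ennreal[symmetric]) (auto simp: iff less_imp_le)
  also have "\<dots> = ennreal (time_at z (n + int m0) - time_at z n)" by (simp add: sum_gaps)
  also have "\<dots> = lifetime z n"
  proof (rule antisym)
    show "ennreal (time_at z (n + int m0) - time_at z n) \<le> lifetime z n"
      unfolding lifetime_def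
    proof (rule INF_greatest)
      fix m assume "m \<in> {m. n < m \<and> blockID (mark_at z n) \<in> set (refs (mark_at z m))}"
      then have m: "n < m" "\<not> alive z n m" by (auto simp: alive_def)
      then have "n + int m0 \<le> m"
        using iff[of "nat (m - n)"] by simp
      then show "ennreal (time_at z (n + int m0) - time_at z n) \<le> ennreal (time_at z m - time_at z n)"
        by (intro ennreal_leI) (simp add: T)
    qed
    show "lifetime z n \<le> ennreal (time_at z (n + int m0) - time_at z n)"
      unfolding lifetime_def using ref \<open>0 < m0\<close> by (intro INF_lower) simp
  qed
  finally show ?thesis by simp
qed

end

end

section \<open>Stationarity of the survival probabilities\<close>

context block_model
begin

text \<open>The probability, starting from state y, that the identifier x is not referenced in the
  next m issuances, by the backward recursion of the chain. It mentions no index of the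
  path.\<close>

primrec survive :: "nat \<Rightarrow> 'n state \<Rightarrow> real \<Rightarrow> ennreal" where
  "survive 0 y x = 1"
| "survive (Suc m) y x = (\<integral>\<^sup>+ z. of_bool (x \<notin> set (refs (snd z))) * survive m (update \<Delta> y (fst z) (snd z)) x \<partial>K y)"

lemma measurable_survive: "(\<lambda>(y, x). survive m y x) \<in> borel_measurable (state_space \<Otimes>\<^sub>M borel)"
proof (induction m)
  case (Suc m)
  have [measurable]: "(\<lambda>w :: ('n state \<times> real) \<times> (real \<times> 'n mark).
      survive m (update \<Delta> (fst (fst w)) (fst (snd w)) (snd (snd w))) (snd (fst w)))
      \<in> borel_measurable ((state_space \<Otimes>\<^sub>M borel) \<Otimes>\<^sub>M innov)"
  proof -
    have "(\<lambda>w :: ('n state \<times> real) \<times> (real \<times> 'n mark). (update \<Delta> (fst (fst w)) (fst (snd w)) (snd (snd w)), snd (fst w)))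
      \<in> (state_space \<Otimes>\<^sub>M borel) \<Otimes>\<^sub>M innov \<rightarrow>\<^sub>M state_space \<Otimes>\<^sub>M borel"
      by measurable
    from measurable_compose[OF this Suc] show ?thesis by (simp only: prod.case)
  qed
  have "(\<lambda>w :: 'n state \<times> real. K (fst w)) \<in> state_space \<Otimes>\<^sub>M borel \<rightarrow>\<^sub>M subprob_algebra innov"
    by (rule measurable_compose[OF measurable_fst measurable_innovation])
  from nn_integral_measurable_subprob_algebra2[OF _ this, of "\<lambda>w z. of_bool (snd w \<notin> set (refs (snd z))) *
      survive m (update \<Delta> (fst w) (fst z) (snd z)) (snd w)"]
  show ?case by (simp add: case_prod_unfold)
qed simp

lemma measurable_survive_compose:
  assumes "y \<in> N \<rightarrow>\<^sub>M state_space" "x \<in> borel_measurable N"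
  shows "(\<lambda>\<omega>. survive m (y \<omega>) (x \<omega>)) \<in> borel_measurable N"
  using measurable_compose[OF measurable_Pair[OF assms] measurable_survive] by (simp only: prod.case)

end

context block_evolution
begin

lemma measurable_alive_filt:
  assumes "l \<le> n"
  shows "Measurable.pred (filt n) (\<lambda>\<omega>. alive (Z0 \<omega>) l n)"
  unfolding alive_def
proof (rule pred_intros_finite)
  fix j assume "j \<in> {l<..n}"
  then have "j \<le> n" by simp
  note measurable_filt(3)[OF this, measurable] measurable_filt(3)[OF assms, measurable]
  show "Measurable.pred (filt n) (\<lambda>\<omega>. blockID (M l \<omega>) \<notin> set (refs (M j \<omega>)))" by measurable
qed simp

text \<open>By the Markov property, one step of the recursion in \<open>survive\<close> can be
  traded for one issuance on the path.\<close>

lemma alive_survive_step: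
  assumes "l \<le> n"
  shows "(\<integral>\<^sup>+ \<omega>. of_bool (alive (Z0 \<omega>) l n) * survive (Suc m) (Y n \<omega>) (blockID (M l \<omega>)) \<partial>P0) =
    (\<integral>\<^sup>+ \<omega>. of_bool (alive (Z0 \<omega>) l (n + 1)) * survive m (Y (n + 1) \<omega>) (blockID (M l \<omega>)) \<partial>P0)"
proof -
  let ?F = "\<lambda>\<omega> z. of_bool (alive (Z0 \<omega>) l n) * (of_bool (blockID (M l \<omega>) \<notin> set (refs (snd z))) *
      survive m (update \<Delta> (Y n \<omega>) (fst z) (snd z)) (blockID (M l \<omega>)))"
  note measurable_filt(3)[OF assms, measurable] measurable_filt(1)[OF order_refl, measurable]
    measurable_alive_filt[OF assms, measurable]
  have inner: "(\<lambda>(\<omega>, z). of_bool (blockID (M l \<omega>) \<notin> set (refs (snd z))) *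
      survive m (update \<Delta> (Y n \<omega>) (fst z) (snd z)) (blockID (M l \<omega>))) \<in> borel_measurable (filt n \<Otimes>\<^sub>M innov)"
  proof -
    have [measurable]: "(\<lambda>w. survive m (update \<Delta> (Y n (fst w)) (fst (snd w)) (snd (snd w))) (blockID (M l (fst w))))
        \<in> borel_measurable (filt n \<Otimes>\<^sub>M innov)"
      by (rule measurable_survive_compose) measurable
    show ?thesis unfolding case_prod_unfold by measurable
  qed
  have F: "(\<lambda>(\<omega>, z). ?F \<omega> z) \<in> borel_measurable (filt n \<Otimes>\<^sub>M innov)"
    using inner unfolding case_prod_unfold by measurable
  have "(\<integral>\<^sup>+ \<omega>. of_bool (alive (Z0 \<omega>) l (n + 1)) * survive m (Y (n + 1) \<omega>) (blockID (M l \<omega>)) \<partial>P0) =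
      (\<integral>\<^sup>+ \<omega>. ?F \<omega> (G (n + 1) \<omega>, M (n + 1) \<omega>) \<partial>P0)"
    using AE_update[of n]
    by (intro nn_integral_cong_AE) (auto elim!: eventually_mono simp: alive_step[OF assms])
  also have "\<dots> = (\<integral>\<^sup>+ \<omega>. \<integral>\<^sup>+ z. ?F \<omega> z \<partial>K (Y n \<omega>) \<partial>P0)" by (rule nn_integral_next[OF F])
  also have "\<dots> = (\<integral>\<^sup>+ \<omega>. of_bool (alive (Z0 \<omega>) l n) * survive (Suc m) (Y n \<omega>) (blockID (M l \<omega>)) \<partial>P0)"
  proof (intro nn_integral_cong)
    fix \<omega> assume "\<omega> \<in> space P0"
    then have "(\<lambda>z. of_bool (blockID (M l \<omega>) \<notin> set (refs (snd z))) *
      survive m (update \<Delta> (Y n \<omega>) (fst z) (snd z)) (blockID (M l \<omega>))) \<in> borel_measurable innov"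
      using measurable_compose[OF measurable_Pair1'[of \<omega> "filt n" innov] inner] by (simp only: prod.case space_filt)
    then show "(\<integral>\<^sup>+ z. ?F \<omega> z \<partial>K (Y n \<omega>)) = of_bool (alive (Z0 \<omega>) l n) * survive (Suc m) (Y n \<omega>) (blockID (M l \<omega>))"
      by (subst nn_integral_cmult) (simp_all add: measurable_cong_sets[OF sets_innovation refl])
  qed
  finally show ?thesis ..
qed

text \<open>All m steps after issuance n are moved into \<open>survive\<close>, and issuance n
  itself becomes an innovation from the preceding state. That state has law \<open>\<pi>\<close>
  whatever n is, so n disappears from the right-hand side.\<close>

lemma alive_probability_stationary:
  "(\<integral>\<^sup>+ \<omega>. of_bool (alive (Z0 \<omega>) n (n + int m)) \<partial>P0) =
   (\<integral>\<^sup>+ y. \<integral>\<^sup>+ z. survive m (update \<Delta> y (fst z) (snd z)) (blockID (snd z)) \<partial>K y \<partial>\<pi>)"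
proof -
  \<comment> \<open>The induction on j leaves i arbitrary because each step lowers j and raises i by
    one.\<close>
  have "(\<integral>\<^sup>+ \<omega>. of_bool (alive (Z0 \<omega>) n (n + int j)) * survive i (Y (n + int j) \<omega>) (blockID (M n \<omega>)) \<partial>P0) =
    (\<integral>\<^sup>+ \<omega>. survive (i + j) (Y n \<omega>) (blockID (M n \<omega>)) \<partial>P0)" for i j
  proof (induction j arbitrary: i)
    case (Suc j)
    show ?case
      using alive_survive_step[of n "n + int j" i] Suc[of "Suc i"] by (simp add: algebra_simps)
  qed simp
  from this[of m 0]
  have "(\<integral>\<^sup>+ \<omega>. of_bool (alive (Z0 \<omega>) n (n + int m)) \<partial>P0) = (\<integral>\<^sup>+ \<omega>. survive m (Y n \<omega>) (blockID (M n \<omega>)) \<partial>P0)"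
    by simp
  also have "\<dots> = (\<integral>\<^sup>+ \<omega>. survive m (update \<Delta> (Y (n - 1) \<omega>) (G n \<omega>) (M n \<omega>)) (blockID (M n \<omega>)) \<partial>P0)"
    using AE_update[of "n - 1"] by (intro nn_integral_cong_AE) (auto elim!: eventually_mono)
  also have "\<dots> = (\<integral>\<^sup>+ \<omega>. \<integral>\<^sup>+ z. survive m (update \<Delta> (Y (n - 1) \<omega>) (fst z) (snd z)) (blockID (snd z)) \<partial>K (Y (n - 1) \<omega>) \<partial>P0)"
  proof -
    note measurable_filt(1)[OF order_refl, of "n - 1", measurable]
    have "(\<lambda>(\<omega>, z). survive m (update \<Delta> (Y (n - 1) \<omega>) (fst z) (snd z)) (blockID (snd z)))
        \<in> borel_measurable (filt (n - 1) \<Otimes>\<^sub>M innov)"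
      unfolding case_prod_unfold by (rule measurable_survive_compose) measurable
    from nn_integral_next[OF this] show ?thesis by simp
  qed
  also have "\<dots> = (\<integral>\<^sup>+ y. \<integral>\<^sup>+ z. survive m (update \<Delta> y (fst z) (snd z)) (blockID (snd z)) \<partial>K y \<partial>\<pi>)"
  proof (rule nn_integral_state[where h = "\<lambda>y. \<integral>\<^sup>+ z. survive m (update \<Delta> y (fst z) (snd z)) (blockID (snd z)) \<partial>K y"])
    have "(\<lambda>(y, z). survive m (update \<Delta> y (fst z) (snd z)) (blockID (snd z))) \<in> borel_measurable (state_space \<Otimes>\<^sub>M innov)"
      unfolding case_prod_unfold by (rule measurable_survive_compose) measurable
    from nn_integral_measurable_subprob_algebra2[OF this measurable_innovation]
    show "(\<lambda>y. \<integral>\<^sup>+ z. survive m (update \<Delta> y (fst z) (snd z)) (blockID (snd z)) \<partial>K y) \<in> borel_measurable state_space" .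
  qed
  finally show ?thesis .
qed


section \<open>Mean tip count and the exclusion of eternal tips\<close>

lemma AE_regular: "AE \<omega> in P0. regular_path (Z0 \<omega>)"
  unfolding regular_path_def AE_all_countable using AE_update AE_good_step by (simp add: AE_conj_iff)

lemma measurable_eternal_filt:
  assumes "n \<le> n'"
  shows "Measurable.pred (filt n') (\<lambda>\<omega>. fst (Y n \<omega>) ! j \<in> eternal (Z0 \<omega>) n)"
    and "(\<lambda>\<omega>. card (eternal (Z0 \<omega>) n)) \<in> filt n' \<rightarrow>\<^sub>M count_space UNIV"
proof -
  have Ob: "(\<lambda>\<omega>. fst (Y m \<omega>)) \<in> filt n' \<rightarrow>\<^sub>M list_space borel" if "m \<le> n" for m
    using measurable_compose[OF measurable_filt(1) measurable_obs_list, of m n'] that assms by simp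
  note nth = measurable_nth_borel_compose[OF Ob[OF order_refl]]
  show 1: "Measurable.pred (filt n') (\<lambda>\<omega>. fst (Y n \<omega>) ! j \<in> eternal (Z0 \<omega>) n)" for j
    unfolding eternal_def mem_Collect_eq
  proof (rule pred_intros_countable(1))
    fix m
    show "Measurable.pred (filt n') (\<lambda>\<omega>. m \<le> n \<longrightarrow> fst (Y n \<omega>) ! j \<in> set (fst (Y m \<omega>)))"
      using pred_mem_list[OF Ob nth, of m j] by (cases "m \<le> n") simp_all
  qed
  show "(\<lambda>\<omega>. card (eternal (Z0 \<omega>) n)) \<in> filt n' \<rightarrow>\<^sub>M count_space UNIV"
    by (rule measurable_card_subset_list[OF Ob[OF order_refl] eternal_subset 1])
qed

text \<open>A tip of age m at issuance n is block n - m, whose survival probability does not depend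
  on n. So n occurs only in the eternal summand, which must then have constant mean.\<close>

lemma tip_expectation_split:
  "(\<integral>\<^sup>+ y. of_nat (obs_tips y) \<partial>\<pi>) =
     (\<Sum>m. \<integral>\<^sup>+ y. \<integral>\<^sup>+ z. survive m (update \<Delta> y (fst z) (snd z)) (blockID (snd z)) \<partial>K y \<partial>\<pi>) +
     (\<integral>\<^sup>+ \<omega>. of_nat (card (eternal (Z0 \<omega>) n)) \<partial>P0)"
proof -
  have a [measurable]: "(\<lambda>\<omega>. of_bool (alive (Z0 \<omega>) (n - int m) n) :: ennreal) \<in> borel_measurable P0" for m
    by measurable
  have "(\<lambda>\<omega>. card (eternal (Z0 \<omega>) n)) \<in> P0 \<rightarrow>\<^sub>M count_space UNIV"
    by (rule measurable_filt_imp[OF measurable_eternal_filt(2)[OF order_refl]])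
  note this[measurable]
  have "(\<integral>\<^sup>+ y. of_nat (obs_tips y) \<partial>\<pi>) = (\<integral>\<^sup>+ \<omega>. of_nat (obs_tips (Y n \<omega>)) \<partial>P0)"
    by (rule nn_integral_state[symmetric, where h = "\<lambda>y. of_nat (obs_tips y)"]) measurable
  also have "\<dots> = (\<integral>\<^sup>+ \<omega>. (\<Sum>m. of_bool (alive (Z0 \<omega>) (n - int m) n)) + of_nat (card (eternal (Z0 \<omega>) n)) \<partial>P0)"
    using AE_regular by (intro nn_integral_cong_AE) (auto elim!: eventually_mono simp: regular_obs_tips)
  also have "\<dots> = (\<integral>\<^sup>+ \<omega>. (\<Sum>m. of_bool (alive (Z0 \<omega>) (n - int m) n)) \<partial>P0) + (\<integral>\<^sup>+ \<omega>. of_nat (card (eternal (Z0 \<omega>) n)) \<partial>P0)"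
    by (rule nn_integral_add) measurable
  also have "(\<integral>\<^sup>+ \<omega>. (\<Sum>m. of_bool (alive (Z0 \<omega>) (n - int m) n)) \<partial>P0) = (\<Sum>m. \<integral>\<^sup>+ \<omega>. of_bool (alive (Z0 \<omega>) (n - int m) n) \<partial>P0)"
    by (rule nn_integral_suminf) measurable
  also have "(\<lambda>m. \<integral>\<^sup>+ \<omega>. of_bool (alive (Z0 \<omega>) (n - int m) n) \<partial>P0) =
      (\<lambda>m. \<integral>\<^sup>+ y. \<integral>\<^sup>+ z. survive m (update \<Delta> y (fst z) (snd z)) (blockID (snd z)) \<partial>K y \<partial>\<pi>)"
  proof
    fix m
    show "(\<integral>\<^sup>+ \<omega>. of_bool (alive (Z0 \<omega>) (n - int m) n) \<partial>P0) =
      (\<integral>\<^sup>+ y. \<integral>\<^sup>+ z. survive m (update \<Delta> y (fst z) (snd z)) (blockID (snd z)) \<partial>K y \<partial>\<pi>)"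
      using alive_probability_stationary[of "n - int m" m] by simp
  qed
  finally show ?thesis .
qed

text \<open>
  The number of eternal tips decreases along the path and has a finite, constant expectation.
\<close>

lemma AE_eternal_step: "AE \<omega> in P0. eternal (Z0 \<omega>) (n + 1) = eternal (Z0 \<omega>) n"
proof -
  let ?e = "\<lambda>n \<omega>. card (eternal (Z0 \<omega>) n)"
  have m: "?e n \<in> P0 \<rightarrow>\<^sub>M count_space UNIV" for n
    by (rule measurable_filt_imp[OF measurable_eternal_filt(2)[OF order_refl]])
  note m[measurable]
  let ?S = "\<Sum>m. \<integral>\<^sup>+ y. \<integral>\<^sup>+ z. survive m (update \<Delta> y (fst z) (snd z)) (blockID (snd z)) \<partial>K y \<partial>\<pi>"
  have S: "?S \<noteq> \<infinity>" and fin: "(\<integral>\<^sup>+ \<omega>. of_nat (?e n \<omega>) \<partial>P0) \<noteq> \<infinity>" for n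
    using tip_expectation_finite tip_expectation_split[of n] by auto
  have "?S + (\<integral>\<^sup>+ \<omega>. of_nat (?e n \<omega>) \<partial>P0) = ?S + (\<integral>\<^sup>+ \<omega>. of_nat (?e (n + 1) \<omega>) \<partial>P0)"
    by (simp only: tip_expectation_split[symmetric])
  then have eq: "(\<integral>\<^sup>+ \<omega>. of_nat (?e n \<omega>) \<partial>P0) = (\<integral>\<^sup>+ \<omega>. of_nat (?e (n + 1) \<omega>) \<partial>P0)"
    using S by (simp add: ennreal_add_left_cancel)
  have le: "?e (n + 1) \<omega> \<le> ?e n \<omega>" for \<omega>
    by (rule card_mono[OF finite_eternal eternal_antimono]) simp
  have "(\<integral>\<^sup>+ \<omega>. of_nat (?e n \<omega>) \<partial>P0) = (\<integral>\<^sup>+ \<omega>. of_nat (?e (n + 1) \<omega>) + of_nat (?e n \<omega> - ?e (n + 1) \<omega>) \<partial>P0)"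
    by (intro nn_integral_cong) (simp only: of_nat_add[symmetric] le_add_diff_inverse[OF le])
  also have "\<dots> = (\<integral>\<^sup>+ \<omega>. of_nat (?e (n + 1) \<omega>) \<partial>P0) + (\<integral>\<^sup>+ \<omega>. of_nat (?e n \<omega> - ?e (n + 1) \<omega>) \<partial>P0)"
    by (rule nn_integral_add) measurable
  finally have "(\<integral>\<^sup>+ \<omega>. of_nat (?e (n + 1) \<omega>) \<partial>P0) + 0 =
      (\<integral>\<^sup>+ \<omega>. of_nat (?e (n + 1) \<omega>) \<partial>P0) + (\<integral>\<^sup>+ \<omega>. of_nat (?e n \<omega> - ?e (n + 1) \<omega>) \<partial>P0)"
    using eq by simp
  then have "(\<integral>\<^sup>+ \<omega>. of_nat (?e n \<omega> - ?e (n + 1) \<omega>) \<partial>P0) = 0"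
    using fin[of "n + 1"] by (simp only: ennreal_add_left_cancel) simp
  then have "AE \<omega> in P0. (of_nat (?e n \<omega> - ?e (n + 1) \<omega>) :: ennreal) = 0"
    by (subst (asm) nn_integral_0_iff_AE) measurable
  then show ?thesis
  proof eventually_elim
    case (elim \<omega>)
    then have "?e n \<omega> \<le> ?e (n + 1) \<omega>" by simp
    then show ?case by (intro card_seteq eternal_antimono finite_eternal) simp_all
  qed
qed

text \<open>An eternal tip stays eternal, so the actual next block does not reference it. As the
  conditional probabilities of a reference integrate to zero, they vanish for almost every past,
  which is a statement about all innovations that could have occurred.\<close>

lemma AE_eternal_unreferenced:
  "AE \<omega> in P0. AE z in K (Y n \<omega>). \<forall>x\<in>eternal (Z0 \<omega>) n. x \<notin> set (refs (snd z))"
proof -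
  \<comment> \<open>The eternal tips are named by their index in the current tip list, to make the
    event measurable.\<close>
  let ?Q = "\<lambda>\<omega> z. \<exists>j. j < length (fst (Y n \<omega>)) \<and> fst (Y n \<omega>) ! j \<in> eternal (Z0 \<omega>) n \<and> fst (Y n \<omega>) ! j \<in> set (refs (snd z))"
  have Q: "(\<forall>x\<in>eternal (Z0 \<omega>) n. x \<notin> set (refs (snd z))) \<longleftrightarrow> \<not> ?Q \<omega> z" for \<omega> and z :: "real \<times> 'n mark"
    using subsetD[OF eternal_subset, of _ "Z0 \<omega>" n] by (metis in_set_conv_nth)
  have Ob [measurable]: "(\<lambda>\<omega>. fst (Y n \<omega>)) \<in> filt n \<rightarrow>\<^sub>M list_space borel"
    using measurable_compose[OF measurable_filt(1)[OF order_refl] measurable_obs_list] .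
  note measurable_nth_borel_compose[OF Ob, measurable] measurable_eternal_filt(1)[OF order_refl, measurable]
  have [measurable]: "Measurable.pred (filt n \<Otimes>\<^sub>M innov) (\<lambda>w. ?Q (fst w) (snd w))"
    by measurable
  have "(\<integral>\<^sup>+ \<omega>. \<integral>\<^sup>+ z. of_bool (?Q \<omega> z) \<partial>K (Y n \<omega>) \<partial>P0) = (\<integral>\<^sup>+ \<omega>. of_bool (?Q \<omega> (G (n + 1) \<omega>, M (n + 1) \<omega>)) \<partial>P0)"
    by (rule nn_integral_next[symmetric]) (unfold case_prod_unfold, measurable)
  also have "\<dots> = (\<integral>\<^sup>+ \<omega>. 0 \<partial>P0)"
  proof (rule nn_integral_cong_AE)
    show "AE \<omega> in P0. of_bool (?Q \<omega> (G (n + 1) \<omega>, M (n + 1) \<omega>)) = (0 :: ennreal)"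
      using AE_regular AE_eternal_step[of n]
    proof eventually_elim
      case (elim \<omega>)
      have "x \<notin> set (refs (M (n + 1) \<omega>))" if "x \<in> eternal (Z0 \<omega>) n" for x
        using that elim(2) eternal_subset[of "Z0 \<omega>" "n + 1"] regular_obs_step[OF elim(1), of n] by blast
      then show ?case by auto
    qed
  qed
  finally have zero: "(\<integral>\<^sup>+ \<omega>. \<integral>\<^sup>+ z. of_bool (?Q \<omega> z) \<partial>K (Y n \<omega>) \<partial>P0) = (0 :: ennreal)" by simp
  have Q_meas: "(\<lambda>(\<omega>, z). of_bool (?Q \<omega> z) :: ennreal) \<in> borel_measurable (filt n \<Otimes>\<^sub>M innov)"
    unfolding case_prod_unfold by measurable
  have "(\<lambda>\<omega>. K (Y n \<omega>)) \<in> filt n \<rightarrow>\<^sub>M subprob_algebra innov"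
    by (rule measurable_compose[OF measurable_filt(1)[OF order_refl] measurable_innovation])
  from measurable_filt_imp[OF nn_integral_measurable_subprob_algebra2[OF Q_meas this]] zero
  have "AE \<omega> in P0. (\<integral>\<^sup>+ z. of_bool (?Q \<omega> z) \<partial>K (Y n \<omega>)) = (0 :: ennreal)"
    by (rule nn_integral_0_iff_AE[THEN iffD1])
  then show ?thesis
  proof eventually_elim
    case zero: (elim \<omega>)
    have "(\<lambda>z. of_bool (?Q \<omega> z) :: ennreal) \<in> borel_measurable (K (Y n \<omega>))"
      unfolding measurable_cong_sets[OF sets_innovation refl] by measurable
    from this zero have "AE z in K (Y n \<omega>). of_bool (?Q \<omega> z) = (0 :: ennreal)"
      by (rule nn_integral_0_iff_AE[THEN iffD1])
    then show "AE z in K (Y n \<omega>). \<forall>x\<in>eternal (Z0 \<omega>) n. x \<notin> set (refs (snd z))"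
      unfolding Q by (auto elim!: eventually_mono)
  qed
qed

text \<open>After such a gap the newest block is the only one that can be recent, and it is not
  eternal. So \<open>emeasure_innovation_ref\<close> gives an eternal tip a positive chance of being
  referenced, against \<open>AE_eternal_unreferenced\<close>.\<close>

lemma AE_eternal_empty_after_long_gap: "AE \<omega> in P0. \<Delta> \<le> G n \<omega> \<longrightarrow> eternal (Z0 \<omega>) n = {}"
  using AE_regular AE_admissible[of n] AE_admissible[of "n - 1"] AE_eternal_unreferenced[of n]
proof eventually_elim
  case (elim \<omega>)
  note reg = elim(1) and adm = elim(2) and adm' = elim(3)
  show ?case
  proof (intro impI equals0I)
    fix x assume gap: "\<Delta> \<le> G n \<omega>" and x: "x \<in> eternal (Z0 \<omega>) n"
    have upd: "Y n \<omega> = update \<Delta> (Y (n - 1) \<omega>) (G n \<omega>) (M n \<omega>)"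
      using reg[unfolded regular_path_def, THEN spec, of "n - 1"] by simp
    have aged: "\<Delta> \<le> a" if "(a, \<kappa>) \<in> set (aged (G n \<omega>) (snd (snd (Y (n - 1) \<omega>))))" for a \<kappa>
      using that gap admissible_ages[OF adm'] by (fastforce simp: aged_def)
    have "recent_ids (Y n \<omega>) \<subseteq> {blockID (M n \<omega>)}"
    proof
      fix e assume "e \<in> recent_ids (Y n \<omega>)"
      then obtain w where "e = (\<lambda>(a, \<kappa>). blockID \<kappa>) w"
        "w \<in> set (filter (\<lambda>(a, _). a < \<Delta>) (aged (G n \<omega>) (snd (snd (Y (n - 1) \<omega>))) @ [(0, M n \<omega>)]))"
        unfolding upd update_recent by (rule imageE)
      moreover obtain a \<kappa> where "w = (a, \<kappa>)" by (cases w)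
      ultimately have e: "e = blockID \<kappa>" and a: "a < \<Delta>"
        "(a, \<kappa>) \<in> set (aged (G n \<omega>) (snd (snd (Y (n - 1) \<omega>))) @ [(0, M n \<omega>)])"
        by (simp_all only: set_filter mem_Collect_eq prod.case)
      then have "(a, \<kappa>) \<notin> set (aged (G n \<omega>) (snd (snd (Y (n - 1) \<omega>))))" using aged[of a \<kappa>] by auto
      with a(2) have "\<kappa> = M n \<omega>" by simp
      with e show "e \<in> {blockID (M n \<omega>)}" by simp
    qed
    moreover have "x \<noteq> blockID (M n \<omega>)"
      using x regular_alive_not_eternal[OF reg, of n n] by auto
    ultimately have x': "x \<in> set (fst (Y n \<omega>)) - recent_ids (Y n \<omega>)"
      using x eternal_subset[of "Z0 \<omega>" n] by auto
    then have "0 < obs_tips (Y n \<omega>)" by (auto simp: obs_tips_def intro: Suc_leI)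
    then have "0 < real (obs_tips (Y n \<omega>) + k * length (snd (snd (Y n \<omega>))))"
      by (simp only: of_nat_0_less_iff add_gr_0 simp_thms)
    then have "0 < min 1 (2 / real (obs_tips (Y n \<omega>) + k * length (snd (snd (Y n \<omega>)))))"
      by (simp del: of_nat_add)
    then have "0 < emeasure (K (Y n \<omega>)) {z. x \<in> set (refs (snd z))}"
      by (intro less_le_trans[OF _ emeasure_innovation_ref[OF adm x']]) (simp only: ennreal_less_zero_iff)
    moreover have "AE z in K (Y n \<omega>). z \<notin> {z. x \<in> set (refs (snd z))}"
      using elim(4) x by (auto elim!: eventually_mono)
    moreover have "{z. x \<in> set (refs (snd z))} \<in> sets (K (Y n \<omega>))"
    proof -
      have "Measurable.pred innov (\<lambda>z. x \<in> set (refs (snd z)))" by measurable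
      then show ?thesis by (simp add: pred_def)
    qed
    ultimately show False by (simp add: AE_iff_null null_sets_def)
  qed
qed

lemma emeasure_long_gap: "0 < emeasure expo {\<Delta>..}"
proof -
  interpret expo: prob_space expo by (rule prob_space_expo)
  have "emeasure expo (space expo) = emeasure expo {..<\<Delta>} + emeasure expo {\<Delta>..}"
    by (subst plus_emeasure) (auto simp: expo_def intro!: arg_cong[of _ _ "emeasure _"])
  then show ?thesis
    using expo_gap_less expo.emeasure_space_1 by (auto simp: zero_less_iff_neq_zero)
qed

text \<open>Eternal tips at n would survive to n + 1, so the gap between must be short. As the gap
  is independent of the past and long with positive probability, the probability of an eternal tip
  at n times a positive factor is zero.\<close>

lemma AE_eternal_empty: "AE \<omega> in P0. eternal (Z0 \<omega>) n = {}"
proof -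
  let ?F = "\<lambda>\<omega> z. of_bool (card (eternal (Z0 \<omega>) n) \<noteq> 0) * indicator {\<Delta>..} (fst z) :: ennreal"
  note measurable_eternal_filt(2)[OF order_refl, of n, measurable]
  have m [measurable]: "(\<lambda>\<omega>. of_bool (card (eternal (Z0 \<omega>) n) \<noteq> 0) :: ennreal) \<in> borel_measurable (filt n)"
    by measurable
  have "(\<integral>\<^sup>+ \<omega>. \<integral>\<^sup>+ z. ?F \<omega> z \<partial>K (Y n \<omega>) \<partial>P0) = (\<integral>\<^sup>+ \<omega>. ?F \<omega> (G (n + 1) \<omega>, M (n + 1) \<omega>) \<partial>P0)"
    by (rule nn_integral_next[symmetric]) (unfold case_prod_unfold, measurable)
  also have "\<dots> = (\<integral>\<^sup>+ \<omega>. 0 \<partial>P0)"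
    using AE_eternal_step[of n] AE_eternal_empty_after_long_gap[of "n + 1"]
    by (intro nn_integral_cong_AE) (auto elim!: eventually_elim2 simp: indicator_def)
  finally have zero: "(\<integral>\<^sup>+ \<omega>. \<integral>\<^sup>+ z. ?F \<omega> z \<partial>K (Y n \<omega>) \<partial>P0) = 0" by simp
  have "(\<integral>\<^sup>+ z. ?F \<omega> z \<partial>K (Y n \<omega>)) = of_bool (card (eternal (Z0 \<omega>) n) \<noteq> 0) * emeasure expo {\<Delta>..}" for \<omega>
    using nn_integral_innovation_gap[of "\<lambda>g. of_bool (card (eternal (Z0 \<omega>) n) \<noteq> 0) * indicator {\<Delta>..} g" "Y n \<omega>"]
    by (simp add: nn_integral_cmult)
  with zero have "(\<integral>\<^sup>+ \<omega>. of_bool (card (eternal (Z0 \<omega>) n) \<noteq> 0) * emeasure expo {\<Delta>..} \<partial>P0) = 0" by simp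
  moreover have "(\<lambda>\<omega>. of_bool (card (eternal (Z0 \<omega>) n) \<noteq> 0) * emeasure expo {\<Delta>..}) \<in> borel_measurable P0"
    by (intro borel_measurable_times_ennreal measurable_filt_imp[OF m] borel_measurable_const)
  ultimately have "AE \<omega> in P0. of_bool (card (eternal (Z0 \<omega>) n) \<noteq> 0) * emeasure expo {\<Delta>..} = 0"
    by (simp only: nn_integral_0_iff_AE)
  then show ?thesis
    using emeasure_long_gap by (auto elim!: eventually_mono split: if_splits)
qed

section \<open>Mean lifetime under the Palm measure\<close>

lemma tip_expectation_alive:
  "(\<integral>\<^sup>+ y. of_nat (obs_tips y) \<partial>\<pi>) = (\<Sum>m. \<integral>\<^sup>+ \<omega>. of_bool (alive (Z0 \<omega>) 0 (int m)) \<partial>P0)"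
proof -
  have "(\<integral>\<^sup>+ \<omega>. of_nat (card (eternal (Z0 \<omega>) 0)) \<partial>P0) = (\<integral>\<^sup>+ \<omega>. 0 \<partial>P0)"
    using AE_eternal_empty[of 0] by (intro nn_integral_cong_AE) (auto elim!: eventually_mono)
  then show ?thesis
    using alive_probability_stationary[of 0] by (simp add: tip_expectation_split[of 0])
qed

text \<open>Independence of the next gap from the past, whose mean is 1 / rate. It applies to
  survival up to issuance n, which is known before the gap is drawn.\<close>

lemma nn_integral_next_gap:
  assumes f: "f \<in> borel_measurable (filt n)"
  shows "(\<integral>\<^sup>+ \<omega>. f \<omega> * ennreal (G (n + 1) \<omega>) \<partial>P0) = (\<integral>\<^sup>+ \<omega>. f \<omega> \<partial>P0) * ennreal (1 / rate)"
proof -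
  note f[measurable]
  have "(\<integral>\<^sup>+ \<omega>. f \<omega> * ennreal (G (n + 1) \<omega>) \<partial>P0) = (\<integral>\<^sup>+ \<omega>. \<integral>\<^sup>+ z. f \<omega> * ennreal (fst z) \<partial>K (Y n \<omega>) \<partial>P0)"
  proof -
    have "(\<lambda>(\<omega>, z). f \<omega> * ennreal (fst z)) \<in> borel_measurable (filt n \<Otimes>\<^sub>M innov)"
      unfolding case_prod_unfold by measurable
    from nn_integral_next[OF this] show ?thesis by simp
  qed
  also have "\<dots> = (\<integral>\<^sup>+ \<omega>. f \<omega> * ennreal (1 / rate) \<partial>P0)"
  proof (intro nn_integral_cong)
    fix \<omega>
    show "(\<integral>\<^sup>+ z. f \<omega> * ennreal (fst z) \<partial>K (Y n \<omega>)) = f \<omega> * ennreal (1 / rate)"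
      using nn_integral_innovation_gap[of "\<lambda>g. f \<omega> * ennreal g" "Y n \<omega>"]
      by (simp add: nn_integral_cmult nn_integral_expo_id)
  qed
  also have "\<dots> = (\<integral>\<^sup>+ \<omega>. f \<omega> \<partial>P0) * ennreal (1 / rate)"
    by (rule nn_integral_multc[OF measurable_filt_imp[OF f]])
  finally show ?thesis .
qed

lemma rate_inverse: "ennreal rate * (a * ennreal (1 / rate)) = a"
proof -
  have "ennreal rate * (a * ennreal (1 / rate)) = a * (ennreal rate * ennreal (1 / rate))"
    by (simp only: mult.assoc mult.commute mult.left_commute)
  also have "ennreal rate * ennreal (1 / rate) = 1"
    using rate by (simp flip: ennreal_mult)
  finally show ?thesis by simp
qed

lemma mean_lifetime: "ennreal rate * (\<integral>\<^sup>+ \<omega>. lifetime (Z0 \<omega>) 0 \<partial>P0) = (\<integral>\<^sup>+ y. of_nat (obs_tips y) \<partial>\<pi>)"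
proof -
  have a [measurable]: "(\<lambda>\<omega>. of_bool (alive (Z0 \<omega>) 0 (int m)) :: ennreal) \<in> borel_measurable P0" for m
    by measurable
  \<comment> \<open>The number of issuances that block 0 survives has finite mean, so it is almost
    surely finite; this is the hypothesis of \<open>regular_lifetime\<close>.\<close>
  have "(\<integral>\<^sup>+ \<omega>. (\<Sum>m. of_bool (alive (Z0 \<omega>) 0 (int m)) :: ennreal) \<partial>P0) < \<infinity>"
    using tip_expectation_finite tip_expectation_alive by (subst nn_integral_suminf) simp_all
  then have "AE \<omega> in P0. (\<Sum>m. of_bool (alive (Z0 \<omega>) 0 (int m)) :: ennreal) \<noteq> \<infinity>"
    by (intro nn_integral_noteq_infinite) auto
  then have "AE \<omega> in P0. \<exists>m. \<not> alive (Z0 \<omega>) 0 (int m)"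
  proof eventually_elim
    case (elim \<omega>)
    show ?case
    proof (rule ccontr)
      assume "\<not> ?thesis"
      then have "(\<Sum>m. of_bool (alive (Z0 \<omega>) 0 (int m)) :: ennreal) = (\<Sum>m::nat. 1)" by simp
      also have "\<dots> = \<infinity>"
        using nn_integral_count_space_nat[of "\<lambda>_. 1"] by simp
      finally show False using elim by simp
    qed
  qed
  then have "AE \<omega> in P0. lifetime (Z0 \<omega>) 0 = (\<Sum>m. of_bool (alive (Z0 \<omega>) 0 (int m)) * ennreal (G (int m + 1) \<omega>))"
    using AE_regular
  proof eventually_elim
    case (elim \<omega>)
    then obtain m where "\<not> alive (Z0 \<omega>) 0 (0 + int m)" by auto
    from regular_lifetime[OF elim(2) this] show ?case by simp
  qed
  then have "(\<integral>\<^sup>+ \<omega>. lifetime (Z0 \<omega>) 0 \<partial>P0) = (\<integral>\<^sup>+ \<omega>. (\<Sum>m. of_bool (alive (Z0 \<omega>) 0 (int m)) * ennreal (G (int m + 1) \<omega>)) \<partial>P0)"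
    by (intro nn_integral_cong_AE)
  also have "\<dots> = (\<Sum>m. \<integral>\<^sup>+ \<omega>. of_bool (alive (Z0 \<omega>) 0 (int m)) * ennreal (G (int m + 1) \<omega>) \<partial>P0)"
    by (rule nn_integral_suminf) measurable
  also have "\<dots> = (\<Sum>m. (\<integral>\<^sup>+ \<omega>. of_bool (alive (Z0 \<omega>) 0 (int m)) \<partial>P0) * ennreal (1 / rate))"
  proof (intro suminf_cong)
    fix m
    note measurable_alive_filt[of 0 "int m", simplified, measurable]
    show "(\<integral>\<^sup>+ \<omega>. of_bool (alive (Z0 \<omega>) 0 (int m)) * ennreal (G (int m + 1) \<omega>) \<partial>P0) =
      (\<integral>\<^sup>+ \<omega>. of_bool (alive (Z0 \<omega>) 0 (int m)) \<partial>P0) * ennreal (1 / rate)"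
      by (rule nn_integral_next_gap) measurable
  qed
  also have "\<dots> = (\<integral>\<^sup>+ y. of_nat (obs_tips y) \<partial>\<pi>) * ennreal (1 / rate)"
    by (simp add: tip_expectation_alive)
  finally show ?thesis by (simp only: rate_inverse)
qed

end


section \<open>The time-stationary version\<close>

lemma time_at_reroot [simp]: "time_at (reroot s n z) m = time_at z (n + m) - s"
  and state_at_reroot [simp]: "state_at (reroot s n z) m = state_at z (n + m)"
  and mark_at_reroot [simp]: "mark_at (reroot s n z) m = mark_at z (n + m)"
  by (simp_all add: time_at_def state_at_def mark_at_def reroot_def)

lemma alive_reroot [simp]: "alive (reroot s n z) l m \<longleftrightarrow> alive z (n + l) (n + m)"
proof -
  have "(\<forall>j\<in>{l<..m}. Q (n + j)) \<longleftrightarrow> (\<forall>j\<in>{n + l<..n + m}. Q j)" for Q :: "int \<Rightarrow> bool"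
  proof (safe)
    fix j assume "\<forall>j\<in>{l<..m}. Q (n + j)" "j \<in> {n + l<..n + m}"
    then have "Q (n + (j - n))" by (intro bspec[of _ _ "j - n"]) auto
    then show "Q j" by simp
  qed auto
  then show ?thesis by (simp add: alive_def)
qed

lemma measurable_reroot:
  assumes z: "z \<in> N \<rightarrow>\<^sub>M path_space" and s: "s \<in> borel_measurable N"
  shows "(\<lambda>\<omega>. reroot (s \<omega>) n (z \<omega>)) \<in> N \<rightarrow>\<^sub>M (path_space :: 'n::finite path measure)"
proof -
  note [measurable] = s measurable_compose[OF z measurable_time_at] measurable_compose[OF z measurable_state_at]
    measurable_compose[OF z measurable_mark_at]
  have sp: "space (borel \<Otimes>\<^sub>M state_space \<Otimes>\<^sub>M mark_space :: (real \<times> 'n state \<times> 'n mark) measure) = UNIV"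
    by (simp add: space_pair_measure)
  show ?thesis
    unfolding reroot_def path_space_def by (rule measurable_PiM_single') (measurable, simp add: sp)
qed

lemma last_issue_eq:
  assumes "strict_mono (time_at z)" "time_at z n \<le> t" "t < time_at z (n + 1)"
  shows "last_issue z t = n"
  unfolding last_issue_def
proof (rule the_equality)
  fix m assume m: "time_at z m \<le> t \<and> t < time_at z (m + 1)"
  have "time_at z m < time_at z (n + 1)" "time_at z n < time_at z (m + 1)" using m assms by auto
  then have "m < n + 1" "n < m + 1" using assms(1) by (simp_all add: strict_mono_less)
  then show "m = n" by simp
qed (use assms in simp)

section \<open>The tip count as a functional of the marked point process\<close>

definition proper_path :: "'n path \<Rightarrow> bool" where
  "proper_path z \<longleftrightarrow> strict_mono (time_at z) \<and> filterlim (time_at z) at_top at_top \<and> filterlim (time_at z) at_bot at_bot"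

lemma last_issue_bounds:
  assumes "proper_path z"
  shows "time_at z (last_issue z t) \<le> t" "t < time_at z (last_issue z t + 1)"
proof -
  have mono: "strict_mono (time_at z)" using assms by (simp add: proper_path_def)
  have "eventually (\<lambda>n. time_at z n \<le> t) at_bot" "eventually (\<lambda>n. t < time_at z n) at_top"
    using assms unfolding proper_path_def
    by (auto simp: filterlim_at_bot filterlim_at_top_dense)
  then obtain a b where a: "time_at z a \<le> t" and b: "t < time_at z b"
    by (auto simp: eventually_at_bot_linorder eventually_at_top_linorder)
  have "a < b" using a b mono by (metis le_less_trans strict_mono_less)
  have "\<exists>n. time_at z n \<le> t \<and> t < time_at z (n + 1)"
  proof (rule ccontr)
    assume no: "\<not> ?thesis"
    have "time_at z n \<le> t" if "a \<le> n" for n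
      using that by (induction n rule: int_ge_induct) (use a no in \<open>auto simp: not_less\<close>)
    then show False using b \<open>a < b\<close> by (meson less_imp_le not_less)
  qed
  then obtain n where "time_at z n \<le> t" "t < time_at z (n + 1)" by blast
  moreover from this have "last_issue z t = n" by (rule last_issue_eq[OF mono])
  ultimately show "time_at z (last_issue z t) \<le> t" "t < time_at z (last_issue z t + 1)" by simp_all
qed

text \<open>Expresses that there are no eternal tips, through tip counts and \<open>alive\<close>
  alone. In this form the property is measurable and does not depend on the root, so it passes from
  the Palm version to the time-stationary one.\<close>

definition balanced_path :: "'n path \<Rightarrow> bool" where
  "balanced_path z \<longleftrightarrow> (\<forall>n. (of_nat (obs_tips (state_at z n)) :: ennreal) = (\<Sum>i. of_bool (alive z (n - int i) n)))"

lemma balanced_path_reroot: "balanced_path (reroot s n z) \<longleftrightarrow> balanced_path z"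
proof
  assume b: "balanced_path (reroot s n z)"
  show "balanced_path z"
    unfolding balanced_path_def
  proof
    fix m
    have "(of_nat (obs_tips (state_at (reroot s n z) (m - n))) :: ennreal) =
        (\<Sum>i. of_bool (alive (reroot s n z) (m - n - int i) (m - n)))"
      using b unfolding balanced_path_def by blast
    then show "(of_nat (obs_tips (state_at z m)) :: ennreal) = (\<Sum>i. of_bool (alive z (m - int i) m))"
      by (simp add: algebra_simps)
  qed
qed (simp add: balanced_path_def add_diff_eq)

lemma measurable_balanced_path [measurable]:
  "Measurable.pred (path_space :: 'n::finite path measure) balanced_path"
  unfolding balanced_path_def[abs_def] by measurable

text \<open>If block n has survived up to N, its first reference comes at issuance N + 1 or later,
  strictly after t. The strict inequality reflects that a tip is lost at the very time of the
  reference.\<close>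

lemma alive_iff_lifetime:
  assumes mono: "strict_mono (time_at z)" and t: "time_at z N \<le> t" "t < time_at z (N + 1)"
  shows "time_at z n \<le> t \<and> ennreal (t - time_at z n) < lifetime z n \<longleftrightarrow> n \<le> N \<and> alive z n N"
proof -
  have T: "time_at z a \<le> time_at z b \<longleftrightarrow> a \<le> b" for a b using mono by (simp add: strict_mono_less_eq)
  have nN: "time_at z n \<le> t \<longleftrightarrow> n \<le> N"
  proof
    assume "time_at z n \<le> t"
    then have "time_at z n < time_at z (N + 1)" using t by simp
    then show "n \<le> N" using mono by (simp add: strict_mono_less)
  next
    assume "n \<le> N"
    then show "time_at z n \<le> t" using T[of n N] t by simp
  qed
  have "ennreal (t - time_at z n) < lifetime z n \<longleftrightarrow> alive z n N" if n: "n \<le> N"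
  proof
    assume alive: "alive z n N"
    have "ennreal (t - time_at z n) < ennreal (time_at z (N + 1) - time_at z n)"
      using t n nN by (subst ennreal_less_iff) auto
    also have "\<dots> \<le> lifetime z n"
      unfolding lifetime_def
    proof (rule INF_greatest)
      fix m assume "m \<in> {m. n < m \<and> blockID (mark_at z n) \<in> set (refs (mark_at z m))}"
      then have "\<not> m \<le> N" using alive by (auto simp: alive_def)
      then show "ennreal (time_at z (N + 1) - time_at z n) \<le> ennreal (time_at z m - time_at z n)"
        by (intro ennreal_leI diff_right_mono) (simp add: T)
    qed
    finally show "ennreal (t - time_at z n) < lifetime z n" .
  next
    assume less: "ennreal (t - time_at z n) < lifetime z n"
    show "alive z n N"
      unfolding alive_def
    proof (intro ballI notI)
      fix j assume j: "j \<in> {n<..N}" "blockID (mark_at z n) \<in> set (refs (mark_at z j))"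
      then have "lifetime z n \<le> ennreal (time_at z j - time_at z n)"
        unfolding lifetime_def by (intro INF_lower) simp
      also have "\<dots> \<le> ennreal (t - time_at z n)"
        using j T[of j N] t by (intro ennreal_leI) simp
      finally show False using less by simp
    qed
  qed
  with nN show ?thesis by blast
qed

text \<open>The set collects the points (s, w) with t in [s, s + w), which are the surviving blocks;
  balance says that these are all tips of the state.\<close>

lemma tip_count_Psi:
  assumes proper: "proper_path z" and bal: "balanced_path z"
  shows "of_nat (tip_count z t) = emeasure (Psi z) {(s, w). s \<le> t \<and> ennreal (t - s) < w}"
proof -
  define N where "N = last_issue z t"
  have mono: "strict_mono (time_at z)" using proper by (simp add: proper_path_def)
  have N: "time_at z N \<le> t" "t < time_at z (N + 1)" using last_issue_bounds[OF proper] by (simp_all add: N_def)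
  let ?A = "{i. alive z (N - int i) N}" and ?B = "{n. n \<le> N \<and> alive z n N}"
  have "{x \<in> space (borel \<Otimes>\<^sub>M borel). fst x \<le> t \<and> ennreal (t - fst x) < snd x} \<in> sets (borel \<Otimes>\<^sub>M borel)"
    by measurable
  then have S: "{(s, w). s \<le> t \<and> ennreal (t - s) < w} \<in> sets (borel \<Otimes>\<^sub>M borel)"
    by (simp add: case_prod_unfold space_pair_measure)
  have "emeasure (Psi z) {(s, w). s \<le> t \<and> ennreal (t - s) < w} =
      emeasure (count_space UNIV) {n. time_at z n \<le> t \<and> ennreal (t - time_at z n) < lifetime z n}"
    unfolding Psi_def by (subst emeasure_distr[OF _ S]) (auto simp: vimage_def space_pair_measure)
  also have "\<dots> = emeasure (count_space UNIV) ?B" by (simp only: alive_iff_lifetime[OF mono N])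
  also have "\<dots> = emeasure (count_space UNIV) ?A"
  proof -
    have bij: "bij_betw (\<lambda>i. N - int i) ?A ?B"
      by (rule bij_betwI[where g = "\<lambda>l. nat (N - l)"]) auto
    show ?thesis
      using bij_betw_finite[OF bij] bij_betw_same_card[OF bij] by (simp add: emeasure_count_space)
  qed
  also have "\<dots> = (\<integral>\<^sup>+ i. indicator ?A i \<partial>count_space UNIV)" by simp
  also have "\<dots> = (\<Sum>i. of_bool (alive z (N - int i) N))"
    by (subst nn_integral_count_space_nat) (intro suminf_cong, simp add: indicator_def)
  also have "\<dots> = of_nat (obs_tips (state_at z N))"
    using bal by (simp add: balanced_path_def)
  finally show ?thesis by (simp add: tip_count_def N_def)
qed

lemma borel_measurable_nn_integral_int:
  fixes g :: "int \<Rightarrow> 'a \<Rightarrow> ennreal"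
  assumes g: "\<And>n. g n \<in> borel_measurable M"
  shows "(\<lambda>x. \<integral>\<^sup>+ n. g n x \<partial>count_space UNIV) \<in> borel_measurable M"
proof -
  interpret sigma_finite_measure "count_space (UNIV :: int set)"
    by (rule sigma_finite_measure_count_space_countable) simp
  have "(\<lambda>x. g (snd x) (fst x)) \<in> borel_measurable (M \<Otimes>\<^sub>M count_space (UNIV :: int set))"
    by (rule measurable_compose_countable[where f = "\<lambda>n x. g n (fst x)" and g = snd])
      (rule measurable_compose[OF measurable_fst g], simp)
  then show ?thesis
    by (intro borel_measurable_nn_integral) (simp add: case_prod_unfold)
qed

text \<open>Folds the line onto [0, 1): each real number has exactly one integer translate
  there.\<close>

lemma nn_integral_unit_intervals:
  fixes f :: "real \<Rightarrow> ennreal"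
  assumes [measurable]: "f \<in> borel_measurable borel"
  shows "(\<integral>\<^sup>+ t. f t \<partial>lborel) = (\<integral>\<^sup>+ t. indicator {0..<1} t * (\<integral>\<^sup>+ i. f (t - real_of_int i) \<partial>count_space UNIV) \<partial>lborel)"
proof -
  have one: "(\<integral>\<^sup>+ i. indicator {0..<1} (t + real_of_int i) \<partial>count_space UNIV) = (1 :: ennreal)" for t
  proof -
    have "indicator {0..<1} (t + real_of_int i) = (indicator {- \<lfloor>t\<rfloor>} i :: ennreal)" for i
    proof -
      have "t + real_of_int i \<in> {0..<1} \<longleftrightarrow> \<lfloor>t\<rfloor> = - i"
        unfolding floor_eq_iff by (simp, linarith)
      also have "\<dots> \<longleftrightarrow> i \<in> {- \<lfloor>t\<rfloor>}" by (simp only: singleton_iff) presburger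
      finally show ?thesis by (simp only: indicator_def)
    qed
    then show ?thesis by simp
  qed
  have "(\<integral>\<^sup>+ t. f t \<partial>lborel) = (\<integral>\<^sup>+ t. \<integral>\<^sup>+ i. indicator {0..<1} (t + real_of_int i) * f t \<partial>count_space UNIV \<partial>lborel)"
    by (subst nn_integral_multc) (simp_all only: one mult_1_left borel_measurable_count_space)
  also have "\<dots> = (\<integral>\<^sup>+ i. \<integral>\<^sup>+ t. indicator {0..<1} (t + real_of_int i) * f t \<partial>lborel \<partial>count_space UNIV)"
    by (rule nn_integral_count_space_nn_integral) simp_all
  also have "\<dots> = (\<integral>\<^sup>+ i. \<integral>\<^sup>+ t. indicator {0..<1} t * f (t - real_of_int i) \<partial>lborel \<partial>count_space UNIV)"
  proof (rule nn_integral_cong)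
    fix i :: int
    show "(\<integral>\<^sup>+ t. indicator {0..<1} (t + real_of_int i) * f t \<partial>lborel) = (\<integral>\<^sup>+ t. indicator {0..<1} t * f (t - real_of_int i) \<partial>lborel)"
      by (subst nn_integral_real_affine[where c = 1 and t = "- real_of_int i"]) simp_all
  qed
  also have "\<dots> = (\<integral>\<^sup>+ t. \<integral>\<^sup>+ i. indicator {0..<1} t * f (t - real_of_int i) \<partial>count_space UNIV \<partial>lborel)"
    by (rule nn_integral_count_space_nn_integral[symmetric]) simp_all
  finally show ?thesis by (simp add: nn_integral_cmult)
qed

section \<open>Palm calculus for the time-stationary path\<close>

locale palm_pair = block_evolution k rate \<Delta> \<nu> D \<pi> P0 Z0
  for k :: nat and rate \<Delta> :: real and \<nu> :: "'n::finite pmf" and D :: "'n \<Rightarrow> ('n \<Rightarrow> real) measure"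
    and \<pi> :: "'n state measure" and P0 :: "'a measure" and Z0 :: "'a \<Rightarrow> 'n path" +
  fixes P :: "'b measure" and Z :: "'b \<Rightarrow> 'n path"
  assumes stationary: "time_stationary rate P Z" and palm: "palm_version rate P Z P0 Z0"
begin

abbreviation T :: "int \<Rightarrow> 'b \<Rightarrow> real" where "T n \<omega> \<equiv> time_at (Z \<omega>) n"
abbreviation X :: "int \<Rightarrow> 'b \<Rightarrow> ennreal" where "X n \<omega> \<equiv> of_nat (obs_tips (state_at (Z \<omega>) n))"

lemma prob_space_P: "prob_space P"
  and measurable_Z [measurable]: "Z \<in> P \<rightarrow>\<^sub>M path_space"
  using stationary by (simp_all add: time_stationary_def)

lemma proper_Z: "\<omega> \<in> space P \<Longrightarrow> proper_path (Z \<omega>)"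
  using stationary by (simp add: time_stationary_def proper_path_def)

lemma measurable_last_issue: "(\<lambda>\<omega>. last_issue (Z \<omega>) t) \<in> P \<rightarrow>\<^sub>M count_space UNIV"
proof (subst measurable_count_space_eq2_countable, simp, safe)
  fix n
  have "(\<lambda>\<omega>. last_issue (Z \<omega>) t) -` {n} \<inter> space P = {\<omega> \<in> space P. T n \<omega> \<le> t \<and> t < T (n + 1) \<omega>}"
    using last_issue_eq last_issue_bounds[OF proper_Z] proper_Z by (fastforce simp: proper_path_def)
  also have "\<dots> \<in> sets P" by measurable
  finally show "(\<lambda>\<omega>. last_issue (Z \<omega>) t) -` {n} \<inter> space P \<in> sets P" .
qed

lemma measurable_rerooted: "(\<lambda>\<omega>. reroot t (last_issue (Z \<omega>) t) (Z \<omega>)) \<in> P \<rightarrow>\<^sub>M path_space"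
  by (rule measurable_compose_countable[OF _ measurable_last_issue, where f = "\<lambda>n \<omega>. reroot t n (Z \<omega>)"])
    (rule measurable_reroot, simp_all)

lemma nn_integral_rerooted:
  assumes f: "f \<in> borel_measurable path_space"
  shows "(\<integral>\<^sup>+ \<omega>. f (reroot t (last_issue (Z \<omega>) t) (Z \<omega>)) \<partial>P) = (\<integral>\<^sup>+ \<omega>. f (Z \<omega>) \<partial>P)"
proof -
  have "distr P path_space (\<lambda>\<omega>. reroot t (last_issue (Z \<omega>) t) (Z \<omega>)) = distr P path_space Z"
    using stationary by (simp add: time_stationary_def)
  moreover have "(\<integral>\<^sup>+ z. f z \<partial>distr P path_space (\<lambda>\<omega>. reroot t (last_issue (Z \<omega>) t) (Z \<omega>))) =
      (\<integral>\<^sup>+ \<omega>. f (reroot t (last_issue (Z \<omega>) t) (Z \<omega>)) \<partial>P)"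
    by (rule nn_integral_distr[OF measurable_rerooted]) (use f in simp)
  moreover have "(\<integral>\<^sup>+ z. f z \<partial>distr P path_space Z) = (\<integral>\<^sup>+ \<omega>. f (Z \<omega>) \<partial>P)"
    by (rule nn_integral_distr[OF measurable_Z]) (use f in simp)
  ultimately show ?thesis by (simp only:)
qed

text \<open>Seen from time t, the path has its times moved by t and its indices by
  \<open>last_issue\<close>. A sum over all integers ignores the move of indices, so only the move
  of times, recorded by \<open>g'\<close>, is left.\<close>

lemma nn_integral_shift:
  assumes g: "\<And>n. (\<lambda>z. g n z) \<in> borel_measurable path_space"
    and shift: "\<And>s m n z. g n (reroot s m z) = g' s (m + n) z"
  shows "(\<integral>\<^sup>+ \<omega>. \<integral>\<^sup>+ n. g n (Z \<omega>) \<partial>count_space UNIV \<partial>P) = (\<integral>\<^sup>+ \<omega>. \<integral>\<^sup>+ n. g' t n (Z \<omega>) \<partial>count_space UNIV \<partial>P)"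
proof -
  have "(\<lambda>z. \<integral>\<^sup>+ n. g n z \<partial>count_space (UNIV :: int set)) \<in> borel_measurable path_space"
    using g by (intro borel_measurable_nn_integral_int) auto
  from nn_integral_rerooted[OF this, of t]
  have "(\<integral>\<^sup>+ \<omega>. \<integral>\<^sup>+ n. g n (Z \<omega>) \<partial>count_space UNIV \<partial>P) =
    (\<integral>\<^sup>+ \<omega>. \<integral>\<^sup>+ n. g' t (last_issue (Z \<omega>) t + n) (Z \<omega>) \<partial>count_space UNIV \<partial>P)"
    by (simp add: shift)
  also have "\<dots> = (\<integral>\<^sup>+ \<omega>. \<integral>\<^sup>+ n. g' t n (Z \<omega>) \<partial>count_space UNIV \<partial>P)"
    by (intro nn_integral_cong nn_integral_bij_count_space) (rule bij_betwI[where g = "\<lambda>n. n - last_issue (Z _) t"], auto)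
  finally show ?thesis .
qed

text \<open>Campbell's formula. \<open>palm_version\<close> is its case of indicators: it says that
  two measures on paths, the image of the weighted product of P with counting measure and rate times
  the law of \<open>Z0\<close>, agree on all measurable sets.\<close>

lemma nn_integral_palm:
  assumes f: "f \<in> borel_measurable path_space"
  shows "ennreal rate * (\<integral>\<^sup>+ \<omega>. f (Z0 \<omega>) \<partial>P0) =
    (\<integral>\<^sup>+ \<omega>. \<integral>\<^sup>+ n. indicator {0<..1} (T n \<omega>) * f (reroot (T n \<omega>) n (Z \<omega>)) \<partial>count_space UNIV \<partial>P)"
proof -
  interpret C: sigma_finite_measure "count_space (UNIV :: int set)"
    by (rule sigma_finite_measure_count_space_countable) simp
  let ?N = "P \<Otimes>\<^sub>M count_space (UNIV :: int set)"
  let ?w = "\<lambda>x. indicator {0<..1} (T (snd x) (fst x)) :: ennreal"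
  let ?r = "\<lambda>x. reroot (T (snd x) (fst x)) (snd x) (Z (fst x))"
  have [measurable]: "?w \<in> borel_measurable ?N"
    by (rule measurable_compose_countable[where f = "\<lambda>n x. indicator {0<..1} (T n (fst x))" and g = snd]) measurable
  have r [measurable]: "?r \<in> ?N \<rightarrow>\<^sub>M path_space"
    by (rule measurable_compose_countable[where f = "\<lambda>n x. reroot (T n (fst x)) n (Z (fst x))" and g = snd])
      (rule measurable_reroot, measurable)
  define \<mu> where "\<mu> = distr (density ?N ?w) path_space ?r"
  have \<mu>: "(\<integral>\<^sup>+ z. h z \<partial>\<mu>) =
      (\<integral>\<^sup>+ \<omega>. \<integral>\<^sup>+ n. indicator {0<..1} (T n \<omega>) * h (reroot (T n \<omega>) n (Z \<omega>)) \<partial>count_space UNIV \<partial>P)"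
    if h [measurable]: "h \<in> borel_measurable path_space" for h
  proof -
    have "(\<integral>\<^sup>+ z. h z \<partial>\<mu>) = (\<integral>\<^sup>+ x. ?w x * h (?r x) \<partial>?N)"
      unfolding \<mu>_def by (subst nn_integral_distr) (simp_all add: nn_integral_density)
    also have "\<dots> = (\<integral>\<^sup>+ \<omega>. \<integral>\<^sup>+ n. ?w (\<omega>, n) * h (?r (\<omega>, n)) \<partial>count_space UNIV \<partial>P)"
      by (rule C.nn_integral_fst[symmetric]) measurable
    finally show ?thesis by simp
  qed
  have "\<mu> = density (distr P0 path_space Z0) (\<lambda>_. ennreal rate)"
  proof (rule measure_eqI)
    fix A assume "A \<in> sets \<mu>"
    then have A [measurable]: "A \<in> sets path_space" by (simp add: \<mu>_def)
    have "emeasure \<mu> A = (\<integral>\<^sup>+ z. indicator A z \<partial>\<mu>)" by (simp add: \<mu>_def)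
    also have "\<dots> = ennreal rate * emeasure P0 {\<omega> \<in> space P0. Z0 \<omega> \<in> A}"
      using palm A by (simp add: \<mu> palm_version_def)
    also have "{\<omega> \<in> space P0. Z0 \<omega> \<in> A} = Z0 -` A \<inter> space P0" by auto
    also have "ennreal rate * emeasure P0 (Z0 -` A \<inter> space P0) = emeasure (density (distr P0 path_space Z0) (\<lambda>_. ennreal rate)) A"
      by (simp add: emeasure_density_const emeasure_distr)
    finally show "emeasure \<mu> A = emeasure (density (distr P0 path_space Z0) (\<lambda>_. ennreal rate)) A" .
  qed (simp add: \<mu>_def)
  then have "(\<integral>\<^sup>+ z. f z \<partial>\<mu>) = ennreal rate * (\<integral>\<^sup>+ \<omega>. f (Z0 \<omega>) \<partial>P0)"
    using f by (simp add: nn_integral_density nn_integral_distr nn_integral_cmult)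
  then show ?thesis using \<mu>[OF f] by simp
qed

text \<open>For a property that does not depend on the root, the Palm formula says that paths
  violating it have almost surely no issuance in (0, 1], and by stationarity none in any (j, j + 1].
  But every path has issuances.\<close>

lemma AE_transfer:
  assumes Q [measurable]: "Measurable.pred path_space Q"
    and inv: "\<And>s n z. Q (reroot s n z) \<longleftrightarrow> Q z" and AE: "AE \<omega> in P0. Q (Z0 \<omega>)"
  shows "AE \<omega> in P. Q (Z \<omega>)"
proof -
  have zero: "(\<integral>\<^sup>+ \<omega>. \<integral>\<^sup>+ n. indicator {0<..1} (T n \<omega>) * of_bool (\<not> Q (Z \<omega>)) \<partial>count_space UNIV \<partial>P) = 0"
  proof -
    have "(\<integral>\<^sup>+ \<omega>. of_bool (\<not> Q (Z0 \<omega>)) \<partial>P0) = (\<integral>\<^sup>+ \<omega>. 0 \<partial>P0)"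
      using AE by (intro nn_integral_cong_AE) (auto elim!: eventually_mono)
    then show ?thesis
      using nn_integral_palm[of "\<lambda>z. of_bool (\<not> Q z)"] by (simp add: inv)
  qed
  have "AE \<omega> in P. \<forall>j :: int. \<forall>n. indicator {0<..1} (T n \<omega> - j) * of_bool (\<not> Q (Z \<omega>)) = (0 :: ennreal)"
    unfolding AE_all_countable
  proof
    fix j :: int
    have "(\<integral>\<^sup>+ \<omega>. \<integral>\<^sup>+ n. indicator {0<..1} (T n \<omega> - j) * of_bool (\<not> Q (Z \<omega>)) \<partial>count_space UNIV \<partial>P) = (0 :: ennreal)"
      using zero nn_integral_shift[of "\<lambda>n z. indicator {0<..1} (time_at z n) * of_bool (\<not> Q z)"
          "\<lambda>s n z. indicator {0<..1} (time_at z n - s) * of_bool (\<not> Q z)" "real_of_int j"]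
      by (simp add: inv)
    moreover have "(\<lambda>\<omega>. \<integral>\<^sup>+ n. indicator {0<..1} (T n \<omega> - j) * of_bool (\<not> Q (Z \<omega>)) \<partial>count_space UNIV) \<in> borel_measurable P"
      by (intro borel_measurable_nn_integral_int) auto
    ultimately have "AE \<omega> in P. (\<integral>\<^sup>+ n. indicator {0<..1} (T n \<omega> - j) * of_bool (\<not> Q (Z \<omega>)) \<partial>count_space UNIV) = (0 :: ennreal)"
      by (simp only: nn_integral_0_iff_AE)
    then show "\<forall>n. AE \<omega> in P. indicator {0<..1} (T n \<omega> - j) * of_bool (\<not> Q (Z \<omega>)) = (0 :: ennreal)"
      unfolding AE_all_countable[symmetric]
      by (rule eventually_mono) (simp add: nn_integral_0_iff_AE AE_count_space)
  qed
  then show ?thesis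
  proof eventually_elim
    case (elim \<omega>)
    \<comment> \<open>Any issuance would do; the unit interval that contains T 1 is taken.\<close>
    define j where "j = \<lceil>T 1 \<omega>\<rceil> - 1"
    have "T 1 \<omega> - j \<in> {0<..1}" unfolding j_def by (auto; linarith)
    with elim[THEN spec[of _ j], THEN spec[of _ 1]] show ?case by (simp split: if_splits)
  qed
qed

lemma AE_balanced: "AE \<omega> in P. balanced_path (Z \<omega>)"
proof (rule AE_transfer)
  have "AE \<omega> in P0. \<forall>n. eternal (Z0 \<omega>) n = {}"
    unfolding AE_all_countable using AE_eternal_empty by blast
  with AE_regular show "AE \<omega> in P0. balanced_path (Z0 \<omega>)"
    by eventually_elim (simp add: balanced_path_def regular_obs_tips)
qed (simp_all add: balanced_path_reroot)


section \<open>Mean tip count by mass transport\<close>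

lemma tip_count_sum:
  assumes "\<omega> \<in> space P"
  shows "of_nat (tip_count (Z \<omega>) t) = (\<integral>\<^sup>+ n. indicator {T n \<omega>..<T (n + 1) \<omega>} t * X n \<omega> \<partial>count_space UNIV)"
proof -
  let ?N = "last_issue (Z \<omega>) t"
  have "t \<in> {T n \<omega>..<T (n + 1) \<omega>} \<longleftrightarrow> n = ?N" for n
    using last_issue_eq[of "Z \<omega>" n t] last_issue_bounds[OF proper_Z[OF assms], of t] proper_Z[OF assms]
    by (auto simp: proper_path_def)
  then have "(\<integral>\<^sup>+ n. indicator {T n \<omega>..<T (n + 1) \<omega>} t * X n \<omega> \<partial>count_space UNIV) =
      (\<integral>\<^sup>+ n. X ?N \<omega> * indicator {?N} n \<partial>count_space UNIV)"
    by (intro nn_integral_cong) (auto simp: indicator_def)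
  then show ?thesis by (simp add: tip_count_def nn_integral_cmult)
qed

text \<open>The mean tip count at time t on the event that the latest issuance up to t fell into (0,
  1].\<close>

definition window :: "real \<Rightarrow> ennreal" where
  "window t = (\<integral>\<^sup>+ \<omega>. \<integral>\<^sup>+ n. indicator {0<..1} (T n \<omega>) * (indicator {T n \<omega>..<T (n + 1) \<omega>} t * X n \<omega>) \<partial>count_space UNIV \<partial>P)"

text \<open>
  Mass transport: a block issued in \<open>(i, i + 1]\<close> and current at time \<open>t\<close> is moved to one issued in
  \<open>(0, 1]\<close> and current at time \<open>t - i\<close>.
\<close>

lemma tip_count_windows:
  "(\<integral>\<^sup>+ \<omega>. of_nat (tip_count (Z \<omega>) 0) \<partial>P) = (\<integral>\<^sup>+ i. window (t - real_of_int i) \<partial>count_space UNIV)"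
proof -
  have one: "(\<integral>\<^sup>+ i. indicator {0<..1} (s - real_of_int i) \<partial>count_space UNIV) = (1 :: ennreal)" for s
  proof -
    have "s - real_of_int i \<in> {0<..1} \<longleftrightarrow> i = \<lceil>s\<rceil> - 1" for i
      by (auto; linarith)
    then have "(\<integral>\<^sup>+ i. indicator {0<..1} (s - real_of_int i) \<partial>count_space UNIV) =
        (\<integral>\<^sup>+ i. indicator {\<lceil>s\<rceil> - 1} i \<partial>count_space UNIV :: ennreal)"
      by (intro nn_integral_cong) (simp add: indicator_def)
    then show ?thesis by simp
  qed
  have Icc [measurable]: "(\<lambda>z :: 'n path. indicator {time_at z n..<time_at z (n + 1)} c :: ennreal) \<in> borel_measurable path_space" for n c
    unfolding indicator_def atLeastLessThan_iff by measurable
  have "(\<integral>\<^sup>+ \<omega>. of_nat (tip_count (Z \<omega>) 0) \<partial>P) =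
      (\<integral>\<^sup>+ \<omega>. \<integral>\<^sup>+ n. indicator {T n \<omega>..<T (n + 1) \<omega>} 0 * X n \<omega> \<partial>count_space UNIV \<partial>P)"
    by (intro nn_integral_cong tip_count_sum)
  also have "\<dots> = (\<integral>\<^sup>+ \<omega>. \<integral>\<^sup>+ n. indicator {T n \<omega>..<T (n + 1) \<omega>} t * X n \<omega> \<partial>count_space UNIV \<partial>P)"
    by (rule nn_integral_shift[where g = "\<lambda>n z. indicator {time_at z n..<time_at z (n + 1)} 0 * of_nat (obs_tips (state_at z n))"
          and g' = "\<lambda>s n z. indicator {time_at z n..<time_at z (n + 1)} s * of_nat (obs_tips (state_at z n))" and t = t])
      (measurable, simp add: indicator_def add.assoc)
  also have "\<dots> = (\<integral>\<^sup>+ \<omega>. \<integral>\<^sup>+ n. \<integral>\<^sup>+ i. indicator {0<..1} (T n \<omega> - real_of_int i) * (indicator {T n \<omega>..<T (n + 1) \<omega>} t * X n \<omega>)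
      \<partial>count_space UNIV \<partial>count_space UNIV \<partial>P)"
    by (simp add: nn_integral_multc one)
  also have "\<dots> = (\<integral>\<^sup>+ \<omega>. \<integral>\<^sup>+ i. \<integral>\<^sup>+ n. indicator {0<..1} (T n \<omega> - real_of_int i) * (indicator {T n \<omega>..<T (n + 1) \<omega>} t * X n \<omega>)
      \<partial>count_space UNIV \<partial>count_space UNIV \<partial>P)"
    by (intro nn_integral_cong nn_integral_count_space_nn_integral) simp_all
  also have "\<dots> = (\<integral>\<^sup>+ i. \<integral>\<^sup>+ \<omega>. \<integral>\<^sup>+ n. indicator {0<..1} (T n \<omega> - real_of_int i) * (indicator {T n \<omega>..<T (n + 1) \<omega>} t * X n \<omega>)
      \<partial>count_space UNIV \<partial>P \<partial>count_space UNIV)"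
  proof (rule nn_integral_count_space_nn_integral)
    fix i :: int
    show "(\<lambda>\<omega>. \<integral>\<^sup>+ n. indicator {0<..1} (T n \<omega> - real_of_int i) * (indicator {T n \<omega>..<T (n + 1) \<omega>} t * X n \<omega>)
      \<partial>count_space UNIV) \<in> borel_measurable P"
      using measurable_compose[OF measurable_Z Icc]
      by (intro borel_measurable_nn_integral_int) measurable
  qed simp
  also have "\<dots> = (\<integral>\<^sup>+ i. window (t - real_of_int i) \<partial>count_space UNIV)"
  proof (intro nn_integral_cong)
    fix i :: int
    show "(\<integral>\<^sup>+ \<omega>. \<integral>\<^sup>+ n. indicator {0<..1} (T n \<omega> - real_of_int i) * (indicator {T n \<omega>..<T (n + 1) \<omega>} t * X n \<omega>)
      \<partial>count_space UNIV \<partial>P) = window (t - real_of_int i)"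
      unfolding window_def
      by (rule nn_integral_shift[symmetric, where g = "\<lambda>n z. indicator {0<..1} (time_at z n) *
              (indicator {time_at z n..<time_at z (n + 1)} (t - real_of_int i) * of_nat (obs_tips (state_at z n)))"
            and g' = "\<lambda>s n z. indicator {0<..1} (time_at z n - s) *
              (indicator {time_at z n..<time_at z (n + 1)} (t - real_of_int i + s) * of_nat (obs_tips (state_at z n)))"
            and t = "real_of_int i", simplified])
        (measurable, simp add: indicator_def add.assoc algebra_simps)
  qed
  finally show ?thesis .
qed

lemma measurable_current:
  "(\<lambda>(\<omega>, t). indicator {0<..1} (T n \<omega>) * (indicator {T n \<omega>..<T (n + 1) \<omega>} t * X n \<omega>)) \<in> borel_measurable (P \<Otimes>\<^sub>M borel)"
  unfolding indicator_def atLeastLessThan_iff case_prod_unfold by measurable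

lemma mean_tip_count: "(\<integral>\<^sup>+ \<omega>. of_nat (tip_count (Z \<omega>) 0) \<partial>P) = (\<integral>\<^sup>+ y. of_nat (obs_tips y) \<partial>\<pi>)"
proof -
  interpret P: prob_space P by (rule prob_space_P)
  interpret PL: pair_sigma_finite P lborel ..
  let ?h = "\<lambda>n \<omega> t. indicator {0<..1} (T n \<omega>) * (indicator {T n \<omega>..<T (n + 1) \<omega>} t * X n \<omega>)"
  let ?I = "\<integral>\<^sup>+ \<omega>. of_nat (tip_count (Z \<omega>) 0) \<partial>P"
  have h1 [measurable]: "(\<lambda>\<omega>. ?h n \<omega> t) \<in> borel_measurable P" for n t
    using measurable_compose[OF measurable_Pair2'[of t borel P] measurable_current[of n]] by simp
  have h2 [measurable]: "(\<lambda>t. \<integral>\<^sup>+ \<omega>. ?h n \<omega> t \<partial>P) \<in> borel_measurable borel" for n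
  proof -
    have "(\<lambda>(t, \<omega>). ?h n \<omega> t) \<in> borel_measurable (borel \<Otimes>\<^sub>M P)"
      using measurable_compose[OF measurable_pair_swap' measurable_current[of n]] by (simp add: case_prod_unfold)
    then show ?thesis by (rule P.borel_measurable_nn_integral)
  qed
  have window: "window t = (\<integral>\<^sup>+ n. \<integral>\<^sup>+ \<omega>. ?h n \<omega> t \<partial>P \<partial>count_space UNIV)" for t
    unfolding window_def by (rule nn_integral_count_space_nn_integral) simp_all
  have window_meas: "window \<in> borel_measurable borel"
    unfolding window[abs_def] by (rule borel_measurable_nn_integral_int) simp
  \<comment> \<open>The window sum has the same value for every t, so it may be averaged over [0,
    1); unfolding the unit interval then integrates a single window over the whole line.\<close>
  have "?I = (\<integral>\<^sup>+ t. indicator {0..<1 :: real} t * ?I \<partial>lborel)"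
    by (subst nn_integral_multc) simp_all
  also have "\<dots> = (\<integral>\<^sup>+ t. indicator {0..<1} t * (\<integral>\<^sup>+ i. window (t - real_of_int i) \<partial>count_space UNIV) \<partial>lborel)"
    using tip_count_windows by simp
  also have "\<dots> = (\<integral>\<^sup>+ t. window t \<partial>lborel)"
    by (rule nn_integral_unit_intervals[OF window_meas, symmetric])
  also have "\<dots> = (\<integral>\<^sup>+ n. \<integral>\<^sup>+ t. \<integral>\<^sup>+ \<omega>. ?h n \<omega> t \<partial>P \<partial>lborel \<partial>count_space UNIV)"
    unfolding window by (rule nn_integral_count_space_nn_integral) simp_all
  also have "\<dots> = (\<integral>\<^sup>+ n. \<integral>\<^sup>+ \<omega>. \<integral>\<^sup>+ t. ?h n \<omega> t \<partial>lborel \<partial>P \<partial>count_space UNIV)"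
  proof (intro nn_integral_cong)
    fix n
    have "(\<lambda>(\<omega>, t). ?h n \<omega> t) \<in> borel_measurable (P \<Otimes>\<^sub>M lborel)"
      using measurable_current[of n] by (simp cong: measurable_cong_sets)
    from PL.Fubini'[OF this] show "(\<integral>\<^sup>+ t. \<integral>\<^sup>+ \<omega>. ?h n \<omega> t \<partial>P \<partial>lborel) = (\<integral>\<^sup>+ \<omega>. \<integral>\<^sup>+ t. ?h n \<omega> t \<partial>lborel \<partial>P)" .
  qed
  \<comment> \<open>The state is constant between issuances, so the time integral contributes the
    length of the gap.\<close>
  also have "\<dots> = (\<integral>\<^sup>+ n. \<integral>\<^sup>+ \<omega>. indicator {0<..1} (T n \<omega>) * (X n \<omega> * ennreal (T (n + 1) \<omega> - T n \<omega>)) \<partial>P \<partial>count_space UNIV)"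
  proof (intro nn_integral_cong)
    fix n \<omega> assume "\<omega> \<in> space P"
    then have "T n \<omega> \<le> T (n + 1) \<omega>" using proper_Z[of \<omega>] by (auto simp: proper_path_def strict_mono_def intro: less_imp_le)
    then show "(\<integral>\<^sup>+ t. ?h n \<omega> t \<partial>lborel) = indicator {0<..1} (T n \<omega>) * (X n \<omega> * ennreal (T (n + 1) \<omega> - T n \<omega>))"
      by (simp add: nn_integral_cmult nn_integral_multc mult.commute)
  qed
  also have "\<dots> = (\<integral>\<^sup>+ \<omega>. \<integral>\<^sup>+ n. indicator {0<..1} (T n \<omega>) * (X n \<omega> * ennreal (T (n + 1) \<omega> - T n \<omega>)) \<partial>count_space UNIV \<partial>P)"
    by (rule nn_integral_count_space_nn_integral[symmetric]) simp_all
  \<comment> \<open>Campbell's formula applies to the tip count at the root times the gap that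
    follows it. The gap is independent of the state at the root, and its mean cancels the factor
    rate.\<close>
  also have "\<dots> = ennreal rate * (\<integral>\<^sup>+ \<omega>. of_nat (obs_tips (Y 0 \<omega>)) * ennreal (G (0 + 1) \<omega>) \<partial>P0)"
    using nn_integral_palm[of "\<lambda>z. of_nat (obs_tips (state_at z 0)) * ennreal (gap_at z 1)"]
    by (simp add: gap_at_def)
  also have "\<dots> = (\<integral>\<^sup>+ \<omega>. of_nat (obs_tips (Y 0 \<omega>)) \<partial>P0)"
  proof -
    have "(\<lambda>\<omega>. of_nat (obs_tips (Y 0 \<omega>)) :: ennreal) \<in> borel_measurable (filt 0)"
      using measurable_filt(1)[OF order_refl, of 0] by measurable
    from nn_integral_next_gap[OF this] show ?thesis by (simp only: rate_inverse)
  qed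
  also have "\<dots> = (\<integral>\<^sup>+ y. of_nat (obs_tips y) \<partial>\<pi>)"
    by (rule nn_integral_state[where h = "\<lambda>y. of_nat (obs_tips y)"]) measurable
  finally show ?thesis .
qed

lemma AE_tip_count_Psi:
  "AE \<omega> in P. \<forall>t. of_nat (tip_count (Z \<omega>) t) = emeasure (Psi (Z \<omega>)) {(s, w). s \<le> t \<and> ennreal (t - s) < w}"
  using AE_balanced AE_space
proof eventually_elim
  case (elim \<omega>)
  then show ?case using tip_count_Psi[OF proper_Z] by blast
qed

end

theorem corollary4p2:
  fixes k :: nat and rate \<Delta> :: real
    and \<nu> :: "'n::finite pmf"
    and D :: "'n \<Rightarrow> ('n \<Rightarrow> real) measure"
    and \<pi> :: "'n state measure"
    and P0 :: "'a measure" and Z0 :: "'a \<Rightarrow> 'n path"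
  assumes k: "k \<ge> 2" and rate: "rate > 0" and \<Delta>: "\<Delta> \<ge> 0"
    and delay_prob: "\<And>i. prob_space (D i)"
    and delay_sets: "\<And>i. sets (D i) = sets (\<Pi>\<^sub>M j\<in>UNIV. borel)"
    and delay_issuer: "\<And>i. AE d in D i. d i = 0"
    and delay_bound: "\<And>i j. AE d in D i. 0 \<le> d j \<and> d j \<le> \<Delta>"
    and invariant: "invariant_distribution k \<Delta> rate \<nu> D \<pi>"
    and evolution: "stationary_evolution k \<Delta> rate \<nu> D \<pi> P0 Z0"
  shows "(\<integral>\<^sup>+ y. of_nat (obs_tips y) \<partial>\<pi>) = ennreal rate * (\<integral>\<^sup>+ \<omega>. lifetime (Z0 \<omega>) 0 \<partial>P0)
    \<and> (\<forall>(P :: 'b measure) Z. time_stationary rate P Z \<and> palm_version rate P Z P0 Z0 \<longrightarrow>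
          (\<integral>\<^sup>+ \<omega>. of_nat (tip_count (Z \<omega>) 0) \<partial>P) = ennreal rate * (\<integral>\<^sup>+ \<omega>. lifetime (Z0 \<omega>) 0 \<partial>P0)
        \<and> ennreal rate * (\<integral>\<^sup>+ \<omega>. lifetime (Z0 \<omega>) 0 \<partial>P0) = (\<integral>\<^sup>+ y. of_nat (obs_tips y) \<partial>\<pi>)
        \<and> (AE \<omega> in P. \<forall>t. of_nat (tip_count (Z \<omega>) t) =
              emeasure (Psi (Z \<omega>)) {(s, w). s \<le> t \<and> ennreal (t - s) < w}))
    \<and> (\<integral>\<^sup>+ \<omega>. lifetime (Z0 \<omega>) 0 \<partial>P0) < \<infinity>"
proof -
  have model: "block_model k rate \<Delta> D"
    by (rule block_model.intro) fact+
  interpret block_evolution k rate \<Delta> \<nu> D \<pi> P0 Z0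
    by (rule block_evolution.intro[OF model block_evolution_axioms.intro[OF invariant evolution]])
  have life: "(\<integral>\<^sup>+ \<omega>. lifetime (Z0 \<omega>) 0 \<partial>P0) < \<infinity>"
  proof -
    have "ennreal rate * (\<integral>\<^sup>+ \<omega>. lifetime (Z0 \<omega>) 0 \<partial>P0) < \<infinity>"
      using tip_expectation_finite by (simp only: mean_lifetime)
    then show ?thesis
      using rate by (auto simp: ennreal_mult_less_top)
  qed
  have "(\<integral>\<^sup>+ \<omega>. of_nat (tip_count (Z \<omega>) 0) \<partial>P) = (\<integral>\<^sup>+ y. of_nat (obs_tips y) \<partial>\<pi>) \<and>
      (AE \<omega> in P. \<forall>t. of_nat (tip_count (Z \<omega>) t) = emeasure (Psi (Z \<omega>)) {(s, w). s \<le> t \<and> ennreal (t - s) < w})"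
    if "time_stationary rate P Z" "palm_version rate P Z P0 Z0" for P :: "'b measure" and Z
  proof -
    interpret palm_pair k rate \<Delta> \<nu> D \<pi> P0 Z0 P Z
      by (rule palm_pair.intro[OF block_evolution_axioms palm_pair_axioms.intro[OF that]])
    show ?thesis using mean_tip_count AE_tip_count_Psi by blast
  qed
  with life mean_lifetime show ?thesis by simp
qed

end
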